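(* Let $(X_i)_{i\ge1}$ be a reversible Markov chain on a measurable space $(E,\Sigma)$ which is uniformly ergodic (see context), with constant $\rho$ as in the context. Let $\mathcal H$ be a set of functions $E\times E\to\mathbb R$ such that $(\mathcal H,\|\cdot\|_\infty)$ is compact and such that, for some $\theta>0$, $\log\mathcal N(\mathcal H,\eta)=\mathcal O(\eta^{-\theta})$. Let $f:E\to\mathbb R$ and let $\ell(h,x_1,x_2)=\varphi(f(x_1)-f(x_2),h(x_1,x_2))$, where $\varphi:\mathbb R\times\mathbb R\to[0,1]$ is Lipschitz in its second variable with finite Lipschitz constant. Let $h_0,h_1,\dots,h_n\in\mathcal H$ be the hypotheses generated by an arbitrary online algorithm working with the loss $\ell$. Let $\xi>0$, $q=\frac{\xi+1}{\log(1/\rho)}$, $b_n=\lfloor q\log n\rfloor$, $c\in(0,1)$, $c_n=\lceil cn\rceil$. Then $$\Big|\frac1{n-c_n}\sum_{t=c_n}^{n-1}\mathcal R(h_{t-b_n})-\mathcal M^n\Big|=\mathcal O_{\mathbb P}\Big[\frac{\log(n)\log(\log n)}{n^{\frac1{2+\theta}}}\Big].$$ Moreover, if the online learner has a regret bound $\mathfrak R_n$ (see context), then, with $h^*\in\arg\min_{h\in\mathcal H}\mathcal R(h)$, $$\frac1{n-c_n}\sum_{t=c_n}^{n-1}\mathcal R(h_{t-b_n})-\mathcal R(h^* )=\mathcal O_{\mathbb P}\Big[\frac{\log(n)\log(\log n)}{n^{\frac1{2+\theta}}}+\mathfrak R_n\Big].$$ The meaning of $\mathcal O_{\mathbb P}$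 is the one given in the context.
   Context: $\mathcal O_{\mathbb P}$: for real random variables $Y_n$ and positive reals $a_n$, $Y_n=\mathcal O_{\mathbb P}(a_n)$ means here that $(Y_n/a_n)_n$ converges to zero in probability as $n\to\infty$. Online algorithm: for each $t$, $h_t\in\mathcal H$ is selected on the basis of the observations $(X_i,f(X_i))_{1\le i\le t}$. Risk: $\mathcal R(h)=\mathbb E_{(X,X')\sim\pi\otimes\pi}[\ell(h,X,X')]$, where $\pi$ is the stationary distribution. Average paired empirical risk: for hypotheses $g_1,\dots,g_{n-1-b_n}$, $\mathcal M^n(g_1,\dots,g_{n-1-b_n})=\frac1{n-c_n}\sum_{t=c_n}^{n-1}\frac1{t-b_n}\sum_{i=1}^{t-b_n}\ell(g_{t-b_n},X_t,X_i)$, and $\mathcal M^n:=\mathcal M^n(h_1,\dots,h_{n-1-b_n})$; $n$ is assumed large enough that $c_n-b_n\ge1$. Regret bound: the online algorithm has regret bound $\mathfrak R_n$ if the hypotheses $h_1,\dots,h_{n-1}$ it produces satisfy $\mathcal M^n\le\min_{h\in\mathcal H}\mathcal M^n(h,\dots,h)+\mathfrak R_n$. Covering number: $\mathcal N(\mathcal H,\eta)$, $\eta>0$, is the smallest cardinality of a set $\{g_1,\dots,g_N\}\subset\mathcal H$ such that every $h\in\mathcal H$ satisfies $\|g_i-h\|_\infty\le\eta$ for some $i$. Uniform ergodicity: with transition kernel $P$, the chain is $\psi$-irreducible for some maximal irreducibility measure $\psi$, and there exist a natural number $m$, $\delta_m>0$ and a probability measure $\mu$ with $\delta_m\mu(A)\le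 P^m(x,A)$ for all $x\in E$, $A\in\Sigma$. Then there is a unique stationary distribution $\pi$ and there are constants $0<\rho<1$, $L>0$ with $\sup_{A\in\Sigma}|P^n(x,A)-\pi(A)|\le L\rho^n$ for all $n\ge0$ and $\pi$-a.e. $x$; such a $\rho$ is fixed.
   Formalization: The second display fails if O_P means ratio tending to 0 (constant bad learner, regret bound 1); proved instead: the positive part of excess risk minus the regret bound is O_P of the rate in that sense, and excess risk over rate plus regret bound is bounded in probability. *)

theory Defs
  imports "HOL-Probability.Probability" "HOL-Library.Landau_Symbols"
begin

section \<open>Markov chains on a measurable space\<close>

text \<open>A transition kernel on \<open>E\<close> is an element of \<open>E \<rightarrow>\<^sub>M prob_algebra E\<close>.\<close>

primrec kernel_power :: "'e measure \<Rightarrow> ('e \<Rightarrow> 'e measure) \<Rightarrow> nat \<Rightarrow> 'e \<Rightarrow> 'e measure" where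
  "kernel_power E P 0 x = return E x"
| "kernel_power E P (Suc n) x = kernel_power E P n x \<bind> P"

text \<open>The chain is indexed from 1; the value \<open>X 0\<close> is unconstrained. The initial distribution,
  i.e. the law of \<open>X 1\<close>, is arbitrary.\<close>

definition past :: "'w measure \<Rightarrow> 'e measure \<Rightarrow> (nat \<Rightarrow> 'w \<Rightarrow> 'e) \<Rightarrow> nat \<Rightarrow> 'w measure" where
  "past M E X t = vimage_algebra (space M) (\<lambda>\<omega>. \<lambda>i\<in>{1..t}. X i \<omega>) (Pi\<^sub>M {1..t} (\<lambda>_. E))"

definition markov_chain ::
    "'w measure \<Rightarrow> 'e measure \<Rightarrow> ('e \<Rightarrow> 'e measure) \<Rightarrow> (nat \<Rightarrow> 'w \<Rightarrow> 'e) \<Rightarrow> bool" where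
  "markov_chain M E P X \<longleftrightarrow>
     prob_space M \<and> P \<in> E \<rightarrow>\<^sub>M prob_algebra E \<and> (\<forall>i\<ge>1. X i \<in> M \<rightarrow>\<^sub>M E) \<and>
     (\<forall>t\<ge>1. \<forall>A\<in>sets E. AE \<omega> in M.
        real_cond_exp M (past M E X t) (\<lambda>\<omega>. indicator A (X (Suc t) \<omega>)) \<omega> = measure (P (X t \<omega>)) A)"

definition stationary_distribution ::
    "'e measure \<Rightarrow> ('e \<Rightarrow> 'e measure) \<Rightarrow> 'e measure \<Rightarrow> bool" where
  "stationary_distribution E P \<pi> \<longleftrightarrow> \<pi> \<in> space (prob_algebra E) \<and> \<pi> \<bind> P = \<pi>"

definition reversible_kernel ::
    "'e measure \<Rightarrow> ('e \<Rightarrow> 'e measure) \<Rightarrow> 'e measure \<Rightarrow> bool" where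
  "reversible_kernel E P \<pi> \<longleftrightarrow>
     (\<forall>A\<in>sets E. \<forall>B\<in>sets E.
        (\<integral>\<^sup>+x\<in>A. emeasure (P x) B \<partial>\<pi>) = (\<integral>\<^sup>+x\<in>B. emeasure (P x) A \<partial>\<pi>))"

definition irreducibility_measure ::
    "'e measure \<Rightarrow> ('e \<Rightarrow> 'e measure) \<Rightarrow> 'e measure \<Rightarrow> bool" where
  "irreducibility_measure E P \<psi> \<longleftrightarrow>
     sets \<psi> = sets E \<and> sigma_finite_measure \<psi> \<and> emeasure \<psi> (space E) \<noteq> 0 \<and>
     (\<forall>A\<in>sets E. emeasure \<psi> A > 0 \<longrightarrow>
        (\<forall>x\<in>space E. \<exists>n\<ge>1. emeasure (kernel_power E P n x) A > 0))"

definition maximal_irreducibility_measure ::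
    "'e measure \<Rightarrow> ('e \<Rightarrow> 'e measure) \<Rightarrow> 'e measure \<Rightarrow> bool" where
  "maximal_irreducibility_measure E P \<psi> \<longleftrightarrow>
     irreducibility_measure E P \<psi> \<and>
     (\<forall>\<psi>'. irreducibility_measure E P \<psi>' \<longrightarrow> absolutely_continuous \<psi> \<psi>')"

definition uniformly_ergodic :: "'e measure \<Rightarrow> ('e \<Rightarrow> 'e measure) \<Rightarrow> bool" where
  "uniformly_ergodic E P \<longleftrightarrow>
     (\<exists>\<psi>. maximal_irreducibility_measure E P \<psi>) \<and>
     (\<exists>(m::nat) (\<delta>::real) \<mu>. \<delta> > 0 \<and> \<mu> \<in> space (prob_algebra E) \<and>
        (\<forall>x\<in>space E. \<forall>A\<in>sets E. \<delta> * measure \<mu> A \<le> measure (kernel_power E P m x) A))"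

definition ergodicity_rate ::
    "'e measure \<Rightarrow> ('e \<Rightarrow> 'e measure) \<Rightarrow> 'e measure \<Rightarrow> real \<Rightarrow> bool" where
  "ergodicity_rate E P \<pi> \<rho> \<longleftrightarrow>
     0 < \<rho> \<and> \<rho> < 1 \<and>
     (\<exists>L>0. \<forall>n. AE x in \<pi>.
        (SUP A\<in>sets E. \<bar>measure (kernel_power E P n x) A - measure \<pi> A\<bar>) \<le> L * \<rho> ^ n)"


section \<open>Hypothesis classes\<close>

text \<open>Hypotheses are bounded functions on \<open>E \<times> E\<close> with the supremum metric. The library metric
  space \<open>funspace\<close> represents a function on a set by its extension with value \<open>undefined\<close>
  outside that set.\<close>

abbreviation sup_metric :: "'e measure \<Rightarrow> ('e \<times> 'e \<Rightarrow> real) metric" where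
  "sup_metric E \<equiv> funspace (space (E \<Otimes>\<^sub>M E)) euclidean_metric"

definition covering_number :: "'e measure \<Rightarrow> ('e \<times> 'e \<Rightarrow> real) set \<Rightarrow> real \<Rightarrow> nat" where
  "covering_number E H \<eta> =
     (LEAST N. \<exists>G. G \<subseteq> H \<and> finite G \<and> card G = N \<and>
        (\<forall>h\<in>H. \<exists>g\<in>G. mdist (sup_metric E) g h \<le> \<eta>))"

text \<open>The class \<open>H\<close> with the Borel sigma-algebra of the supremum metric.\<close>

definition borel_class ::
    "'e measure \<Rightarrow> ('e \<times> 'e \<Rightarrow> real) set \<Rightarrow> ('e \<times> 'e \<Rightarrow> real) measure" where
  "borel_class E H = sigma H {U. openin (subtopology (mtopology_of (sup_metric E)) H) U}"


section \<open>Pairwise losses and online learning\<close>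

definition pair_loss ::
    "(real \<Rightarrow> real \<Rightarrow> real) \<Rightarrow> ('e \<Rightarrow> real) \<Rightarrow> ('e \<times> 'e \<Rightarrow> real) \<Rightarrow> 'e \<Rightarrow> 'e \<Rightarrow> real" where
  "pair_loss \<phi> f h x\<^sub>1 x\<^sub>2 = \<phi> (f x\<^sub>1 - f x\<^sub>2) (h (x\<^sub>1, x\<^sub>2))"

definition risk ::
    "(('e \<times> 'e \<Rightarrow> real) \<Rightarrow> 'e \<Rightarrow> 'e \<Rightarrow> real) \<Rightarrow> 'e measure \<Rightarrow> ('e \<times> 'e \<Rightarrow> real) \<Rightarrow> real" where
  "risk l \<pi> h = (\<integral>z. l h (fst z) (snd z) \<partial>(\<pi> \<Otimes>\<^sub>M \<pi>))"

text \<open>An algorithm maps, for each \<open>t\<close>, the observations at times \<open>1, \<dots>, t\<close> measurably to a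
  hypothesis.\<close>

definition online_algorithm ::
    "'e measure \<Rightarrow> ('e \<times> 'e \<Rightarrow> real) set \<Rightarrow>
     (nat \<Rightarrow> (nat \<Rightarrow> 'e \<times> real) \<Rightarrow> ('e \<times> 'e \<Rightarrow> real)) \<Rightarrow> bool" where
  "online_algorithm E H alg \<longleftrightarrow>
     (\<forall>t. alg t \<in> Pi\<^sub>M {1..t} (\<lambda>_. E \<Otimes>\<^sub>M borel) \<rightarrow>\<^sub>M borel_class E H)"

definition generated_hypothesis ::
    "(nat \<Rightarrow> (nat \<Rightarrow> 'e \<times> real) \<Rightarrow> ('e \<times> 'e \<Rightarrow> real)) \<Rightarrow> ('e \<Rightarrow> real) \<Rightarrow>
     (nat \<Rightarrow> 'w \<Rightarrow> 'e) \<Rightarrow> 'w \<Rightarrow> nat \<Rightarrow> ('e \<times> 'e \<Rightarrow> real)" where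
  "generated_hypothesis alg f X \<omega> t = alg t (\<lambda>i\<in>{1..t}. (X i \<omega>, f (X i \<omega>)))"

text \<open>Here \<open>b\<close> and \<open>c\<close> are the sequences \<open>b\<^sub>n\<close> and \<open>c\<^sub>n\<close>, \<open>g\<close> is a sequence of hypotheses, and
  \<open>x\<close> is a trajectory. The subtraction \<open>t - b n\<close> does not truncate once \<open>b n < c n\<close>.\<close>

definition paired_empirical_risk ::
    "(('e \<times> 'e \<Rightarrow> real) \<Rightarrow> 'e \<Rightarrow> 'e \<Rightarrow> real) \<Rightarrow> (nat \<Rightarrow> nat) \<Rightarrow> (nat \<Rightarrow> nat) \<Rightarrow>
     (nat \<Rightarrow> 'e \<times> 'e \<Rightarrow> real) \<Rightarrow> (nat \<Rightarrow> 'e) \<Rightarrow> nat \<Rightarrow> real" where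
  "paired_empirical_risk l b c g x n =
     1 / (real n - real (c n)) *
       (\<Sum>t\<in>{c n..<n}. 1 / (real t - real (b n)) *
          (\<Sum>i = 1..t - b n. l (g (t - b n)) (x t) (x i)))"

definition average_risk ::
    "(('e \<times> 'e \<Rightarrow> real) \<Rightarrow> 'e \<Rightarrow> 'e \<Rightarrow> real) \<Rightarrow> 'e measure \<Rightarrow> (nat \<Rightarrow> nat) \<Rightarrow> (nat \<Rightarrow> nat) \<Rightarrow>
     (nat \<Rightarrow> 'e \<times> 'e \<Rightarrow> real) \<Rightarrow> nat \<Rightarrow> real" where
  "average_risk l \<pi> b c g n =
     1 / (real n - real (c n)) * (\<Sum>t\<in>{c n..<n}. risk l \<pi> (g (t - b n)))"

definition regret_bound ::
    "'w measure \<Rightarrow> (('e \<times> 'e \<Rightarrow> real) \<Rightarrow> 'e \<Rightarrow> 'e \<Rightarrow> real) \<Rightarrow> (nat \<Rightarrow> nat) \<Rightarrow> (nat \<Rightarrow> nat) \<Rightarrow>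
     ('e \<times> 'e \<Rightarrow> real) set \<Rightarrow> (nat \<Rightarrow> 'w \<Rightarrow> 'e) \<Rightarrow>
     ('w \<Rightarrow> nat \<Rightarrow> 'e \<times> 'e \<Rightarrow> real) \<Rightarrow> (nat \<Rightarrow> real) \<Rightarrow> bool" where
  "regret_bound M l b c H X hyp R \<longleftrightarrow>
     (\<forall>n. c n \<ge> b n + 1 \<longrightarrow> (AE \<omega> in M.
        paired_empirical_risk l b c (hyp \<omega>) (\<lambda>i. X i \<omega>) n
          \<le> (INF h\<in>H. paired_empirical_risk l b c (\<lambda>_. h) (\<lambda>i. X i \<omega>) n) + R n))"


section \<open>Stochastic orders\<close>

text \<open>\<open>negligible_in_prob M Y a\<close>: the ratio \<open>Y n / a n\<close> converges to zero in probability.\<close>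

definition negligible_in_prob ::
    "'w measure \<Rightarrow> (nat \<Rightarrow> 'w \<Rightarrow> real) \<Rightarrow> (nat \<Rightarrow> real) \<Rightarrow> bool" where
  "negligible_in_prob M Y a \<longleftrightarrow>
     (\<forall>\<epsilon>>0. (\<lambda>n. measure M {\<omega>\<in>space M. \<bar>Y n \<omega> / a n\<bar> > \<epsilon>}) \<longlonglongrightarrow> 0)"

text \<open>\<open>bounded_in_prob M Y a\<close>: the ratio \<open>Y n / a n\<close> is asymptotically tight.
  For a term \<open>a\<close> containing a regret bound this cannot be sharpened to \<open>negligible_in_prob\<close>:
  a learner that always plays a constant bad hypothesis has a constant regret bound, and its excess
  risk is of the same order.\<close>

definition bounded_in_prob ::
    "'w measure \<Rightarrow> (nat \<Rightarrow> 'w \<Rightarrow> real) \<Rightarrow> (nat \<Rightarrow> real) \<Rightarrow> bool" where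
  "bounded_in_prob M Y a \<longleftrightarrow>
     (\<forall>\<epsilon>>0. \<exists>K. \<forall>\<^sub>F n in sequentially. measure M {\<omega>\<in>space M. \<bar>Y n \<omega> / a n\<bar> > K} \<le> \<epsilon>)"

end

theory Submission
  imports Defs "HOL-Real_Asymp.Real_Asymp"
begin

text \<open>Write \<open>s = t - b\<^sub>n\<close> and \<open>F\<^sub>s(y) = (1/s) \<Sum>i\<le>s. l(h\<^sub>s, y, X\<^sub>i)\<close>, so that the summands compared are
  \<open>\<R>(h\<^sub>s)\<close> and \<open>F\<^sub>s(X\<^sub>t)\<close>. With \<open>T\<close> the transition operator, the difference splits into three parts.
  The terms \<open>F\<^sub>s(X\<^sub>t) - T^b\<^sub>n F\<^sub>s(X\<^sub>s)\<close> are bounded and orthogonal at time distance at least \<open>b\<^sub>n\<close>, so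
  Chebyshev's inequality suffices. The difference \<open>T^b\<^sub>n F\<^sub>s(X\<^sub>s) - \<pi> F\<^sub>s\<close> is \<open>O(\<rho>^b\<^sub>n)\<close> off a \<open>\<pi>\<close>-null
  set, which the chain visits at times \<open>\<ge> c\<^sub>n - b\<^sub>n\<close> with exponentially small probability by Doeblin
  contraction, whatever the initial law. Finally \<open>\<pi> F\<^sub>s - \<R>(h\<^sub>s)\<close> is an additive functional of the chain,
  controlled uniformly over the class by a Hoeffding--Azuma bound for the martingale of a truncated
  Poisson sum of length of order \<open>log n\<close> and a union bound over a covering of \<open>H\<close>; this is where the rate
  \<open>n^(-1/(2+\<theta>))\<close> arises. The excess risk bound follows by applying the first claim also to the algorithm
  that always outputs \<open>h*\<close>.\<close>

section \<open>Transition operators\<close>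

text \<open>Two ergodicity statements enter because neither does both jobs. \<open>b_n\<close> is
  tuned to \<open>\<rho>\<close>, and the bound with \<open>\<rho>\<close> holds only almost
  everywhere for \<open>\<pi>\<close>; the Doeblin contraction holds at every point, but with a rate
  unrelated to \<open>\<rho>\<close>. The former is used only at lag \<open>b_n\<close>; being a
  total variation bound, it has one null set for all test functions, the random \<open>F_s\<close>
  included. The covering is needed because \<open>h_s\<close> depends on the very points over which
  the sum runs. Exponents: a Poisson sum of length of order \<open>log n\<close> has range of that
  order, so at deviation \<open>r = \<zeta> log n log log n / n^\<kappa>\<close> the Azuma exponent
  is of order \<open>n r^2 / (log n)^2\<close>, that is
  \<open>(log log n)^2 n^(1 - 2\<kappa>)\<close>, while the entropy at radius \<open>r\<close> is at
  most of order \<open>n^(\<kappa>\<theta>)\<close>. Equal powers give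
  \<open>\<kappa> = 1/(2 + \<theta>)\<close>. In the rate, \<open>log n\<close> pays for the range,
  and \<open>log log n\<close> makes the deviation term win for every \<open>\<zeta>\<close>, as
  convergence to zero in probability demands.\<close>

lemma integral_bind_bounded:
  fixes g :: "'b \<Rightarrow> real"
  assumes M: "prob_space M" and K: "K \<in> M \<rightarrow>\<^sub>M prob_algebra N"
    and g[measurable]: "g \<in> borel_measurable N" and bound: "\<And>y. y \<in> space N \<Longrightarrow> \<bar>g y\<bar> \<le> B"
  shows "(\<integral>y. g y \<partial>(M \<bind> K)) = (\<integral>x. (\<integral>y. g y \<partial>K x) \<partial>M)"
proof -
  interpret prob_space M by fact
  have K'[measurable]: "K \<in> M \<rightarrow>\<^sub>M subprob_algebra N"
    using K by (rule measurable_prob_algebraD)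
  have Kx: "prob_space (K x)" "sets (K x) = sets N" "space (K x) = space N" if "x \<in> space M" for x
    using measurable_space[OF K that] sets_eq_imp_space_eq[of "K x" N]
    by (auto simp: space_prob_algebra)
  have sets_bind: "sets (M \<bind> K) = sets N"
    by (intro sets_bind) (auto simp: Kx not_empty)
  have space_bind: "space (M \<bind> K) = space N"
    using sets_bind by (rule sets_eq_imp_space_eq)
  interpret MK: prob_space "M \<bind> K"
    by (intro prob_space_bind[OF _ K']) (auto simp: Kx)
  have lower': "0 \<le> u + B \<Longrightarrow> -B \<le> u" for u by simp
  have lower: "0 \<le> g y + B" if "y \<in> space N" for y
    using bound[OF that] by auto
  have int_bind: "integrable (M \<bind> K) g"
    by (rule MK.integrable_const_bound[where B=B]) (auto simp: space_bind bound sets_bind cong: measurable_cong_sets)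
  have int_K: "integrable (K x) g" if "x \<in> space M" for x
  proof -
    interpret Kx: prob_space "K x" using Kx that by auto
    show ?thesis
      by (rule Kx.integrable_const_bound[where B=B]) (auto simp: Kx that bound cong: measurable_cong_sets)
  qed
  have meas[measurable]: "(\<lambda>x. \<integral>y. g y \<partial>K x) \<in> borel_measurable M"
    by measurable
  have avg: "\<bar>\<integral>y. g y \<partial>K x\<bar> \<le> B" if "x \<in> space M" for x
  proof -
    interpret Kx: prob_space "K x" using Kx that by auto
    have "(\<integral>y. g y \<partial>K x) \<le> B"
      by (rule Kx.integral_le_const[OF int_K[OF that]]) (use bound Kx that in \<open>auto simp: abs_le_iff\<close>)
    moreover have "-B \<le> (\<integral>y. g y \<partial>K x)"
      by (rule Kx.integral_ge_const[OF int_K[OF that]]) (auto simp: Kx that intro!: lower' lower)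
    ultimately show ?thesis by auto
  qed
  have avg': "0 \<le> (\<integral>y. g y \<partial>K x) + B" if "x \<in> space M" for x
    using avg[OF that] by auto
  have int_avg: "integrable M (\<lambda>x. \<integral>y. g y \<partial>K x)"
    by (rule integrable_const_bound[where B=B]) (auto simp: avg)
  \<comment> \<open>Adding \<open>B\<close> makes the integrand nonnegative, so the identity can be
    taken from \<open>nn_integral_bind\<close>; both shifted integrals are nonnegative, hence
    \<open>ennreal\<close> can be cancelled at the end.\<close>
  have "ennreal ((\<integral>y. g y \<partial>(M \<bind> K)) + B) = (\<integral>\<^sup>+y. ennreal (g y + B) \<partial>(M \<bind> K))"
  proof -
    have "(\<integral>\<^sup>+y. ennreal (g y + B) \<partial>(M \<bind> K)) = ennreal (\<integral>y. g y + B \<partial>(M \<bind> K))"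
      by (rule nn_integral_eq_integral) (use int_bind lower in \<open>auto simp: space_bind\<close>)
    then show ?thesis using int_bind by (simp add: MK.prob_space)
  qed
  also have "\<dots> = (\<integral>\<^sup>+x. (\<integral>\<^sup>+y. ennreal (g y + B) \<partial>K x) \<partial>M)"
    by (rule nn_integral_bind[OF _ K']) measurable
  also have "\<dots> = (\<integral>\<^sup>+x. ennreal ((\<integral>y. g y \<partial>K x) + B) \<partial>M)"
  proof (rule nn_integral_cong)
    fix x assume x: "x \<in> space M"
    interpret Kx: prob_space "K x" using Kx x by auto
    have "(\<integral>\<^sup>+y. ennreal (g y + B) \<partial>K x) = ennreal (\<integral>y. g y + B \<partial>K x)"
      by (rule nn_integral_eq_integral) (use int_K[OF x] lower Kx x in auto)
    then show "(\<integral>\<^sup>+y. ennreal (g y + B) \<partial>K x) = ennreal ((\<integral>y. g y \<partial>K x) + B)"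
      using int_K[OF x] by (simp add: Kx.prob_space)
  qed
  also have "\<dots> = ennreal (\<integral>x. (\<integral>y. g y \<partial>K x) + B \<partial>M)"
    by (rule nn_integral_eq_integral) (use int_avg avg' in auto)
  also have "\<dots> = ennreal ((\<integral>x. (\<integral>y. g y \<partial>K x) \<partial>M) + B)"
    using int_avg by (simp add: prob_space)
  finally have eq: "ennreal ((\<integral>y. g y \<partial>(M \<bind> K)) + B) = ennreal ((\<integral>x. (\<integral>y. g y \<partial>K x) \<partial>M) + B)" .
  have "-B \<le> (\<integral>y. g y \<partial>(M \<bind> K))"
    by (rule MK.integral_ge_const[OF int_bind]) (auto simp: space_bind intro!: lower' lower)
  moreover have "-B \<le> (\<integral>x. (\<integral>y. g y \<partial>K x) \<partial>M)"
    by (rule integral_ge_const[OF int_avg]) (auto intro!: lower' avg')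
  ultimately show ?thesis
    using eq by simp
qed

definition transition :: "('e \<Rightarrow> 'e measure) \<Rightarrow> ('e \<Rightarrow> real) \<Rightarrow> 'e \<Rightarrow> real" where
  "transition P g x = (\<integral>y. g y \<partial>P x)"

locale markov_kernel =
  fixes E :: "'e measure" and P :: "'e \<Rightarrow> 'e measure"
  assumes kernel: "P \<in> E \<rightarrow>\<^sub>M prob_algebra E"
begin

abbreviation T :: "('e \<Rightarrow> real) \<Rightarrow> 'e \<Rightarrow> real" where "T \<equiv> transition P"

lemma kernel_subprob[measurable]: "P \<in> E \<rightarrow>\<^sub>M subprob_algebra E"
  using kernel by (rule measurable_prob_algebraD)

lemma kernel_at:
  assumes "x \<in> space E"
  shows "prob_space (P x)" "sets (P x) = sets E" "space (P x) = space E"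
  using measurable_space[OF kernel assms] sets_eq_imp_space_eq[of "P x" E]
  by (auto simp: space_prob_algebra)

text \<open>The parameter \<open>w\<close> will be the observed past, because the functions to which
  \<open>T\<close> is applied are themselves random. Carrying \<open>w\<close> along as a point mass
  turns the integral over \<open>P x\<close> into the integral of one fixed function against a
  measurable kernel on the product.\<close>

lemma transition_pow_parametric_measurable:
  assumes "(\<lambda>(w, y). \<Psi> w y) \<in> borel_measurable (N \<Otimes>\<^sub>M E)"
  shows "(\<lambda>(w, x). (T ^^ k) (\<Psi> w) x) \<in> borel_measurable (N \<Otimes>\<^sub>M E)"
proof (induction k)
  case 0
  then show ?case using assms by simp
next
  case (Suc k)
  have eq: "(\<lambda>(w, x). (T ^^ Suc k) (\<Psi> w) x)
      = (\<lambda>z. \<integral>y. (T ^^ k) (\<Psi> (fst z)) y \<partial>P (snd z))"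
    by (auto simp: transition_def fun_eq_iff)
  have [measurable]: "(\<lambda>z. (T ^^ k) (\<Psi> (fst z)) (snd z)) \<in> borel_measurable (N \<Otimes>\<^sub>M E)"
    using Suc by (simp add: case_prod_beta)
  have K: "(\<lambda>z. distr (P (snd z)) (N \<Otimes>\<^sub>M E) (\<lambda>y. (fst z, y))) \<in> N \<Otimes>\<^sub>M E \<rightarrow>\<^sub>M subprob_algebra (N \<Otimes>\<^sub>M E)"
    by (rule measurable_distr2[where M=E]) measurable
  have "(\<lambda>z. \<integral>u. (T ^^ k) (\<Psi> (fst u)) (snd u) \<partial>distr (P (snd z)) (N \<Otimes>\<^sub>M E) (\<lambda>y. (fst z, y)))
      \<in> borel_measurable (N \<Otimes>\<^sub>M E)"
    by (rule measurable_compose[OF K]) measurable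
  also have "?this \<longleftrightarrow> ?case"
    unfolding eq
  proof (rule measurable_cong)
    fix z assume z: "z \<in> space (N \<Otimes>\<^sub>M E)"
    then have "fst z \<in> space N" "snd z \<in> space E" by (auto simp: space_pair_measure)
    then show "(\<integral>u. (T ^^ k) (\<Psi> (fst u)) (snd u) \<partial>distr (P (snd z)) (N \<Otimes>\<^sub>M E) (\<lambda>y. (fst z, y)))
      = (\<integral>y. (T ^^ k) (\<Psi> (fst z)) y \<partial>P (snd z))"
      by (subst integral_distr) (auto simp: kernel_at cong: measurable_cong_sets)
  qed
  finally show ?case .
qed

lemma transition_pow_measurable[measurable]:
  assumes g: "g \<in> borel_measurable E"
  shows "(T ^^ k) g \<in> borel_measurable E"
proof -
  have "(\<lambda>(w, x). (T ^^ k) g x) \<in> borel_measurable (count_space {()} \<Otimes>\<^sub>M E)"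
    by (rule transition_pow_parametric_measurable) (use g in measurable)
  from measurable_Pair2[OF this, of "()"] show ?thesis by simp
qed

lemma transition_measurable[measurable]: "g \<in> borel_measurable E \<Longrightarrow> T g \<in> borel_measurable E"
  using transition_pow_measurable[of g 1] by simp

lemma kernel_integrable:
  fixes g :: "'e \<Rightarrow> real"
  assumes "x \<in> space E" "g \<in> borel_measurable E" "\<And>y. y \<in> space E \<Longrightarrow> g y \<in> {a..b}"
  shows "integrable (P x) g"
proof -
  interpret prob_space "P x" by (rule kernel_at) fact
  show ?thesis
  proof (rule integrable_const_bound[where B="max \<bar>a\<bar> \<bar>b\<bar>"])
    show "AE y in P x. norm (g y) \<le> max \<bar>a\<bar> \<bar>b\<bar>"
      using assms(3) by (intro AE_I2) (force simp: kernel_at[OF assms(1)])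
  qed (use assms in \<open>auto simp: kernel_at cong: measurable_cong_sets\<close>)
qed

lemma transition_range:
  assumes "g \<in> borel_measurable E" "\<And>y. y \<in> space E \<Longrightarrow> g y \<in> {a..b}" "x \<in> space E"
  shows "T g x \<in> {a..b}"
proof -
  interpret prob_space "P x" by (rule kernel_at) fact
  have i: "integrable (P x) g" using assms by (intro kernel_integrable) auto
  show ?thesis
    unfolding transition_def using assms
    by (auto intro!: integral_le_const[OF i] integral_ge_const[OF i] simp: kernel_at)
qed

lemma transition_pow_range:
  assumes "g \<in> borel_measurable E" "\<And>y. y \<in> space E \<Longrightarrow> g y \<in> {a..b}" "x \<in> space E"
  shows "(T ^^ k) g x \<in> {a..b}"
  using assms(3)
proof (induction k arbitrary: x)
  case 0
  then show ?case using assms by auto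
next
  case (Suc k)
  then show ?case using transition_range[of "(T ^^ k) g" a b x] assms(1) by simp
qed

lemma transition_cong:
  assumes "\<And>y. y \<in> space E \<Longrightarrow> g y = g' y" "x \<in> space E"
  shows "T g x = T g' x"
  unfolding transition_def using assms by (intro Bochner_Integration.integral_cong) (auto simp: kernel_at)

lemma transition_pow_cong:
  assumes "\<And>y. y \<in> space E \<Longrightarrow> g y = g' y" "x \<in> space E"
  shows "(T ^^ k) g x = (T ^^ k) g' x"
  using assms(2) by (induction k arbitrary: x) (auto simp: assms(1) intro!: transition_cong)

lemma transition_pow_affine:
  assumes g: "g \<in> borel_measurable E" "\<And>y. y \<in> space E \<Longrightarrow> g y \<in> {a..b}" and x: "x \<in> space E"
  shows "(T ^^ k) (\<lambda>y. p + s * g y) x = p + s * (T ^^ k) g x"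
  using x
proof (induction k arbitrary: x)
  case (Suc k)
  interpret Px: prob_space "P x" by (rule kernel_at[OF Suc.prems])
  have int: "integrable (P x) ((T ^^ k) g)"
    using g(1) transition_pow_range[OF g] by (intro kernel_integrable[OF Suc.prems]) auto
  have "(T ^^ Suc k) (\<lambda>y. p + s * g y) x = T (\<lambda>z. p + s * (T ^^ k) g z) x"
    using Suc by (auto intro!: transition_cong)
  also have "\<dots> = p + s * T ((T ^^ k) g) x"
    using int by (simp add: transition_def Px.prob_space)
  finally show ?case by simp
qed simp

lemma kernel_power_prob:
  assumes "x \<in> space E"
  shows "kernel_power E P n x \<in> space (prob_algebra E)"
proof (induction n)
  case 0
  then show ?case using assms by (auto simp: space_prob_algebra prob_space_return)
next
  case (Suc n)
  then interpret prob_space "kernel_power E P n x" by (simp add: space_prob_algebra)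
  have s: "sets (kernel_power E P n x) = sets E" "space (kernel_power E P n x) = space E"
    using Suc sets_eq_imp_space_eq[of "kernel_power E P n x" E] by (auto simp: space_prob_algebra)
  show ?case
    unfolding space_prob_algebra kernel_power.simps
  proof safe
    show "prob_space (kernel_power E P n x \<bind> P)"
      by (intro prob_space_bind[where S=E]) (auto simp: kernel_at s cong: measurable_cong_sets)
    have "space (kernel_power E P n x) \<noteq> {}" using s assms by auto
    then have "sets (kernel_power E P n x \<bind> P) = sets E"
      by (intro sets_bind) (auto simp: kernel_at s)
    then show "\<And>y. y \<in> sets (kernel_power E P n x \<bind> P) \<Longrightarrow> y \<in> sets E"
      and "\<And>y. y \<in> sets E \<Longrightarrow> y \<in> sets (kernel_power E P n x \<bind> P)"
      by auto
  qed
qed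

text \<open>\<open>kernel_power\<close> appends the new step at the end, so that step is absorbed
  into the test function; the induction therefore ranges over arbitrary \<open>g\<close>.\<close>

lemma integral_kernel_power:
  assumes "x \<in> space E" "g \<in> borel_measurable E" "\<And>y. y \<in> space E \<Longrightarrow> g y \<in> {a..b}"
  shows "(\<integral>y. g y \<partial>kernel_power E P n x) = (T ^^ n) g x"
  using assms(2,3)
proof (induction n arbitrary: g)
  case 0
  then show ?case using assms by (simp add: integral_return)
next
  case (Suc n)
  have K: "kernel_power E P n x \<in> space (prob_algebra E)" by (rule kernel_power_prob) fact
  have bd: "\<bar>g y\<bar> \<le> max \<bar>a\<bar> \<bar>b\<bar>" if "y \<in> space E" for y
    using Suc.prems(2)[OF that] by auto
  have "(\<integral>y. g y \<partial>kernel_power E P (Suc n) x) = (\<integral>z. T g z \<partial>kernel_power E P n x)"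
    unfolding kernel_power.simps transition_def
    by (rule integral_bind_bounded[where N=E and B="max \<bar>a\<bar> \<bar>b\<bar>"])
      (use K kernel bd Suc.prems in \<open>auto simp: space_prob_algebra cong: measurable_cong_sets\<close>)
  also have "\<dots> = (T ^^ n) (T g) x"
    by (rule Suc.IH) (use Suc.prems transition_range[of g a b] in auto)
  finally show ?case by (simp add: funpow_swap1)
qed

end

section \<open>The Markov property for past-measurable statistics\<close>

locale markov_process = markov_kernel E P + prob_space M
  for M :: "'w measure" and E :: "'e measure" and P :: "'e \<Rightarrow> 'e measure" +
  fixes X :: "nat \<Rightarrow> 'w \<Rightarrow> 'e"
  assumes chain: "markov_chain M E P X"
begin

lemma X_measurable: "1 \<le> i \<Longrightarrow> X i \<in> M \<rightarrow>\<^sub>M E"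
  using chain by (auto simp: markov_chain_def)

lemma X_space: "1 \<le> i \<Longrightarrow> \<omega> \<in> space M \<Longrightarrow> X i \<omega> \<in> space E"
  using X_measurable measurable_space by metis

definition trajectory :: "nat \<Rightarrow> 'w \<Rightarrow> nat \<Rightarrow> 'e" where
  "trajectory t \<omega> = (\<lambda>i\<in>{1..t}. X i \<omega>)"

lemma trajectory_space: "trajectory t \<in> space M \<rightarrow> space (Pi\<^sub>M {1..t} (\<lambda>_. E))"
  by (auto simp: trajectory_def space_PiM PiE_iff intro!: X_space)

lemma trajectory_measurable: "trajectory t \<in> past M E X t \<rightarrow>\<^sub>M Pi\<^sub>M {1..t} (\<lambda>_. E)"
  using measurable_vimage_algebra1[OF trajectory_space]
  unfolding past_def trajectory_def .

lemma space_past[simp]: "space (past M E X t) = space M"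
  by (simp add: past_def)

lemma past_measurableI:
  assumes "h \<in> Pi\<^sub>M {1..t} (\<lambda>_. E) \<rightarrow>\<^sub>M N" "\<And>\<omega>. \<omega> \<in> space M \<Longrightarrow> W \<omega> = h (trajectory t \<omega>)"
  shows "W \<in> past M E X t \<rightarrow>\<^sub>M N"
  using measurable_compose[OF trajectory_measurable assms(1)] assms(2)
  by (subst measurable_cong) auto

lemma X_past_measurable: "1 \<le> i \<Longrightarrow> i \<le> t \<Longrightarrow> X i \<in> past M E X t \<rightarrow>\<^sub>M E"
  by (rule past_measurableI[where h="\<lambda>x. x i"]) (auto simp: trajectory_def)

lemma past_mono_measurable:
  assumes "W \<in> past M E X s \<rightarrow>\<^sub>M N" "s \<le> t"
  shows "W \<in> past M E X t \<rightarrow>\<^sub>M N"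
proof -
  have "(\<lambda>\<omega>. \<lambda>i\<in>{1..s}. X i \<omega>) \<in> past M E X t \<rightarrow>\<^sub>M Pi\<^sub>M {1..s} (\<lambda>_. E)"
    using X_past_measurable assms(2) by (intro measurable_restrict) auto
  then have "(\<lambda>\<omega>. \<omega>) \<in> past M E X t \<rightarrow>\<^sub>M past M E X s"
    unfolding past_def[of _ _ _ s] by (intro measurable_vimage_algebra2) auto
  from measurable_compose[OF this assms(1)] show ?thesis .
qed

lemma past_measurable_M: "W \<in> past M E X t \<rightarrow>\<^sub>M N \<Longrightarrow> W \<in> M \<rightarrow>\<^sub>M N"
proof -
  assume W: "W \<in> past M E X t \<rightarrow>\<^sub>M N"
  have "(\<lambda>\<omega>. \<lambda>i\<in>{1..t}. X i \<omega>) \<in> M \<rightarrow>\<^sub>M Pi\<^sub>M {1..t} (\<lambda>_. E)"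
    using X_measurable by (intro measurable_restrict) auto
  then have "(\<lambda>\<omega>. \<omega>) \<in> M \<rightarrow>\<^sub>M past M E X t"
    unfolding past_def by (intro measurable_vimage_algebra2) auto
  from measurable_compose[OF this W] show ?thesis .
qed

lemma subalgebra_past: "subalgebra M (past M E X t)"
unfolding subalgebra_def
proof
  show "sets (past M E X t) \<subseteq> sets M"
  proof
    fix A assume A: "A \<in> sets (past M E X t)"
    then have "(\<lambda>\<omega>. indicator A \<omega> :: real) \<in> borel_measurable (past M E X t)" by measurable
    then have "(\<lambda>\<omega>. indicator A \<omega> :: real) \<in> borel_measurable M" by (rule past_measurable_M)
    moreover have "A \<subseteq> space M" using sets.sets_into_space[OF A] by simp
    ultimately show "A \<in> sets M"
      by (simp add: borel_measurable_indicator_iff inf.absorb1)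
  qed
qed simp

text \<open>The one-step Markov identity is almost sure for each fixed target set. Integrating it
  over a past event is the defining property of the conditional expectation.\<close>

lemma markov_rectangle:
  assumes t: "1 \<le> t" and A: "A \<in> sets (past M E X t)" and B[measurable]: "B \<in> sets E"
  shows "prob {\<omega>\<in>space M. \<omega> \<in> A \<and> X (Suc t) \<omega> \<in> B} = (\<integral>\<omega>. indicator A \<omega> * measure (P (X t \<omega>)) B \<partial>M)"
proof -
  note X_measurable[measurable]
  interpret sigma_finite_subalgebra M "past M E X t"
    by (rule finite_measure_subalgebra_is_sigma_finite)
      (simp_all add: subalgebra_past finite_measure_subalgebra_def finite_measure_axioms finite_measure_subalgebra_axioms_def)
  have [measurable]: "A \<in> sets M" using A subalgebra_past by (auto simp: subalgebra_def)
  have [measurable]: "X (Suc t) \<in> M \<rightarrow>\<^sub>M E" "X t \<in> M \<rightarrow>\<^sub>M E" using t by auto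
  have "prob {\<omega>\<in>space M. \<omega> \<in> A \<and> X (Suc t) \<omega> \<in> B}
      = (\<integral>\<omega>. indicator {\<omega>\<in>space M. \<omega> \<in> A \<and> X (Suc t) \<omega> \<in> B} \<omega> \<partial>M)"
    by simp
  also have "\<dots> = (\<integral>\<omega>. indicator A \<omega> * indicator B (X (Suc t) \<omega>) \<partial>M)"
    by (intro Bochner_Integration.integral_cong) (auto simp: indicator_def)
  also have "\<dots> = (\<integral>\<omega>. indicator A \<omega> * real_cond_exp M (past M E X t) (\<lambda>\<omega>. indicator B (X (Suc t) \<omega>)) \<omega> \<partial>M)"
    by (rule real_cond_exp_intg(2)[symmetric])
      (use A in \<open>auto intro!: integrable_const_bound[where B=1] simp: indicator_def\<close>)
  also have "\<dots> = (\<integral>\<omega>. indicator A \<omega> * measure (P (X t \<omega>)) B \<partial>M)"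
  proof (rule integral_cong_AE)
    have "AE \<omega> in M. real_cond_exp M (past M E X t) (\<lambda>\<omega>. indicator B (X (Suc t) \<omega>)) \<omega> = measure (P (X t \<omega>)) B"
      using chain t B by (auto simp: markov_chain_def)
    then show "AE \<omega> in M. indicator A \<omega> * real_cond_exp M (past M E X t) (\<lambda>\<omega>. indicator B (X (Suc t) \<omega>)) \<omega>
        = indicator A \<omega> * measure (P (X t \<omega>)) B" by auto
  qed measurable
  finally show ?thesis .
qed

text \<open>The freezing lemma: given the past, \<open>W\<close> behaves as a constant.
  \<open>K \<omega>\<close> is the candidate conditional law of \<open>(W, X (Suc t))\<close>, the
  point mass at \<open>W \<omega>\<close> times \<open>P (X t \<omega>)\<close>. Mixing
  \<open>K\<close> over \<open>M\<close> agrees with the joint law on rectangles, which generate the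
  product sigma-algebra and are stable under intersection.\<close>

lemma markov_step:
  fixes \<Psi> :: "'n \<Rightarrow> 'e \<Rightarrow> real"
  assumes t: "1 \<le> t" and W: "W \<in> past M E X t \<rightarrow>\<^sub>M N"
    and \<Psi>: "(\<lambda>(w, y). \<Psi> w y) \<in> borel_measurable (N \<Otimes>\<^sub>M E)"
    and bound: "\<And>w y. w \<in> space N \<Longrightarrow> y \<in> space E \<Longrightarrow> \<bar>\<Psi> w y\<bar> \<le> B"
  shows "(\<integral>\<omega>. \<Psi> (W \<omega>) (X (Suc t) \<omega>) \<partial>M) = (\<integral>\<omega>. T (\<Psi> (W \<omega>)) (X t \<omega>) \<partial>M)"
proof -
  have Xm[measurable]: "X (Suc t) \<in> M \<rightarrow>\<^sub>M E" "X t \<in> M \<rightarrow>\<^sub>M E"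
    using X_measurable t by auto
  have Wm[measurable]: "W \<in> M \<rightarrow>\<^sub>M N" using W by (rule past_measurable_M)
  define K where "K \<omega> = distr (P (X t \<omega>)) (N \<Otimes>\<^sub>M E) (\<lambda>y. (W \<omega>, y))" for \<omega>
  have K_sub: "K \<in> M \<rightarrow>\<^sub>M subprob_algebra (N \<Otimes>\<^sub>M E)"
    unfolding K_def by (rule measurable_distr2[where M=E]) measurable
  have pair[measurable]: "(\<lambda>y. (W \<omega>, y)) \<in> P (X t \<omega>) \<rightarrow>\<^sub>M N \<Otimes>\<^sub>M E" if "\<omega> \<in> space M" for \<omega>
    using measurable_space[OF Wm that] kernel_at[OF X_space[OF t that]]
    by (auto cong: measurable_cong_sets)
  have K: "K \<in> M \<rightarrow>\<^sub>M prob_algebra (N \<Otimes>\<^sub>M E)"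
    using K_sub unfolding K_def
    by (intro measurable_prob_algebraI prob_space.prob_space_distr kernel_at X_space t) auto
  have sets_K: "sets (K \<omega>) = sets (N \<Otimes>\<^sub>M E)" for \<omega> by (simp add: K_def)
  have law: "distr M (N \<Otimes>\<^sub>M E) (\<lambda>\<omega>. (W \<omega>, X (Suc t) \<omega>)) = M \<bind> K"
  proof (rule measure_eqI_generator_eq[OF Int_stable_pair_measure_generator[of N E] pair_measure_closed])
    fix Z assume "Z \<in> {a \<times> b |a b. a \<in> sets N \<and> b \<in> sets E}"
    then obtain a b where Z: "Z = a \<times> b" and [measurable]: "a \<in> sets N" "b \<in> sets E" by auto
    have "emeasure (distr M (N \<Otimes>\<^sub>M E) (\<lambda>\<omega>. (W \<omega>, X (Suc t) \<omega>))) Z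
        = emeasure M {\<omega>\<in>space M. \<omega> \<in> W -` a \<inter> space M \<and> X (Suc t) \<omega> \<in> b}"
      unfolding Z by (subst emeasure_distr) (auto intro!: arg_cong[where f="emeasure M"])
    also have "\<dots> = ennreal (\<integral>\<omega>. indicator (W -` a \<inter> space M) \<omega> * measure (P (X t \<omega>)) b \<partial>M)"
      using markov_rectangle[OF t, of "W -` a \<inter> space M" b] measurable_sets[OF W, of a]
      by (simp add: emeasure_eq_measure)
    also have "\<dots> = (\<integral>\<^sup>+\<omega>. ennreal (indicator (W -` a \<inter> space M) \<omega> * measure (P (X t \<omega>)) b) \<partial>M)"
    proof (rule nn_integral_eq_integral[symmetric])
      show "integrable M (\<lambda>\<omega>. indicator (W -` a \<inter> space M) \<omega> * measure (P (X t \<omega>)) b)"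
      proof (rule integrable_const_bound[where B=1])
        show "AE \<omega> in M. norm (indicator (W -` a \<inter> space M) \<omega> * measure (P (X t \<omega>)) b) \<le> 1"
          using prob_space.prob_le_1[OF kernel_at(1)[OF X_space[OF t]]]
          by (intro AE_I2) (auto simp: indicator_def)
      qed measurable
    qed (auto simp: indicator_def)
    also have "\<dots> = (\<integral>\<^sup>+\<omega>. emeasure (K \<omega>) Z \<partial>M)"
    proof (rule nn_integral_cong)
      fix \<omega> assume \<omega>: "\<omega> \<in> space M"
      interpret K: prob_space "P (X t \<omega>)" using kernel_at X_space t \<omega> by auto
      have "emeasure (K \<omega>) Z = emeasure (P (X t \<omega>)) ((\<lambda>y. (W \<omega>, y)) -` Z \<inter> space (P (X t \<omega>)))"
        unfolding K_def Z by (subst emeasure_distr) (use pair \<omega> in auto)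
      also have "(\<lambda>y. (W \<omega>, y)) -` Z \<inter> space (P (X t \<omega>)) = (if W \<omega> \<in> a then b else {})"
        using sets.sets_into_space[of b E] kernel_at X_space t \<omega> by (auto simp: Z)
      finally show "ennreal (indicator (W -` a \<inter> space M) \<omega> * measure (P (X t \<omega>)) b) = emeasure (K \<omega>) Z"
        using \<omega> by (auto simp: indicator_def K.emeasure_eq_measure)
    qed
    also have "\<dots> = emeasure (M \<bind> K) Z"
      by (rule emeasure_bind[OF _ K_sub, symmetric]) (auto simp: not_empty Z)
    finally show "emeasure (distr M (N \<Otimes>\<^sub>M E) (\<lambda>\<omega>. (W \<omega>, X (Suc t) \<omega>))) Z = emeasure (M \<bind> K) Z" .
  next
    show "sets (M \<bind> K) = sigma_sets (space N \<times> space E) {a \<times> b |a b. a \<in> sets N \<and> b \<in> sets E}"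
      by (subst sets_bind[where N="N \<Otimes>\<^sub>M E"]) (auto simp: sets_K not_empty sets_pair_measure)
    show "range (\<lambda>_::nat. space N \<times> space E) \<subseteq> {a \<times> b |a b. a \<in> sets N \<and> b \<in> sets E}" by auto
    show "emeasure (distr M (N \<Otimes>\<^sub>M E) (\<lambda>\<omega>. (W \<omega>, X (Suc t) \<omega>))) (space N \<times> space E) \<noteq> \<infinity>"
      by (subst emeasure_distr) (auto simp: emeasure_eq_measure)
  qed (auto simp: sets_pair_measure)
  have \<Psi>'[measurable]: "(\<lambda>z. \<Psi> (fst z) (snd z)) \<in> borel_measurable (N \<Otimes>\<^sub>M E)"
    using \<Psi> by (simp add: case_prod_beta)
  have "(\<integral>\<omega>. \<Psi> (W \<omega>) (X (Suc t) \<omega>) \<partial>M) = (\<integral>z. \<Psi> (fst z) (snd z) \<partial>(M \<bind> K))"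
    unfolding law[symmetric] by (subst integral_distr) auto
  also have "\<dots> = (\<integral>\<omega>. (\<integral>z. \<Psi> (fst z) (snd z) \<partial>K \<omega>) \<partial>M)"
    by (rule integral_bind_bounded[OF prob_space_axioms K \<Psi>', of B]) (auto simp: bound space_pair_measure)
  also have "\<dots> = (\<integral>\<omega>. T (\<Psi> (W \<omega>)) (X t \<omega>) \<partial>M)"
    unfolding K_def transition_def
    by (intro Bochner_Integration.integral_cong refl, subst integral_distr) (use pair in auto)
  finally show ?thesis .
qed

text \<open>The last of the \<open>k\<close> steps is peeled off by replacing \<open>\<Psi>\<close>
  with its image under \<open>T\<close>; \<open>W\<close> stays measurable for every later
  past.\<close>

lemma markov_steps_aux:
  fixes \<Psi> :: "'n \<Rightarrow> 'e \<Rightarrow> real"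
  assumes t: "1 \<le> t" and W: "W \<in> past M E X t \<rightarrow>\<^sub>M N"
    and "(\<lambda>(w, y). \<Psi> w y) \<in> borel_measurable (N \<Otimes>\<^sub>M E)"
    and "\<And>w y. w \<in> space N \<Longrightarrow> y \<in> space E \<Longrightarrow> \<bar>\<Psi> w y\<bar> \<le> B"
  shows "(\<integral>\<omega>. \<Psi> (W \<omega>) (X (t + k) \<omega>) \<partial>M) = (\<integral>\<omega>. (T ^^ k) (\<Psi> (W \<omega>)) (X t \<omega>) \<partial>M)"
  using assms(3,4)
proof (induction k arbitrary: \<Psi>)
  case 0
  then show ?case by simp
next
  case (Suc k)
  have sec: "\<Psi> w \<in> borel_measurable E" if "w \<in> space N" for w
    using measurable_Pair2[OF Suc.prems(1) that] by simp
  have "(\<integral>\<omega>. \<Psi> (W \<omega>) (X (t + Suc k) \<omega>) \<partial>M) = (\<integral>\<omega>. T (\<Psi> (W \<omega>)) (X (t + k) \<omega>) \<partial>M)"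
    using markov_step[of "t + k" W N \<Psi> B] t past_mono_measurable[OF W] Suc.prems by simp
  also have "\<dots> = (\<integral>\<omega>. (T ^^ k) (T (\<Psi> (W \<omega>))) (X t \<omega>) \<partial>M)"
  proof (rule Suc.IH)
    show "(\<lambda>(w, y). T (\<Psi> w) y) \<in> borel_measurable (N \<Otimes>\<^sub>M E)"
      using transition_pow_parametric_measurable[OF Suc.prems(1), of 1] by simp
    show "\<bar>T (\<Psi> w) y\<bar> \<le> B" if "w \<in> space N" "y \<in> space E" for w y
      using transition_range[of "\<Psi> w" "-B" B y] sec Suc.prems(2) that by (fastforce simp: abs_le_iff)
  qed
  finally show ?case by (simp add: funpow_swap1)
qed

lemma markov_steps:
  fixes \<Psi> :: "'n \<Rightarrow> 'e \<Rightarrow> real"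
  assumes t: "1 \<le> t" and W: "W \<in> past M E X t \<rightarrow>\<^sub>M N"
    and \<Psi>: "(\<lambda>(w, y). \<Psi> w y) \<in> borel_measurable (N \<Otimes>\<^sub>M E)"
    and bound: "\<And>\<omega> y. \<omega> \<in> space M \<Longrightarrow> y \<in> space E \<Longrightarrow> \<bar>\<Psi> (W \<omega>) y\<bar> \<le> B"
  shows "(\<integral>\<omega>. \<Psi> (W \<omega>) (X (t + k) \<omega>) \<partial>M) = (\<integral>\<omega>. (T ^^ k) (\<Psi> (W \<omega>)) (X t \<omega>) \<partial>M)"
proof -
  \<comment> \<open>The bound is assumed only at realized values of \<open>W\<close>, since later
    \<open>W\<close> has a real component ranging over all of \<open>borel\<close>. Clipping makes
    \<open>\<Psi>\<close> bounded everywhere without changing it at those values.\<close>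
  define \<Psi>' where "\<Psi>' w y = max (-\<bar>B\<bar>) (min \<bar>B\<bar> (\<Psi> w y))" for w y
  have eq: "\<Psi>' (W \<omega>) y = \<Psi> (W \<omega>) y" if "\<omega> \<in> space M" "y \<in> space E" for \<omega> y
    using bound[OF that] by (auto simp: \<Psi>'_def)
  have \<Psi>'_meas: "(\<lambda>(w, y). \<Psi>' w y) \<in> borel_measurable (N \<Otimes>\<^sub>M E)"
    using \<Psi> by (simp add: \<Psi>'_def case_prod_beta)
  have "(\<integral>\<omega>. \<Psi>' (W \<omega>) (X (t + k) \<omega>) \<partial>M) = (\<integral>\<omega>. (T ^^ k) (\<Psi>' (W \<omega>)) (X t \<omega>) \<partial>M)"
    by (rule markov_steps_aux[OF t W \<Psi>'_meas, of "\<bar>B\<bar>"]) (auto simp: \<Psi>'_def)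
  moreover have "(\<integral>\<omega>. \<Psi>' (W \<omega>) (X (t + k) \<omega>) \<partial>M) = (\<integral>\<omega>. \<Psi> (W \<omega>) (X (t + k) \<omega>) \<partial>M)"
    using t by (intro Bochner_Integration.integral_cong) (auto intro!: eq X_space)
  moreover have "(\<integral>\<omega>. (T ^^ k) (\<Psi>' (W \<omega>)) (X t \<omega>) \<partial>M) = (\<integral>\<omega>. (T ^^ k) (\<Psi> (W \<omega>)) (X t \<omega>) \<partial>M)"
    using t by (intro Bochner_Integration.integral_cong refl transition_pow_cong eq X_space)
  ultimately show ?thesis by simp
qed

end

section \<open>Concentration for additive functionals\<close>

text \<open>To be applied in the probability space \<open>P x\<close>, where it becomes the
  conditional Hoeffding bound for a single martingale increment.\<close>

lemma (in prob_space) Hoeffding_lemma_bounded: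
  fixes G :: "'a \<Rightarrow> real"
  assumes G[measurable]: "G \<in> borel_measurable M" and range: "\<And>y. y \<in> space M \<Longrightarrow> G y \<in> {0..r}"
    and "\<kappa> > 0"
  shows "(\<integral>y. exp (\<kappa> * (G y - expectation G)) \<partial>M) \<le> exp (\<kappa>\<^sup>2 * r\<^sup>2 / 8)"
proof -
  interpret interval_bounded_random_variable M G 0 r
    by unfold_locales (use range in auto)
  have ex: "\<bar>expectation G\<bar> \<le> \<bar>r\<bar>"
    using integral_ge_const[OF integrable, of 0] integral_le_const[OF integrable, of r] range by force
  have "integrable M (\<lambda>y. exp (\<kappa> * (G y - expectation G)))"
  proof (rule integrable_const_bound[where B="exp (\<kappa> * (r + \<bar>r\<bar>))"])
    show "AE y in M. norm (exp (\<kappa> * (G y - expectation G))) \<le> exp (\<kappa> * (r + \<bar>r\<bar>))"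
    proof (rule AE_I2)
      fix y assume "y \<in> space M"
      then have "G y - expectation G \<le> r + \<bar>r\<bar>" using range[of y] ex by auto
      then show "norm (exp (\<kappa> * (G y - expectation G))) \<le> exp (\<kappa> * (r + \<bar>r\<bar>))"
        using \<open>\<kappa> > 0\<close> by simp
    qed
  qed measurable
  then have "ennreal (\<integral>y. exp (\<kappa> * (G y - expectation G)) \<partial>M)
      = (\<integral>\<^sup>+y. exp (\<kappa> * (G y - expectation G)) \<partial>M)"
    by (subst nn_integral_eq_integral) auto
  also have "\<dots> \<le> ennreal (exp (\<kappa>\<^sup>2 * (r - 0)\<^sup>2 / 8))"
    by (rule Hoeffdings_lemma_nn_integral) fact
  finally show ?thesis by simp
qed

section \<open>Azuma bound for the martingale of a bounded function\<close>

context markov_process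
begin

text \<open>A martingale: \<open>T G (X i)\<close> is the conditional mean of
  \<open>G (X (Suc i))\<close> given the past up to time \<open>i\<close>. The value at
  \<open>n\<close> involves the chain up to time \<open>Suc n\<close>.\<close>

definition increments :: "('e \<Rightarrow> real) \<Rightarrow> nat \<Rightarrow> 'w \<Rightarrow> real" where
  "increments G n \<omega> = (\<Sum>i = 1..n. G (X (Suc i) \<omega>) - T G (X i \<omega>))"

lemma increments_past_measurable:
  assumes "G \<in> borel_measurable E"
  shows "increments G n \<in> borel_measurable (past M E X (Suc n))"
  unfolding increments_def
  using assms by (intro borel_measurable_sum borel_measurable_diff measurable_compose[OF X_past_measurable])
    auto

lemma abs_increments_le:
  assumes "G \<in> borel_measurable E" "\<And>y. y \<in> space E \<Longrightarrow> G y \<in> {0..r}" "\<omega> \<in> space M"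
  shows "\<bar>increments G n \<omega>\<bar> \<le> real n * r"
proof -
  have "\<bar>increments G n \<omega>\<bar> \<le> (\<Sum>i = 1..n. r)"
    unfolding increments_def
  proof (rule order_trans[OF sum_abs sum_mono])
    fix i assume "i \<in> {1..n}"
    then have "X (Suc i) \<omega> \<in> space E" "X i \<omega> \<in> space E"
      using assms(3) by (auto intro!: X_space)
    then have "G (X (Suc i) \<omega>) \<in> {0..r}" "T G (X i \<omega>) \<in> {0..r}"
      using assms(1,2) by (blast intro: transition_range)+
    then show "\<bar>G (X (Suc i) \<omega>) - T G (X i \<omega>)\<bar> \<le> r" by auto
  qed
  then show ?thesis by simp
qed

text \<open>Conditionally on the past up to \<open>Suc n\<close>, the newest increment is a centred
  variable whose law lives in an interval of length \<open>r\<close>, so each step costs one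
  Hoeffding factor with \<open>r\<close> itself rather than the bound \<open>2 * r\<close> obtained
  from absolute values.\<close>

lemma increments_exp_moment:
  assumes G: "G \<in> borel_measurable E" and range: "\<And>y. y \<in> space E \<Longrightarrow> G y \<in> {0..r}"
    and \<kappa>: "\<kappa> > 0"
  shows "integrable M (\<lambda>\<omega>. exp (\<kappa> * increments G n \<omega>))"
    and "expectation (\<lambda>\<omega>. exp (\<kappa> * increments G n \<omega>)) \<le> exp (real n * (\<kappa>\<^sup>2 * r\<^sup>2 / 8))"
proof -
  have meas[measurable]: "increments G n \<in> borel_measurable M" for n
    using increments_past_measurable[OF G] by (rule past_measurable_M)
  have bound: "exp (\<kappa> * increments G n \<omega>) \<le> exp (\<kappa> * (real n * r))" if "\<omega> \<in> space M" for n \<omega>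
    using abs_increments_le[OF G range that, of n] \<kappa> by auto
  show int: "integrable M (\<lambda>\<omega>. exp (\<kappa> * increments G n \<omega>))" for n
    by (rule integrable_const_bound[where B="exp (\<kappa> * (real n * r))"]) (auto simp del: exp_le_cancel_iff intro!: bound AE_I2)
  show "expectation (\<lambda>\<omega>. exp (\<kappa> * increments G n \<omega>)) \<le> exp (real n * (\<kappa>\<^sup>2 * r\<^sup>2 / 8))"
  proof (induction n)
    case 0
    then show ?case by (simp add: increments_def prob_space)
  next
    case (Suc n)
    \<comment> \<open>\<open>W\<close> collects what is frozen at time \<open>Suc n\<close>: the
      accumulated sum and the current state, on which the centring of the next increment
      depends.\<close>
    define W where "W \<omega> = (increments G n \<omega>, X (Suc n) \<omega>)" for \<omega>
    define \<Psi> where "\<Psi> w y = exp (\<kappa> * (fst w + (G y - T G (snd w))))" for w y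
    have W: "W \<in> past M E X (Suc n) \<rightarrow>\<^sub>M borel \<Otimes>\<^sub>M E"
      unfolding W_def using increments_past_measurable[OF G] X_past_measurable[of "Suc n" "Suc n"]
      by measurable
    have \<Psi>: "(\<lambda>(w, y). \<Psi> w y) \<in> borel_measurable ((borel \<Otimes>\<^sub>M E) \<Otimes>\<^sub>M E)"
      unfolding \<Psi>_def using G by measurable
    have TG: "T G x \<in> {0..r}" if "x \<in> space E" for x
      using transition_range[OF G range that] by auto
    have step: "increments G (Suc n) \<omega> = increments G n \<omega> + (G (X (Suc n + 1) \<omega>) - T G (X (Suc n) \<omega>))" for \<omega>
      by (simp add: increments_def)
    have \<Psi>_bound: "\<bar>\<Psi> (W \<omega>) y\<bar> \<le> exp (\<kappa> * (real n * r + r))" if "\<omega> \<in> space M" "y \<in> space E" for \<omega> y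
    proof -
      have "increments G n \<omega> \<le> real n * r" using abs_increments_le[OF G range that(1), of n] by auto
      moreover have "G y - T G (X (Suc n) \<omega>) \<le> r"
        using range[OF that(2)] TG[OF X_space[OF _ that(1), of "Suc n"]] by auto
      ultimately show ?thesis
        using \<kappa> unfolding \<Psi>_def W_def by (auto intro!: mult_left_mono add_mono)
    qed
    have "expectation (\<lambda>\<omega>. exp (\<kappa> * increments G (Suc n) \<omega>)) = (\<integral>\<omega>. \<Psi> (W \<omega>) (X (Suc n + 1) \<omega>) \<partial>M)"
      by (simp add: step \<Psi>_def W_def)
    also have "\<dots> = (\<integral>\<omega>. (T ^^ 1) (\<Psi> (W \<omega>)) (X (Suc n) \<omega>) \<partial>M)"
      by (rule markov_steps[OF _ W \<Psi> \<Psi>_bound]) auto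
    also have "\<dots> \<le> (\<integral>\<omega>. exp (\<kappa> * increments G n \<omega>) * exp (\<kappa>\<^sup>2 * r\<^sup>2 / 8) \<partial>M)"
    proof (rule integral_mono)
      have Wm: "W \<in> M \<rightarrow>\<^sub>M borel \<Otimes>\<^sub>M E" using W by (rule past_measurable_M)
      have T1_meas: "(\<lambda>\<omega>. (T ^^ 1) (\<Psi> (W \<omega>)) (X (Suc n) \<omega>)) \<in> borel_measurable M"
        using measurable_compose[OF measurable_Pair[OF Wm X_measurable[of "Suc n"]]
            transition_pow_parametric_measurable[OF \<Psi>, of 1]] by simp
      have sec: "\<Psi> (W \<omega>) \<in> borel_measurable E" if "\<omega> \<in> space M" for \<omega>
        using measurable_Pair2[OF \<Psi>, of "W \<omega>"] measurable_space[OF Wm that] by simp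
      have "(T ^^ 1) (\<Psi> (W \<omega>)) (X (Suc n) \<omega>) \<in> {- exp (\<kappa> * (real n * r + r))..exp (\<kappa> * (real n * r + r))}"
        if "\<omega> \<in> space M" for \<omega>
      proof (rule transition_pow_range[OF sec[OF that] _ X_space[OF _ that]])
        show "\<Psi> (W \<omega>) y \<in> {- exp (\<kappa> * (real n * r + r))..exp (\<kappa> * (real n * r + r))}"
          if "y \<in> space E" for y
          using \<Psi>_bound[OF \<open>\<omega> \<in> space M\<close> that] unfolding abs_le_iff atLeastAtMost_iff by (simp del: exp_le_cancel_iff)
      qed simp
      then have "norm ((T ^^ 1) (\<Psi> (W \<omega>)) (X (Suc n) \<omega>)) \<le> exp (\<kappa> * (real n * r + r))"
        if "\<omega> \<in> space M" for \<omega>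
        using that unfolding real_norm_def abs_le_iff atLeastAtMost_iff by (metis minus_le_iff)
      then show "integrable M (\<lambda>\<omega>. (T ^^ 1) (\<Psi> (W \<omega>)) (X (Suc n) \<omega>))"
        by (intro integrable_const_bound[where B="exp (\<kappa> * (real n * r + r))"] AE_I2 T1_meas)
      show "integrable M (\<lambda>\<omega>. exp (\<kappa> * increments G n \<omega>) * exp (\<kappa>\<^sup>2 * r\<^sup>2 / 8))"
        using int by simp
      fix \<omega> assume \<omega>: "\<omega> \<in> space M"
      let ?x = "X (Suc n) \<omega>"
      have x: "?x \<in> space E" using \<omega> by (simp add: X_space)
      interpret Px: prob_space "P ?x" by (rule kernel_at[OF x])
      have "(T ^^ 1) (\<Psi> (W \<omega>)) ?x
          = exp (\<kappa> * increments G n \<omega>) * (\<integral>y. exp (\<kappa> * (G y - Px.expectation G)) \<partial>P ?x)"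
        by (simp add: transition_def \<Psi>_def W_def distrib_left exp_add)
      also have "\<dots> \<le> exp (\<kappa> * increments G n \<omega>) * exp (\<kappa>\<^sup>2 * r\<^sup>2 / 8)"
        using G range \<kappa> by (intro mult_left_mono Px.Hoeffding_lemma_bounded)
          (auto simp: kernel_at[OF x] cong: measurable_cong_sets)
      finally show "(T ^^ 1) (\<Psi> (W \<omega>)) ?x \<le> exp (\<kappa> * increments G n \<omega>) * exp (\<kappa>\<^sup>2 * r\<^sup>2 / 8)" .
    qed
    also have "\<dots> \<le> exp (real n * (\<kappa>\<^sup>2 * r\<^sup>2 / 8)) * exp (\<kappa>\<^sup>2 * r\<^sup>2 / 8)"
      using Suc by simp
    also have "\<dots> = exp (real (Suc n) * (\<kappa>\<^sup>2 * r\<^sup>2 / 8))"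
      by (simp add: exp_add[symmetric] field_simps)
    finally show ?case .
  qed
qed

lemma increments_upper_tail:
  assumes G: "G \<in> borel_measurable E" and range: "\<And>y. y \<in> space E \<Longrightarrow> G y \<in> {0..r}"
    and n: "n \<ge> 1" and r: "r > 0" and u: "u > 0"
  shows "prob {\<omega>\<in>space M. increments G n \<omega> \<ge> u} \<le> exp (- 2 * u\<^sup>2 / (n * r\<^sup>2))"
proof -
  \<comment> \<open>The minimizer of \<open>n * \<kappa>^2 * r^2 / 8 - \<kappa> * u\<close>, the
    exponent left by the exponential Markov inequality.\<close>
  define \<kappa> where "\<kappa> = 4 * u / (n * r\<^sup>2)"
  have \<kappa>: "\<kappa> > 0" using n r u by (auto simp: \<kappa>_def)
  have [measurable]: "increments G n \<in> borel_measurable M"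
    using increments_past_measurable[OF G] by (rule past_measurable_M)
  have "prob {\<omega>\<in>space M. increments G n \<omega> \<ge> u} = prob {\<omega>\<in>space M. exp (\<kappa> * increments G n \<omega>) \<ge> exp (\<kappa> * u)}"
    using \<kappa> by simp
  also have "\<dots> \<le> expectation (\<lambda>\<omega>. exp (\<kappa> * increments G n \<omega>)) / exp (\<kappa> * u)"
    by (rule integral_Markov_inequality_measure[where A="{}"]) (auto intro: increments_exp_moment[OF G range \<kappa>])
  also have "\<dots> \<le> exp (real n * (\<kappa>\<^sup>2 * r\<^sup>2 / 8)) / exp (\<kappa> * u)"
    by (intro divide_right_mono increments_exp_moment[OF G range \<kappa>]) auto
  also have "\<dots> = exp (real n * (\<kappa>\<^sup>2 * r\<^sup>2 / 8) - \<kappa> * u)" by (simp add: exp_diff)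
  also have "real n * (\<kappa>\<^sup>2 * r\<^sup>2 / 8) - \<kappa> * u = - 2 * u\<^sup>2 / (n * r\<^sup>2)"
    using n r by (simp add: \<kappa>_def field_simps power2_eq_square)
  finally show ?thesis .
qed

lemma increments_tail:
  assumes G: "G \<in> borel_measurable E" and range: "\<And>y. y \<in> space E \<Longrightarrow> G y \<in> {0..r}"
    and n: "n \<ge> 1" and r: "r > 0" and u: "u > 0"
  shows "prob {\<omega>\<in>space M. \<bar>increments G n \<omega>\<bar> \<ge> u} \<le> 2 * exp (- 2 * u\<^sup>2 / (n * r\<^sup>2))"
proof -
  \<comment> \<open>Reflection inside \<open>{0..r}\<close> instead of plain negation: the range
    hypothesis survives and the increments change sign.\<close>
  let ?G = "\<lambda>y. r - G y"
  have G': "?G \<in> borel_measurable E" using G by simp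
  have meas[measurable]: "increments G n \<in> borel_measurable M" "increments ?G n \<in> borel_measurable M"
    using increments_past_measurable[OF G] increments_past_measurable[OF G'] by (auto intro: past_measurable_M)
  have neg: "increments ?G n \<omega> = - increments G n \<omega>" if \<omega>: "\<omega> \<in> space M" for \<omega>
  proof -
    have "T ?G (X i \<omega>) = r - T G (X i \<omega>)" if "i \<in> {1..n}" for i
    proof -
      have x: "X i \<omega> \<in> space E" using that \<omega> by (auto intro: X_space)
      interpret Px: prob_space "P (X i \<omega>)" by (rule kernel_at[OF x])
      show ?thesis
        unfolding transition_def using kernel_integrable[OF x G range] by (simp add: Px.prob_space)
    qed
    then have "increments ?G n \<omega> = (\<Sum>i = 1..n. - (G (X (Suc i) \<omega>) - T G (X i \<omega>)))"
      unfolding increments_def by (intro sum.cong) auto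
    then show ?thesis unfolding increments_def sum_negf by simp
  qed
  have "prob {\<omega>\<in>space M. \<bar>increments G n \<omega>\<bar> \<ge> u}
      \<le> prob ({\<omega>\<in>space M. increments G n \<omega> \<ge> u} \<union> {\<omega>\<in>space M. increments ?G n \<omega> \<ge> u})"
    by (intro finite_measure_mono) (auto simp: neg abs_if split: if_splits)
  also have "\<dots> \<le> prob {\<omega>\<in>space M. increments G n \<omega> \<ge> u} + prob {\<omega>\<in>space M. increments ?G n \<omega> \<ge> u}"
    by (intro measure_Un_le) auto
  also have "\<dots> \<le> 2 * exp (- 2 * u\<^sup>2 / (n * r\<^sup>2))"
    using increments_upper_tail[OF G range n r u] increments_upper_tail[OF G' _ n r u] range by force
  finally show ?thesis .
qed

end

section \<open>Doeblin minorization\<close>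

text \<open>A setwise minorization is an inequality between the measures
  \<open>scale_measure \<delta> \<mu>\<close> and \<open>\<nu>\<close>, and nonnegative integrals
  are monotone in the measure.\<close>

lemma minorization_integral:
  fixes g :: "'a \<Rightarrow> real"
  assumes \<mu>: "prob_space \<mu>" "sets \<mu> = sets N" and \<nu>: "prob_space \<nu>" "sets \<nu> = sets N"
    and \<delta>: "\<delta> \<ge> 0" and minor: "\<And>A. A \<in> sets N \<Longrightarrow> \<delta> * measure \<mu> A \<le> measure \<nu> A"
    and g: "g \<in> borel_measurable N" "\<And>y. y \<in> space N \<Longrightarrow> g y \<in> {0..b}"
  shows "\<delta> * (\<integral>y. g y \<partial>\<mu>) \<le> (\<integral>y. g y \<partial>\<nu>)"
proof -
  interpret \<mu>: prob_space \<mu> by fact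
  interpret \<nu>: prob_space \<nu> by fact
  have sp: "space \<mu> = space N" "space \<nu> = space N" using \<mu> \<nu> sets_eq_imp_space_eq by blast+
  have g\<mu>[measurable]: "g \<in> borel_measurable \<mu>" and g\<nu>[measurable]: "g \<in> borel_measurable \<nu>"
    using g(1) \<mu>(2) \<nu>(2) by (auto cong: measurable_cong_sets)
  have int: "integrable \<mu> g" "integrable \<nu> g"
    using g(2) by (auto intro!: \<mu>.integrable_const_bound[where B=b] \<nu>.integrable_const_bound[where B=b] simp: sp)
  have nonneg: "AE y in \<mu>. 0 \<le> g y" "AE y in \<nu>. 0 \<le> g y"
    using g(2) by (auto simp: sp intro!: AE_I2)
  have "scale_measure (ennreal \<delta>) \<mu> \<le> \<nu>"
  proof -
    have "emeasure (scale_measure (ennreal \<delta>) \<mu>) \<le> emeasure \<nu>"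
    proof (rule le_funI)
      fix A show "emeasure (scale_measure (ennreal \<delta>) \<mu>) A \<le> emeasure \<nu> A"
      proof (cases "A \<in> sets N")
        case True
        then show ?thesis
          using minor[OF True] \<delta> \<mu>(2)
          by (simp add: \<mu>.emeasure_eq_measure \<nu>.emeasure_eq_measure ennreal_mult[symmetric])
      qed (simp add: emeasure_notin_sets \<mu>(2))
    qed
    then show ?thesis
      unfolding le_measure_iff using \<mu>(2) \<nu>(2) sp by (simp add: space_scale_measure)
  qed
  then have "nn_integral (scale_measure (ennreal \<delta>) \<mu>) (\<lambda>y. ennreal (g y)) \<le> nn_integral \<nu> (\<lambda>y. ennreal (g y))"
    by (intro nn_integral_mono_measure) (auto simp: \<mu>(2) \<nu>(2))
  then have "ennreal \<delta> * (\<integral>\<^sup>+y. ennreal (g y) \<partial>\<mu>) \<le> (\<integral>\<^sup>+y. ennreal (g y) \<partial>\<nu>)"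
    by (simp add: nn_integral_scale_measure)
  then have "ennreal \<delta> * ennreal (\<integral>y. g y \<partial>\<mu>) \<le> ennreal (\<integral>y. g y \<partial>\<nu>)"
    using nn_integral_eq_integral[OF int(1)] nn_integral_eq_integral[OF int(2)] nonneg by simp
  moreover have "0 \<le> (\<integral>y. g y \<partial>\<mu>)" "0 \<le> (\<integral>y. g y \<partial>\<nu>)"
    using g(2) by (auto intro!: integral_nonneg_AE simp: sp)
  ultimately show ?thesis
    using \<delta> by (simp add: ennreal_mult[symmetric])
qed

text \<open>The normalizations \<open>\<delta> < 1\<close> and \<open>1 \<le> m\<close> give
  \<open>- ln (1 - \<delta>)\<close> and \<open>k div m\<close> their intended meaning;
  \<open>uniformly_ergodic_minorization\<close> provides them.\<close>

locale doeblin_process = markov_process M E P X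
  for M :: "'w measure" and E :: "'e measure" and P X +
  fixes \<pi> \<mu> :: "'e measure" and \<delta> :: real and m :: nat
  assumes stationary: "stationary_distribution E P \<pi>"
    and \<mu>: "\<mu> \<in> space (prob_algebra E)"
    and \<delta>: "0 < \<delta>" "\<delta> < 1" and m: "1 \<le> m"
    and minorization: "\<And>x A. x \<in> space E \<Longrightarrow> A \<in> sets E \<Longrightarrow>
      \<delta> * measure \<mu> A \<le> measure (kernel_power E P m x) A"
begin

lemma pi_prob: "prob_space \<pi>" "sets \<pi> = sets E" "space \<pi> = space E"
  using stationary sets_eq_imp_space_eq[of \<pi> E] by (auto simp: stationary_distribution_def space_prob_algebra)

lemma mu_prob: "prob_space \<mu>" "sets \<mu> = sets E" "space \<mu> = space E"
  using \<mu> sets_eq_imp_space_eq[of \<mu> E] by (auto simp: space_prob_algebra)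

lemma integrable_pi:
  fixes g :: "'e \<Rightarrow> real"
  assumes "g \<in> borel_measurable E" "\<And>y. y \<in> space E \<Longrightarrow> g y \<in> {a..b}"
  shows "integrable \<pi> g"
proof -
  interpret \<pi>: prob_space \<pi> by (rule pi_prob)
  have "\<bar>g y\<bar> \<le> max \<bar>a\<bar> \<bar>b\<bar>" if "y \<in> space E" for y
    using assms(2)[OF that] by auto
  then show ?thesis
    using assms(1)
    by (intro \<pi>.integrable_const_bound[where B="max \<bar>a\<bar> \<bar>b\<bar>"])
      (auto simp: pi_prob cong: measurable_cong_sets)
qed

lemma integral_pi_range:
  assumes "g \<in> borel_measurable E" "\<And>y. y \<in> space E \<Longrightarrow> g y \<in> {a..b}"
  shows "(\<integral>y. g y \<partial>\<pi>) \<in> {a..b::real}"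
proof -
  interpret \<pi>: prob_space \<pi> by (rule pi_prob)
  note i = integrable_pi[of g a b, OF assms]
  have "AE y in \<pi>. g y \<le> b" "AE y in \<pi>. a \<le> g y"
    using assms(2) by (auto simp: pi_prob intro!: AE_I2)
  then show ?thesis
    using \<pi>.integral_le_const[OF i, of b] \<pi>.integral_ge_const[OF i, of a] by simp
qed

lemma integral_pi_transition_pow:
  assumes g: "g \<in> borel_measurable E" "\<And>y. y \<in> space E \<Longrightarrow> g y \<in> {a..b}"
  shows "(\<integral>x. (T ^^ k) g x \<partial>\<pi>) = (\<integral>x. g x \<partial>\<pi>)"
proof (induction k)
  case (Suc k)
  have range: "(T ^^ k) g y \<in> {a..b}" if "y \<in> space E" for y
    using transition_pow_range[OF g that] .
  have "\<bar>(T ^^ k) g y\<bar> \<le> max \<bar>a\<bar> \<bar>b\<bar>" if "y \<in> space E" for y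
    using range[OF that] by auto
  then have "(\<integral>y. (T ^^ k) g y \<partial>(\<pi> \<bind> P)) = (\<integral>x. T ((T ^^ k) g) x \<partial>\<pi>)"
    unfolding transition_def[of P "(T ^^ k) g"] using g pi_prob kernel
    by (intro integral_bind_bounded[where N=E]) (auto cong: measurable_cong_sets)
  moreover have "\<pi> \<bind> P = \<pi>" using stationary by (simp add: stationary_distribution_def)
  ultimately show ?case using Suc by simp
qed simp

lemma minorization_transition:
  assumes g: "g \<in> borel_measurable E" "\<And>y. y \<in> space E \<Longrightarrow> g y \<in> {0..b}" and x: "x \<in> space E"
  shows "\<delta> * (\<integral>y. g y \<partial>\<mu>) \<le> (T ^^ m) g x"
proof -
  have "\<delta> * (\<integral>y. g y \<partial>\<mu>) \<le> (\<integral>y. g y \<partial>kernel_power E P m x)"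
    using kernel_power_prob[OF x, of m] mu_prob \<delta> minorization[OF x] g
    by (intro minorization_integral[where N=E]) (auto simp: space_prob_algebra)
  then show ?thesis using integral_kernel_power[OF x g] by simp
qed

text \<open>The minorization is applied to both nonnegative functions \<open>g - a\<close> and
  \<open>b - g\<close>. Each gains a fraction \<open>\<delta>\<close> of its
  \<open>\<mu>\<close>-mean, and this gain does not depend on \<open>x\<close>, so the oscillation
  shrinks by the factor \<open>1 - \<delta>\<close>.\<close>

lemma doeblin_contraction:
  assumes g: "g \<in> borel_measurable E" "\<And>y. y \<in> space E \<Longrightarrow> g y \<in> {a..b}"
  shows "\<exists>a'. \<forall>x\<in>space E. (T ^^ m) g x \<in> {a'..a' + (1 - \<delta>) * (b - a)}"
proof (intro exI ballI)
  fix x assume x: "x \<in> space E"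
  interpret \<mu>: prob_space \<mu> by (rule mu_prob)
  have gm: "g \<in> borel_measurable \<mu>" using g(1) mu_prob by (auto cong: measurable_cong_sets)
  have bd: "\<bar>g y\<bar> \<le> max \<bar>a\<bar> \<bar>b\<bar>" if "y \<in> space E" for y
    using g(2)[OF that] by auto
  have int: "integrable \<mu> g"
    using gm bd by (intro \<mu>.integrable_const_bound[where B="max \<bar>a\<bar> \<bar>b\<bar>"]) (auto simp: mu_prob)
  have "\<delta> * (\<integral>y. -a + 1 * g y \<partial>\<mu>) \<le> (T ^^ m) (\<lambda>y. -a + 1 * g y) x"
    by (rule minorization_transition[where b="b - a"]) (use g x in auto)
  then have lower: "\<delta> * ((\<integral>y. g y \<partial>\<mu>) - a) \<le> (T ^^ m) g x - a"
    using transition_pow_affine[OF g x, of m "-a" 1] int by (simp add: \<mu>.prob_space)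
  have "\<delta> * (\<integral>y. b + (-1) * g y \<partial>\<mu>) \<le> (T ^^ m) (\<lambda>y. b + (-1) * g y) x"
    by (rule minorization_transition[where b="b - a"]) (use g x in auto)
  then have upper: "\<delta> * (b - (\<integral>y. g y \<partial>\<mu>)) \<le> b - (T ^^ m) g x"
    using transition_pow_affine[OF g x, of m b "-1"] int by (simp add: \<mu>.prob_space)
  from lower upper show "(T ^^ m) g x \<in> {a + \<delta> * ((\<integral>y. g y \<partial>\<mu>) - a)..
      a + \<delta> * ((\<integral>y. g y \<partial>\<mu>) - a) + (1 - \<delta>) * (b - a)}"
    by (simp add: algebra_simps)
qed

lemma doeblin_contraction_pow:
  assumes g: "g \<in> borel_measurable E" "\<And>y. y \<in> space E \<Longrightarrow> g y \<in> {a..b}"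
  shows "\<exists>a'. \<forall>x\<in>space E. (T ^^ (m * j)) g x \<in> {a'..a' + (1 - \<delta>) ^ j * (b - a)}"
proof (induction j)
  case 0
  then show ?case using g by (intro exI[of _ a]) auto
next
  case (Suc j)
  then obtain a' where a': "\<And>x. x \<in> space E \<Longrightarrow> (T ^^ (m * j)) g x \<in> {a'..a' + (1 - \<delta>) ^ j * (b - a)}"
    by auto
  obtain a'' where "\<forall>x\<in>space E. (T ^^ m) ((T ^^ (m * j)) g) x \<in> {a''..a'' + (1 - \<delta>) * (a' + (1 - \<delta>) ^ j * (b - a) - a')}"
    using doeblin_contraction[OF transition_pow_measurable[OF g(1)] a'] by blast
  then show ?case
    by (intro exI[of _ a'']) (auto simp: funpow_add mult.assoc)
qed

text \<open>By invariance the stationary mean of \<open>g\<close> is an average of values of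
  \<open>T^(m j) g\<close>, hence lies in the same short interval as each of them. The bound holds
  at every point of the space.\<close>

lemma geometric_mixing:
  assumes g: "g \<in> borel_measurable E" "\<And>y. y \<in> space E \<Longrightarrow> g y \<in> {a..b}" and x: "x \<in> space E"
  shows "\<bar>(T ^^ (m * j)) g x - (\<integral>y. g y \<partial>\<pi>)\<bar> \<le> (1 - \<delta>) ^ j * (b - a)"
proof -
  obtain a' where a': "\<And>x. x \<in> space E \<Longrightarrow> (T ^^ (m * j)) g x \<in> {a'..a' + (1 - \<delta>) ^ j * (b - a)}"
    using doeblin_contraction_pow[OF g, of j] by blast
  have "(\<integral>y. g y \<partial>\<pi>) \<in> {a'..a' + (1 - \<delta>) ^ j * (b - a)}"
    using integral_pi_range[OF transition_pow_measurable[OF g(1)] a'] integral_pi_transition_pow[OF g]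
    by simp
  then show ?thesis using a'[OF x] by auto
qed

text \<open>Since \<open>\<pi>\<close> gives \<open>A\<close> mass zero, the \<open>k\<close>-step
  probability of \<open>A\<close> equals its own distance to stationarity, which contracts from
  every starting point; hence the law of \<open>X 1\<close> does not matter. The remaining
  \<open>k mod m\<close> steps cannot enlarge a uniform bound.\<close>

lemma prob_visit_null_set:
  assumes A: "A \<in> null_sets \<pi>"
  shows "prob {\<omega>\<in>space M. X (1 + k) \<omega> \<in> A} \<le> (1 - \<delta>) ^ (k div m)"
proof -
  have [measurable]: "A \<in> sets E" using A pi_prob by auto
  let ?g = "indicator A :: 'e \<Rightarrow> real"
  have g: "?g \<in> borel_measurable E" "\<And>y. y \<in> space E \<Longrightarrow> ?g y \<in> {0..1}" by (auto simp: indicator_def)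
  have X1: "X (1 + k) \<in> M \<rightarrow>\<^sub>M E" by (rule X_measurable) simp
  have "measure \<pi> A = 0" using A by (auto simp: measure_eq_0_null_sets)
  then have zero: "(\<integral>y. ?g y \<partial>\<pi>) = 0"
    using A by (auto simp: null_sets_def)
  have "(T ^^ (m * (k div m))) ?g x \<in> {0..(1 - \<delta>) ^ (k div m)}" if "x \<in> space E" for x
    using geometric_mixing[OF g that, of "k div m"] transition_pow_range[OF g that, of "m * (k div m)"] zero
    by auto
  then have "(T ^^ (k mod m)) ((T ^^ (m * (k div m))) ?g) x \<in> {0..(1 - \<delta>) ^ (k div m)}" if "x \<in> space E" for x
    by (rule transition_pow_range[OF transition_pow_measurable[OF g(1)] _ that])
  moreover have "(T ^^ (k mod m)) ((T ^^ (m * (k div m))) ?g) = (T ^^ k) ?g"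
    by (metis comp_apply funpow_add mod_mult_div_eq)
  ultimately have small: "(T ^^ k) ?g x \<le> (1 - \<delta>) ^ (k div m)" if "x \<in> space E" for x
    using that by auto
  have "prob {\<omega>\<in>space M. X (1 + k) \<omega> \<in> A} = expectation (indicator {\<omega>\<in>space M. X (1 + k) \<omega> \<in> A})"
    using X1 by simp
  also have "\<dots> = expectation (\<lambda>\<omega>. ?g (X (1 + k) \<omega>))"
    by (intro Bochner_Integration.integral_cong) (auto simp: indicator_def)
  \<comment> \<open>The trivial statistic \<open>()\<close> reduces the Markov property to a
    statement about plain expectations.\<close>
  also have "\<dots> = expectation (\<lambda>\<omega>. (T ^^ k) ?g (X 1 \<omega>))"
    by (rule markov_steps[of 1 "\<lambda>_. ()" "count_space UNIV" "\<lambda>_. ?g" 1]) (auto simp: indicator_def)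
  also have "\<dots> \<le> (1 - \<delta>) ^ (k div m)"
  proof (rule integral_le_const)
    have "(T ^^ k) ?g (X 1 \<omega>) \<in> {0..1}" if "\<omega> \<in> space M" for \<omega>
      using transition_pow_range[OF g X_space[OF _ that]] by simp
    then show "integrable M (\<lambda>\<omega>. (T ^^ k) ?g (X 1 \<omega>))"
      using measurable_compose[OF X_measurable transition_pow_measurable[OF g(1)], of 1 k]
      by (intro integrable_const_bound[where B=1]) auto
  qed (use small X_space in auto)
  finally show ?thesis .
qed

text \<open>The truncated Poisson sum \<open>G = \<Sum>j<k. T^j g\<close> satisfies \<open>g - T^k g = G - T G\<close>, which
  turns the additive functional into a martingale up to boundary terms.\<close>

lemma additive_functional_deviation:
  assumes g: "g \<in> borel_measurable E" "\<And>y. y \<in> space E \<Longrightarrow> g y \<in> {0..1}"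
    and n: "1 \<le> n" and j: "1 \<le> j" and u: "u > 0"
  shows "prob {\<omega>\<in>space M. \<bar>(\<Sum>i = 1..n. g (X i \<omega>)) - real n * (\<integral>y. g y \<partial>\<pi>)\<bar>
      \<ge> u + real (m * j) + real n * (1 - \<delta>) ^ j} \<le> 2 * exp (- 2 * u\<^sup>2 / (real n * (real (m * j))\<^sup>2))"
proof -
  define k where "k = m * j"
  define G where "G y = (\<Sum>i<k. (T ^^ i) g y)" for y
  have k: "1 \<le> k" using m j by (simp add: k_def)
  have Tg: "(T ^^ i) g y \<in> {0..1}" if "y \<in> space E" for i y
    using transition_pow_range[OF g that] .
  have G: "G \<in> borel_measurable E" using g(1) unfolding G_def by measurable
  have G_range: "G y \<in> {0..real k}" if "y \<in> space E" for y
    using sum_mono[of "{..<k}" "\<lambda>i. (T ^^ i) g y" "\<lambda>_. 1"] Tg[OF that]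
    by (auto simp: G_def intro!: sum_nonneg)
  have TG: "T G x = (\<Sum>i<k. (T ^^ Suc i) g x)" if x: "x \<in> space E" for x
  proof -
    have "integrable (P x) ((T ^^ i) g)" for i
      using g(1) Tg by (intro kernel_integrable[OF x]) auto
    then show ?thesis by (simp add: transition_def G_def)
  qed
  have poisson: "G x - T G x = g x - (T ^^ k) g x" if x: "x \<in> space E" for x
    using sum_lessThan_telescope'[of "\<lambda>i. (T ^^ i) g x" k]
    unfolding TG[OF x] G_def sum_subtractf[symmetric] by simp
  have meas[measurable]: "increments G n \<in> borel_measurable M"
    using increments_past_measurable[OF G] by (rule past_measurable_M)
  have "prob {\<omega>\<in>space M. \<bar>(\<Sum>i = 1..n. g (X i \<omega>)) - real n * (\<integral>y. g y \<partial>\<pi>)\<bar>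
      \<ge> u + real k + real n * (1 - \<delta>) ^ j} \<le> prob {\<omega>\<in>space M. \<bar>increments G n \<omega>\<bar> \<ge> u}"
  proof (intro finite_measure_mono subsetI CollectI conjI; (elim CollectE conjE)?)
    fix \<omega> assume \<omega>: "\<omega> \<in> space M"
      and dev: "u + real k + real n * (1 - \<delta>) ^ j \<le> \<bar>(\<Sum>i = 1..n. g (X i \<omega>)) - real n * (\<integral>y. g y \<partial>\<pi>)\<bar>"
    have sp: "X i \<omega> \<in> space E" if "1 \<le> i" for i using X_space[OF that \<omega>] .
    have "(\<Sum>i = 1..n. g (X i \<omega>) - (T ^^ k) g (X i \<omega>)) = (\<Sum>i = 1..n. G (X i \<omega>) - T G (X i \<omega>))"
      by (intro sum.cong) (auto simp: poisson sp)
    also have "\<dots> = (\<Sum>i = 1..n. G (X i \<omega>) - G (X (Suc i) \<omega>)) + increments G n \<omega>"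
      by (simp add: increments_def sum.distrib[symmetric])
    also have "(\<Sum>i = 1..n. G (X i \<omega>) - G (X (Suc i) \<omega>)) = G (X 1 \<omega>) - G (X (Suc n) \<omega>)"
      by (induction n) auto
    \<comment> \<open>Three terms remain: a boundary difference of size at most \<open>k\<close>, as
      \<open>G\<close> takes values in \<open>{0..k}\<close>; the martingale; and \<open>n\<close>
      truncation errors of size at most \<open>(1 - \<delta>) ^ j\<close>. The threshold in the
      statement reserves room for the first and the third.\<close>
    finally have 1: "(\<Sum>i = 1..n. g (X i \<omega>)) - real n * (\<integral>y. g y \<partial>\<pi>)
        = G (X 1 \<omega>) - G (X (Suc n) \<omega>) + increments G n \<omega> + (\<Sum>i = 1..n. (T ^^ k) g (X i \<omega>) - (\<integral>y. g y \<partial>\<pi>))"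
      by (simp add: sum_subtractf)
    have "\<bar>\<Sum>i = 1..n. (T ^^ k) g (X i \<omega>) - (\<integral>y. g y \<partial>\<pi>)\<bar> \<le> (\<Sum>i = 1..n. (1 - \<delta>) ^ j)"
      using geometric_mixing[OF g sp, of _ j] by (intro order_trans[OF sum_abs sum_mono]) (auto simp: k_def)
    moreover have "\<bar>G (X 1 \<omega>) - G (X (Suc n) \<omega>)\<bar> \<le> real k"
      using G_range[OF sp, of 1] G_range[OF sp, of "Suc n"] by auto
    ultimately show "u \<le> \<bar>increments G n \<omega>\<bar>"
      using dev unfolding 1 by simp
  qed auto
  also have "\<dots> \<le> 2 * exp (- 2 * u\<^sup>2 / (n * (real k)\<^sup>2))"
    by (rule increments_tail[OF G G_range n _ u]) (use k in auto)
  finally show ?thesis by (simp add: k_def)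
qed

end

text \<open>Layer-cake argument. \<open>gK\<close> is \<open>g\<close> rounded down to a multiple of
  \<open>1 / K\<close>, written as an average of \<open>K\<close> indicators of superlevel sets;
  each layer contributes at most \<open>d / K\<close>, so the total is \<open>d\<close> with no
  extra factor, and \<open>K\<close> tends to infinity. \<open>approx\<close> is stated for
  arbitrary measures so that their roles can be exchanged.\<close>

lemma integral_diff_le_total_variation:
  fixes g :: "'a \<Rightarrow> real"
  assumes \<mu>: "prob_space \<mu>" "sets \<mu> = sets N" and \<nu>: "prob_space \<nu>" "sets \<nu> = sets N"
    and d: "\<And>A. A \<in> sets N \<Longrightarrow> \<bar>measure \<mu> A - measure \<nu> A\<bar> \<le> d"
    and g[measurable]: "g \<in> borel_measurable N" and range: "\<And>y. y \<in> space N \<Longrightarrow> g y \<in> {0..1}"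
  shows "\<bar>(\<integral>y. g y \<partial>\<mu>) - (\<integral>y. g y \<partial>\<nu>)\<bar> \<le> d"
proof -
  have approx: "(\<integral>y. g y \<partial>\<mu>) \<le> (\<integral>y. g y \<partial>\<nu>) + d + 1 / real K"
    if \<mu>: "prob_space \<mu>" "sets \<mu> = sets N" and \<nu>: "prob_space \<nu>" "sets \<nu> = sets N"
      and d: "\<And>A. A \<in> sets N \<Longrightarrow> \<bar>measure \<mu> A - measure \<nu> A\<bar> \<le> d" and K: "K \<ge> 1"
    for \<mu> \<nu> and K :: nat
  proof -
    interpret \<mu>: prob_space \<mu> by fact
    interpret \<nu>: prob_space \<nu> by fact
    have sp: "space \<mu> = space N" "space \<nu> = space N" using \<mu> \<nu> sets_eq_imp_space_eq by blast+
    define A where "A i = {y\<in>space N. real i \<le> real K * g y}" for i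
    have A[measurable]: "A i \<in> sets N" for i unfolding A_def by measurable
    define gK where "gK y = (\<Sum>i = 1..K. indicator (A i) y / real K)" for y
    have gm[measurable]: "g \<in> borel_measurable \<mu>" "g \<in> borel_measurable \<nu>"
      using \<mu>(2) \<nu>(2) by (auto cong: measurable_cong_sets)
    have step: "gK y \<le> g y \<and> g y \<le> gK y + 1 / real K" if y: "y \<in> space N" for y
    proof -
      let ?v = "real K * g y"
      have v: "0 \<le> ?v" "?v \<le> real K" using range[OF y] by (auto intro: mult_left_le)
      have fl: "\<lfloor>?v\<rfloor> \<le> int K" using floor_mono[OF v(2)] by simp
      have "{i\<in>{1..K}. real i \<le> ?v} = {1..nat \<lfloor>?v\<rfloor>}"
        using fl v by (auto simp: le_nat_iff le_floor_iff)
      moreover have "(\<Sum>i = 1..K. indicator (A i) y) = real (card {i\<in>{1..K}. real i \<le> ?v})"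
        using y by (simp add: A_def indicator_def sum.If_cases Int_def)
      ultimately have "gK y = real_of_int \<lfloor>?v\<rfloor> / real K"
        using v by (simp add: gK_def sum_divide_distrib[symmetric])
      moreover have "real_of_int \<lfloor>?v\<rfloor> \<le> ?v" "?v \<le> real_of_int \<lfloor>?v\<rfloor> + 1" by linarith+
      ultimately have "real K * gK y \<le> real K * g y" "real K * g y \<le> real K * (gK y + 1 / real K)"
        using K by (simp_all add: distrib_left)
      then show ?thesis using K by simp
    qed
    have int_g: "integrable \<mu> g" "integrable \<nu> g"
      using range by (auto intro!: \<mu>.integrable_const_bound[where B=1] \<nu>.integrable_const_bound[where B=1] AE_I2 simp: sp)
    have int_ind: "integrable \<mu> (indicator (A i) :: _ \<Rightarrow> real)" "integrable \<nu> (indicator (A i) :: _ \<Rightarrow> real)" for i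
      using \<mu>(2) \<nu>(2) by (auto simp: \<mu>.emeasure_eq_measure \<nu>.emeasure_eq_measure)
    have int_gK: "integrable \<mu> gK" "integrable \<nu> gK"
      unfolding gK_def using int_ind by auto
    have "(\<integral>y. g y \<partial>\<mu>) \<le> (\<integral>y. gK y + 1 / real K \<partial>\<mu>)"
      using int_g int_gK step by (intro integral_mono) (auto simp: sp)
    also have "\<dots> = (\<integral>y. gK y \<partial>\<mu>) + 1 / real K"
      using int_gK by (simp add: \<mu>.prob_space)
    also have "(\<integral>y. gK y \<partial>\<mu>) = (\<Sum>i = 1..K. measure \<mu> (A i) / real K)"
      unfolding gK_def using int_ind A \<mu>(2) sets.sets_into_space[OF A]
      by (simp add: sp Int_absorb2)
    also have "\<dots> \<le> (\<Sum>i = 1..K. measure \<nu> (A i) / real K + d / real K)"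
      using d[OF A] K by (intro sum_mono) (simp add: field_simps abs_le_iff)
    also have "\<dots> = (\<integral>y. gK y \<partial>\<nu>) + d"
      unfolding gK_def using int_ind A \<nu>(2) sets.sets_into_space[OF A] K
      by (simp add: sp Int_absorb2 sum.distrib)
    also have "(\<integral>y. gK y \<partial>\<nu>) \<le> (\<integral>y. g y \<partial>\<nu>)"
      using int_g int_gK step by (intro integral_mono) (auto simp: sp)
    finally show ?thesis by simp
  qed
  have eps: "x \<le> y" if "\<And>K::nat. K \<ge> 1 \<Longrightarrow> x \<le> y + 1 / real K" for x y :: real
  proof (rule field_le_epsilon)
    fix e :: real assume "e > 0"
    then obtain K where "K \<noteq> 0" "inverse (real K) < e" using real_arch_inverse by blast
    with that[of K] show "x \<le> y + e" by (simp add: inverse_eq_divide)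
  qed
  have "(\<integral>y. g y \<partial>\<mu>) \<le> (\<integral>y. g y \<partial>\<nu>) + d"
    by (rule eps) (use approx[OF \<mu> \<nu> d] in simp)
  moreover have "(\<integral>y. g y \<partial>\<nu>) \<le> (\<integral>y. g y \<partial>\<mu>) + d"
    by (rule eps) (use approx[OF \<nu> \<mu>] d in \<open>simp add: abs_minus_commute\<close>)
  ultimately show ?thesis by auto
qed

section \<open>The ergodicity rate for bounded functions\<close>

context doeblin_process
begin

text \<open>The order of quantifiers is the point: the null set depends on the lag \<open>b\<close>
  but not on \<open>g\<close>, so it may be used with a \<open>g\<close> that depends on the
  trajectory.\<close>

lemma ergodicity_rate_functions:
  assumes "ergodicity_rate E P \<pi> \<rho>"
  obtains L where "L > 0" "\<And>b. \<exists>A\<in>null_sets \<pi>. \<forall>x\<in>space E - A. \<forall>g\<in>borel_measurable E.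
    (\<forall>y\<in>space E. g y \<in> {0..1}) \<longrightarrow> \<bar>(T ^^ b) g x - (\<integral>y. g y \<partial>\<pi>)\<bar> \<le> L * \<rho> ^ b"
proof -
  obtain L where L: "L > 0" "\<And>n. AE x in \<pi>.
      (SUP A\<in>sets E. \<bar>measure (kernel_power E P n x) A - measure \<pi> A\<bar>) \<le> L * \<rho> ^ n"
    using assms by (auto simp: ergodicity_rate_def)
  show thesis
  proof (rule that[OF L(1)])
    fix b
    obtain A where A: "A \<in> null_sets \<pi>" "{x\<in>space \<pi>. \<not> (SUP A\<in>sets E. \<bar>measure (kernel_power E P b x) A - measure \<pi> A\<bar>) \<le> L * \<rho> ^ b} \<subseteq> A"
      using L(2)[of b] by (auto simp: eventually_ae_filter)
    show "\<exists>A\<in>null_sets \<pi>. \<forall>x\<in>space E - A. \<forall>g\<in>borel_measurable E.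
      (\<forall>y\<in>space E. g y \<in> {0..1}) \<longrightarrow> \<bar>(T ^^ b) g x - (\<integral>y. g y \<partial>\<pi>)\<bar> \<le> L * \<rho> ^ b"
    proof (intro bexI[OF _ A(1)] ballI impI)
      fix x and g :: "'e \<Rightarrow> real"
      assume x: "x \<in> space E - A" and g: "g \<in> borel_measurable E" "\<forall>y\<in>space E. g y \<in> {0..1}"
      then have xE: "x \<in> space E" by simp
      have K: "prob_space (kernel_power E P b x)" "sets (kernel_power E P b x) = sets E"
        using kernel_power_prob[OF xE, of b] by (auto simp: space_prob_algebra)
      interpret K: prob_space "kernel_power E P b x" by (rule K)
      interpret \<pi>: prob_space \<pi> by (rule pi_prob)
      have sup: "(SUP A\<in>sets E. \<bar>measure (kernel_power E P b x) A - measure \<pi> A\<bar>) \<le> L * \<rho> ^ b"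
        using x A(2) by (auto simp: pi_prob)
      have "\<bar>measure (kernel_power E P b x) B - measure \<pi> B\<bar> \<le> L * \<rho> ^ b" if "B \<in> sets E" for B
      proof (rule order_trans[OF cSUP_upper[OF that] sup])
        show "bdd_above ((\<lambda>A. \<bar>measure (kernel_power E P b x) A - measure \<pi> A\<bar>) ` sets E)"
        proof (rule bdd_aboveI2)
          show "\<bar>measure (kernel_power E P b x) A - measure \<pi> A\<bar> \<le> 1" for A
            using K.prob_le_1[of A] \<pi>.prob_le_1[of A] measure_nonneg[of "kernel_power E P b x" A]
              measure_nonneg[of \<pi> A] by linarith
        qed
      qed
      then have "\<bar>(\<integral>y. g y \<partial>kernel_power E P b x) - (\<integral>y. g y \<partial>\<pi>)\<bar> \<le> L * \<rho> ^ b"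
        using g K pi_prob by (intro integral_diff_le_total_variation[where N=E]) auto
      then show "\<bar>(T ^^ b) g x - (\<integral>y. g y \<partial>\<pi>)\<bar> \<le> L * \<rho> ^ b"
        using integral_kernel_power[OF xE g(1), of 0 1 b] g(2) by simp
    qed
  qed
qed

end

section \<open>Orthogonality of lagged differences\<close>

context markov_process
begin

text \<open>The subtracted term is the conditional mean of the first one given the past up to time
  \<open>s\<close>; \<open>b\<close> is the lag between the last observation used and the test
  point.\<close>

definition lagged_difference :: "nat \<Rightarrow> ((nat \<Rightarrow> 'e) \<Rightarrow> 'e \<Rightarrow> real) \<Rightarrow> nat \<Rightarrow> 'w \<Rightarrow> real" where
  "lagged_difference b F s \<omega> = F (trajectory s \<omega>) (X (s + b) \<omega>) - (T ^^ b) (F (trajectory s \<omega>)) (X s \<omega>)"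

definition predictable_family :: "(nat \<Rightarrow> (nat \<Rightarrow> 'e) \<Rightarrow> 'e \<Rightarrow> real) \<Rightarrow> bool" where
  "predictable_family F \<longleftrightarrow>
     (\<forall>s\<ge>1. (\<lambda>(w, y). F s w y) \<in> borel_measurable (Pi\<^sub>M {1..s} (\<lambda>_. E) \<Otimes>\<^sub>M E) \<and>
       (\<forall>w\<in>space (Pi\<^sub>M {1..s} (\<lambda>_. E)). \<forall>y\<in>space E. F s w y \<in> {0..1}))"

context
  fixes F :: "nat \<Rightarrow> (nat \<Rightarrow> 'e) \<Rightarrow> 'e \<Rightarrow> real"
  assumes F: "predictable_family F"
begin

lemma predictable_section:
  assumes "1 \<le> s" "\<omega> \<in> space M"
  shows "F s (trajectory s \<omega>) \<in> borel_measurable E"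
    and "y \<in> space E \<Longrightarrow> F s (trajectory s \<omega>) y \<in> {0..1}"
proof -
  have tr: "trajectory s \<omega> \<in> space (Pi\<^sub>M {1..s} (\<lambda>_. E))" using trajectory_space assms(2) by auto
  show "F s (trajectory s \<omega>) \<in> borel_measurable E"
    using F assms(1) measurable_Pair2[OF _ tr, of "\<lambda>(w, y). F s w y" E borel]
    by (simp add: predictable_family_def)
  show "y \<in> space E \<Longrightarrow> F s (trajectory s \<omega>) y \<in> {0..1}"
    using F assms(1) tr by (simp add: predictable_family_def)
qed

lemma abs_lagged_difference_le:
  assumes "1 \<le> s" "\<omega> \<in> space M"
  shows "\<bar>lagged_difference b (F s) s \<omega>\<bar> \<le> 1"
proof -
  have "F s (trajectory s \<omega>) (X (s + b) \<omega>) \<in> {0..1}"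
    using assms by (intro predictable_section X_space) auto
  moreover have "(T ^^ b) (F s (trajectory s \<omega>)) (X s \<omega>) \<in> {0..1}"
    using assms by (intro transition_pow_range predictable_section X_space) auto
  ultimately show ?thesis by (auto simp: lagged_difference_def)
qed

lemma lagged_difference_past_measurable:
  assumes s: "1 \<le> s"
  shows "lagged_difference b (F s) s \<in> borel_measurable (past M E X (s + b))"
proof -
  have Fm: "(\<lambda>(w, y). F s w y) \<in> borel_measurable (Pi\<^sub>M {1..s} (\<lambda>_. E) \<Otimes>\<^sub>M E)"
    using F s by (simp add: predictable_family_def)
  have tr: "trajectory s \<in> past M E X (s + b) \<rightarrow>\<^sub>M Pi\<^sub>M {1..s} (\<lambda>_. E)"
    by (rule past_mono_measurable[OF trajectory_measurable]) simp
  have X: "X (s + b) \<in> past M E X (s + b) \<rightarrow>\<^sub>M E" "X s \<in> past M E X (s + b) \<rightarrow>\<^sub>M E"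
    using s by (auto intro!: X_past_measurable)
  show ?thesis
    unfolding lagged_difference_def
    using measurable_compose[OF measurable_Pair[OF tr X(1)] Fm]
      measurable_compose[OF measurable_Pair[OF tr X(2)] transition_pow_parametric_measurable[OF Fm, of b]]
    by (intro borel_measurable_diff) simp_all
qed

lemma lagged_difference_orthogonal:
  assumes s: "1 \<le> s" and Z: "Z \<in> borel_measurable (past M E X s)"
    and bound: "\<And>\<omega>. \<omega> \<in> space M \<Longrightarrow> \<bar>Z \<omega>\<bar> \<le> 1"
  shows "expectation (\<lambda>\<omega>. Z \<omega> * lagged_difference b (F s) s \<omega>) = 0"
proof -
  define W where "W \<omega> = (Z \<omega>, trajectory s \<omega>)" for \<omega>
  \<comment> \<open>The summand \<open>0 +\<close> gives \<open>\<Psi>\<close> the shape required by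
    \<open>transition_pow_affine\<close>, which then pulls \<open>Z \<omega>\<close> out of the
    \<open>b\<close>-th power of \<open>T\<close>.\<close>
  define \<Psi> where "\<Psi> w y = 0 + fst w * F s (snd w) y" for w y
  have Fm: "(\<lambda>(w, y). F s w y) \<in> borel_measurable (Pi\<^sub>M {1..s} (\<lambda>_. E) \<Otimes>\<^sub>M E)"
    using F s by (simp add: predictable_family_def)
  have W: "W \<in> past M E X s \<rightarrow>\<^sub>M borel \<Otimes>\<^sub>M Pi\<^sub>M {1..s} (\<lambda>_. E)"
    unfolding W_def using Z trajectory_measurable by (intro measurable_Pair) auto
  have "(\<lambda>z. F s (snd (fst z)) (snd z)) \<in> borel_measurable ((borel \<Otimes>\<^sub>M Pi\<^sub>M {1..s} (\<lambda>_. E)) \<Otimes>\<^sub>M E)"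
    using measurable_compose[OF _ Fm, of "\<lambda>z. (snd (fst z), snd z)" "(borel \<Otimes>\<^sub>M Pi\<^sub>M {1..s} (\<lambda>_. E)) \<Otimes>\<^sub>M E"]
    by simp
  then have \<Psi>: "(\<lambda>(w, y). \<Psi> w y) \<in> borel_measurable ((borel \<Otimes>\<^sub>M Pi\<^sub>M {1..s} (\<lambda>_. E)) \<Otimes>\<^sub>M E)"
    unfolding \<Psi>_def case_prod_beta by measurable
  have \<Psi>_bound: "\<bar>\<Psi> (W \<omega>) y\<bar> \<le> 1" if "\<omega> \<in> space M" "y \<in> space E" for \<omega> y
    using bound[OF that(1)] predictable_section(2)[OF s that] unfolding \<Psi>_def W_def
    by (auto simp: abs_mult intro!: mult_le_one)
  let ?A = "\<lambda>\<omega>. \<Psi> (W \<omega>) (X (s + b) \<omega>)" and ?B = "\<lambda>\<omega>. (T ^^ b) (\<Psi> (W \<omega>)) (X s \<omega>)"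
  have eq: "expectation ?A = expectation ?B"
    by (rule markov_steps[OF s W \<Psi> \<Psi>_bound])
  have WM: "W \<in> M \<rightarrow>\<^sub>M borel \<Otimes>\<^sub>M Pi\<^sub>M {1..s} (\<lambda>_. E)" using W by (rule past_measurable_M)
  have Xm: "X s \<in> M \<rightarrow>\<^sub>M E" "X (s + b) \<in> M \<rightarrow>\<^sub>M E" using s by (auto intro!: X_measurable)
  have "integrable M ?A"
    using measurable_compose[OF measurable_Pair[OF WM Xm(2)] \<Psi>] \<Psi>_bound X_space s
    by (intro integrable_const_bound[where B=1] AE_I2) auto
  moreover have "integrable M ?B"
  proof (rule integrable_const_bound[where B=1])
    show "AE \<omega> in M. norm ((T ^^ b) (\<Psi> (W \<omega>)) (X s \<omega>)) \<le> 1"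
    proof (rule AE_I2)
      fix \<omega> assume \<omega>: "\<omega> \<in> space M"
      have "\<Psi> (W \<omega>) \<in> borel_measurable E"
        using measurable_Pair2[OF \<Psi>, of "W \<omega>"] measurable_space[OF WM \<omega>] by simp
      then have "(T ^^ b) (\<Psi> (W \<omega>)) (X s \<omega>) \<in> {-1..1}"
        using \<Psi>_bound[OF \<omega>] s by (intro transition_pow_range X_space[OF s \<omega>]) (auto simp: abs_le_iff minus_le_iff)
      then show "norm ((T ^^ b) (\<Psi> (W \<omega>)) (X s \<omega>)) \<le> 1" by auto
    qed
    show "?B \<in> borel_measurable M"
      using measurable_compose[OF measurable_Pair[OF WM Xm(1)] transition_pow_parametric_measurable[OF \<Psi>, of b]]
      by simp
  qed
  ultimately have "expectation (\<lambda>\<omega>. ?A \<omega> - ?B \<omega>) = 0"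
    using eq by simp
  moreover have "?A \<omega> - ?B \<omega> = Z \<omega> * lagged_difference b (F s) s \<omega>" if \<omega>: "\<omega> \<in> space M" for \<omega>
    using transition_pow_affine[OF predictable_section[OF s \<omega>] X_space[OF s \<omega>], of b 0 "Z \<omega>"]
    by (simp add: \<Psi>_def[abs_def] W_def lagged_difference_def right_diff_distrib)
  ultimately show ?thesis
    by (metis (mono_tags, lifting) Bochner_Integration.integral_cong)
qed

text \<open>The difference at \<open>s\<close> is known at time \<open>s + b\<close>, hence
  orthogonal to the one at \<open>u\<close> as soon as \<open>s + b \<le> u\<close>. Only a band of
  at most \<open>2 * b\<close> indices per row survives in the double sum, with entries of mean at
  most 1.\<close>

lemma lagged_sum_second_moment:
  assumes p: "1 \<le> p"
  shows "integrable M (\<lambda>\<omega>. (\<Sum>s\<in>{p..<n}. lagged_difference b (F s) s \<omega>)\<^sup>2)"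
    and "expectation (\<lambda>\<omega>. (\<Sum>s\<in>{p..<n}. lagged_difference b (F s) s \<omega>)\<^sup>2) \<le> real (n - p) * real (2 * b)"
proof -
  let ?D = "\<lambda>s. lagged_difference b (F s) s"
  have meas: "?D s \<in> borel_measurable M" if "1 \<le> s" for s
    using lagged_difference_past_measurable[OF that] by (rule past_measurable_M)
  have prod_le: "\<bar>?D s \<omega> * ?D u \<omega>\<bar> \<le> 1" if "1 \<le> s" "1 \<le> u" "\<omega> \<in> space M" for s u \<omega>
    using abs_lagged_difference_le[OF that(1,3), of b] abs_lagged_difference_le[OF that(2,3), of b]
    by (auto simp: abs_mult intro!: mult_le_one)
  have int: "integrable M (\<lambda>\<omega>. ?D s \<omega> * ?D u \<omega>)" if "1 \<le> s" "1 \<le> u" for s u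
    using prod_le[OF that] meas[OF that(1)] meas[OF that(2)]
    by (intro integrable_const_bound[where B=1] AE_I2) auto
  have int': "integrable M (\<lambda>\<omega>. ?D s \<omega> * ?D u \<omega>)" if "p \<le> s \<and> s < n" "p \<le> u \<and> u < n" for s u
    using p that by (intro int) auto
  have far: "expectation (\<lambda>\<omega>. ?D s \<omega> * ?D u \<omega>) = 0" if "1 \<le> s" "s + b \<le> u" for s u
    using that lagged_difference_past_measurable[OF that(1), of b]
    by (intro lagged_difference_orthogonal past_mono_measurable[of _ "s + b" _ u] abs_lagged_difference_le) auto
  have near: "expectation (\<lambda>\<omega>. ?D s \<omega> * ?D u \<omega>) \<le> (if u < s + b \<and> s < u + b then 1 else 0)"
    if "1 \<le> s" "1 \<le> u" for s u
  proof (cases "u < s + b \<and> s < u + b")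
    case True
    then show ?thesis
      using integral_le_const[OF int[OF that], of 1] prod_le[OF that] by (auto simp: abs_le_iff)
  next
    case False
    then consider "s + b \<le> u" | "u + b \<le> s" by linarith
    then have "expectation (\<lambda>\<omega>. ?D s \<omega> * ?D u \<omega>) = 0"
      using far[of s u] far[of u s] that by cases (simp_all add: mult.commute)
    then show ?thesis using False by simp
  qed
  have sq: "(\<Sum>s\<in>{p..<n}. ?D s \<omega>)\<^sup>2 = (\<Sum>s\<in>{p..<n}. \<Sum>u\<in>{p..<n}. ?D s \<omega> * ?D u \<omega>)" for \<omega>
    by (simp add: power2_eq_square sum_product)
  show "integrable M (\<lambda>\<omega>. (\<Sum>s\<in>{p..<n}. ?D s \<omega>)\<^sup>2)"
    unfolding sq using p by (intro Bochner_Integration.integrable_sum int) auto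
  have "expectation (\<lambda>\<omega>. (\<Sum>s\<in>{p..<n}. ?D s \<omega>)\<^sup>2)
      = (\<Sum>s\<in>{p..<n}. \<Sum>u\<in>{p..<n}. expectation (\<lambda>\<omega>. ?D s \<omega> * ?D u \<omega>))"
  proof -
    have "expectation (\<lambda>\<omega>. (\<Sum>s\<in>{p..<n}. ?D s \<omega>)\<^sup>2)
        = (\<Sum>s\<in>{p..<n}. expectation (\<lambda>\<omega>. \<Sum>u\<in>{p..<n}. ?D s \<omega> * ?D u \<omega>))"
      unfolding sq by (rule Bochner_Integration.integral_sum) (auto intro!: Bochner_Integration.integrable_sum int')
    also have "\<dots> = (\<Sum>s\<in>{p..<n}. \<Sum>u\<in>{p..<n}. expectation (\<lambda>\<omega>. ?D s \<omega> * ?D u \<omega>))"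
      by (rule sum.cong[OF refl], rule Bochner_Integration.integral_sum) (auto intro!: int')
    finally show ?thesis .
  qed
  also have "\<dots> \<le> (\<Sum>s\<in>{p..<n}. real (2 * b))"
  proof (rule sum_mono)
    fix s assume s: "s \<in> {p..<n}"
    have "(\<Sum>u\<in>{p..<n}. expectation (\<lambda>\<omega>. ?D s \<omega> * ?D u \<omega>))
        \<le> (\<Sum>u\<in>{p..<n}. if u < s + b \<and> s < u + b then 1 else 0)"
      using p s by (intro sum_mono near) auto
    also have "\<dots> = real (card {u\<in>{p..<n}. u < s + b \<and> s < u + b})"
      by (simp add: sum.If_cases Int_def)
    also have "\<dots> \<le> real (card {s + 1 - b..<s + b})"
      by (intro of_nat_mono card_mono) auto
    also have "\<dots> \<le> real (2 * b)" by simp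
    finally show "(\<Sum>u\<in>{p..<n}. expectation (\<lambda>\<omega>. ?D s \<omega> * ?D u \<omega>)) \<le> real (2 * b)" .
  qed
  finally show "expectation (\<lambda>\<omega>. (\<Sum>s\<in>{p..<n}. ?D s \<omega>)\<^sup>2) \<le> real (n - p) * real (2 * b)"
    by simp
qed

lemma lagged_sum_tail:
  assumes p: "1 \<le> p" "p < n" and \<tau>: "\<tau> > 0"
  shows "prob {\<omega>\<in>space M. \<bar>\<Sum>s\<in>{p..<n}. lagged_difference b (F s) s \<omega>\<bar> \<ge> real (n - p) * \<tau>}
    \<le> 2 * real b / (real (n - p) * \<tau>\<^sup>2)"
proof -
  have meas: "(\<lambda>\<omega>. \<Sum>s\<in>{p..<n}. lagged_difference b (F s) s \<omega>) \<in> borel_measurable M"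
    using p by (intro borel_measurable_sum past_measurable_M[OF lagged_difference_past_measurable]) auto
  have "prob {\<omega>\<in>space M. \<bar>\<Sum>s\<in>{p..<n}. lagged_difference b (F s) s \<omega>\<bar> \<ge> real (n - p) * \<tau>}
    \<le> expectation (\<lambda>\<omega>. (\<Sum>s\<in>{p..<n}. lagged_difference b (F s) s \<omega>)\<^sup>2) / (real (n - p) * \<tau>)\<^sup>2"
    using p \<tau> by (intro second_moment_method[OF meas] lagged_sum_second_moment) auto
  also have "\<dots> \<le> real (n - p) * real (2 * b) / (real (n - p) * \<tau>)\<^sup>2"
    by (intro divide_right_mono lagged_sum_second_moment p) simp
  also have "\<dots> = 2 * real b / (real (n - p) * \<tau>\<^sup>2)"
    using p \<tau> by (simp add: power2_eq_square del: of_nat_diff)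
  finally show ?thesis .
qed

end

end

section \<open>Hypothesis classes and losses\<close>

lemma compactin_finite_net:
  assumes "compactin (mtopology_of m) H" "\<epsilon> > 0"
  shows "\<exists>G. finite G \<and> G \<subseteq> H \<and> (\<forall>h\<in>H. \<exists>g\<in>G. mdist m g h < \<epsilon>)"
proof -
  interpret Metric_space "mspace m" "mdist m" by (rule Metric_space_mspace_mdist)
  have "mtotally_bounded H"
    using assms(1) compactin_imp_mtotally_bounded by (simp add: mtopology_of_def)
  then obtain G where G: "finite G" "G \<subseteq> H" "H \<subseteq> (\<Union>g\<in>G. mball g \<epsilon>)"
    using assms(2) unfolding mtotally_bounded_def by metis
  have "\<exists>g\<in>G. mdist m g h < \<epsilon>" if "h \<in> H" for h
    using G(3) that in_mball by fastforce
  then show ?thesis using G(1,2) by metis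
qed

lemma openin_ball_mtopology_of: "openin (mtopology_of m) {h\<in>mspace m. g \<in> mspace m \<and> mdist m g h < r}"
proof -
  interpret Metric_space "mspace m" "mdist m" by (rule Metric_space_mspace_mdist)
  have "{h\<in>mspace m. g \<in> mspace m \<and> mdist m g h < r} = mball g r" by auto
  then show ?thesis by (simp add: mtopology_of_def)
qed

locale hypothesis_class =
  fixes E :: "'e measure" and H :: "('e \<times> 'e \<Rightarrow> real) set"
  assumes H_measurable: "H \<subseteq> borel_measurable (E \<Otimes>\<^sub>M E)"
    and H_compact: "compactin (mtopology_of (sup_metric E)) H"
begin

lemma H_mspace: "H \<subseteq> mspace (sup_metric E)"
  using compactin_subset_topspace[OF H_compact] unfolding topspace_mtopology_of .

lemma abs_diff_le_mdist:
  assumes "g \<in> H" "h \<in> H" "z \<in> space (E \<Otimes>\<^sub>M E)"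
  shows "\<bar>g z - h z\<bar> \<le> mdist (sup_metric E) g h"
proof -
  have "\<forall>x\<in>space (E \<Otimes>\<^sub>M E). mdist euclidean_metric (g x) (h x) \<le> mdist (sup_metric E) g h"
  proof (subst funspace_mdist_le[symmetric])
    show "g \<in> mspace (sup_metric E)" "h \<in> mspace (sup_metric E)" using assms H_mspace by blast+
    show "space (E \<Otimes>\<^sub>M E) \<noteq> {}" using assms(3) by blast
  qed (rule order_refl)
  then show ?thesis using assms(3) by (simp add: dist_real_def del: mdist_funspace)
qed

text \<open>Compactness supplies a finite net, so the set of admissible cardinalities is nonempty
  and the \<open>LEAST\<close> in the definition is attained.\<close>

lemma covering_number_attained:
  assumes "\<eta> > 0"
  obtains G where "G \<subseteq> H" "finite G" "card G = covering_number E H \<eta>"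
    "\<And>h. h \<in> H \<Longrightarrow> \<exists>g\<in>G. mdist (sup_metric E) g h \<le> \<eta>"
proof -
  let ?Q = "\<lambda>N. \<exists>G. G \<subseteq> H \<and> finite G \<and> card G = N \<and> (\<forall>h\<in>H. \<exists>g\<in>G. mdist (sup_metric E) g h \<le> \<eta>)"
  obtain G where "finite G" "G \<subseteq> H" "\<forall>h\<in>H. \<exists>g\<in>G. mdist (sup_metric E) g h < \<eta>"
    using compactin_finite_net[OF H_compact assms] by auto
  then have "?Q (card G)" by (intro exI[of _ G]) (blast intro: less_imp_le)
  then have "?Q (LEAST N. ?Q N)" by (rule LeastI)
  then have "?Q (covering_number E H \<eta>)" unfolding covering_number_def .
  then show thesis using that by (elim exE conjE) blast
qed

lemma sets_borel_class: "sets (borel_class E H) = sigma_sets H {U. openin (subtopology (mtopology_of (sup_metric E)) H) U}"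
  unfolding borel_class_def by (rule sets_measure_of) (auto dest: openin_imp_subset)

lemma space_borel_class[simp]: "space (borel_class E H) = H"
  unfolding borel_class_def by (rule space_measure_of) (auto dest: openin_imp_subset)

lemma ball_borel_class:
  assumes "g \<in> H"
  shows "{h\<in>H. mdist (sup_metric E) g h < r} \<in> sets (borel_class E H)"
proof -
  have eq: "{h\<in>H. mdist (sup_metric E) g h < r}
      = {h\<in>mspace (sup_metric E). g \<in> mspace (sup_metric E) \<and> mdist (sup_metric E) g h < r} \<inter> H"
    using assms H_mspace by blast
  have "openin (subtopology (mtopology_of (sup_metric E)) H) {h\<in>H. mdist (sup_metric E) g h < r}"
    unfolding eq openin_subtopology
    by (rule exI, rule conjI[OF openin_ball_mtopology_of refl])
  then show ?thesis unfolding sets_borel_class by (intro sigma_sets.Basic) simp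
qed

text \<open>The point is that \<open>h z > a\<close> iff some member \<open>g\<close> of a countable dense set satisfies
  \<open>g z > a + \<epsilon>\<close> and \<open>\<parallel>g - h\<parallel> < \<epsilon>\<close> for some \<open>\<epsilon> = 1/(k+1)\<close>.\<close>

lemma evaluation_measurable:
  "(\<lambda>z. (fst z) (snd z)) \<in> borel_measurable (borel_class E H \<Otimes>\<^sub>M (E \<Otimes>\<^sub>M E))"
proof (rule borel_measurableI_greater)
  fix a :: real
  let ?d = "mdist (sup_metric E)"
  have "\<forall>k::nat. \<exists>G. finite G \<and> G \<subseteq> H \<and> (\<forall>h\<in>H. \<exists>g\<in>G. ?d g h < 1 / (real k + 1))"
    by (intro allI compactin_finite_net[OF H_compact]) simp
  then obtain G where G: "\<And>k::nat. finite (G k)" "\<And>k. G k \<subseteq> H"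
    "\<And>k h. h \<in> H \<Longrightarrow> \<exists>g\<in>G k. ?d g h < 1 / (real k + 1)" by metis
  have "{z\<in>space (borel_class E H \<Otimes>\<^sub>M (E \<Otimes>\<^sub>M E)). a < (fst z) (snd z)}
    = (\<Union>k. \<Union>g\<in>G k. {h\<in>H. ?d g h < 1 / (real k + 1)} \<times> {x\<in>space (E \<Otimes>\<^sub>M E). a + 1 / (real k + 1) < g x})"
    (is "?L = ?R")
  proof
    show "?L \<subseteq> ?R"
    proof
      fix z assume "z \<in> ?L"
      then obtain h x where z: "z = (h, x)" "h \<in> H" "x \<in> space (E \<Otimes>\<^sub>M E)" "a < h x"
        by (auto simp: space_pair_measure[of "borel_class E H"])
      obtain k where k: "1 / (real k + 1) < (h x - a) / 2"
        using reals_Archimedean[of "(h x - a) / 2"] z(4) by (auto simp: inverse_eq_divide add.commute)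
      obtain g where g: "g \<in> G k" "?d g h < 1 / (real k + 1)" using G(3)[OF z(2), of k] by (elim bexE)
      have "\<bar>g x - h x\<bar> < 1 / (real k + 1)"
        using abs_diff_le_mdist[of g h x] g z G(2)[of k] by (intro le_less_trans[OF _ g(2)]) auto
      then have "a + 1 / (real k + 1) < g x" using k by argo
      then show "z \<in> ?R" using z g by (intro UN_I[of k] UN_I[of g]) auto
    qed
    show "?R \<subseteq> ?L"
    proof
      fix z assume "z \<in> ?R"
      then obtain k g h x where z: "z = (h, x)" "g \<in> G k" "h \<in> H" "?d g h < 1 / (real k + 1)"
        "x \<in> space (E \<Otimes>\<^sub>M E)" "a + 1 / (real k + 1) < g x" by (elim UN_E SigmaE CollectE conjE)
      have "\<bar>g x - h x\<bar> < 1 / (real k + 1)"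
        using abs_diff_le_mdist[of g h x] z G(2)[of k] by (intro le_less_trans[OF _ z(4)]) auto
      then have "a < h x" using z(6) by argo
      then show "z \<in> ?L" using z by (auto simp: space_pair_measure[of "borel_class E H"])
    qed
  qed
  moreover have "?R \<in> sets (borel_class E H \<Otimes>\<^sub>M (E \<Otimes>\<^sub>M E))"
  proof -
    have "{h\<in>H. ?d g h < 1 / (real k + 1)} \<times> {x\<in>space (E \<Otimes>\<^sub>M E). a + 1 / (real k + 1) < g x}
        \<in> sets (borel_class E H \<Otimes>\<^sub>M (E \<Otimes>\<^sub>M E))" if "g \<in> G k" for k g
    proof -
      have "g \<in> H" using that G(2) by auto
      then have [measurable]: "g \<in> borel_measurable (E \<Otimes>\<^sub>M E)" using H_measurable by auto
      show ?thesis
        by (intro pair_measureI ball_borel_class \<open>g \<in> H\<close>) measurable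
    qed
    then have "(\<Union>g\<in>G k. {h\<in>H. ?d g h < 1 / (real k + 1)} \<times> {x\<in>space (E \<Otimes>\<^sub>M E). a + 1 / (real k + 1) < g x})
        \<in> sets (borel_class E H \<Otimes>\<^sub>M (E \<Otimes>\<^sub>M E))" for k
      using G(1) by (intro sets.finite_UN)
    then show ?thesis by (intro sets.countable_UN) blast
  qed
  ultimately show "{z\<in>space (borel_class E H \<Otimes>\<^sub>M (E \<Otimes>\<^sub>M E)). a < (fst z) (snd z)}
      \<in> sets (borel_class E H \<Otimes>\<^sub>M (E \<Otimes>\<^sub>M E))" by simp
qed

end

locale loss_class = hypothesis_class E H
  for E :: "'e measure" and H :: "('e \<times> 'e \<Rightarrow> real) set" +
  fixes f :: "'e \<Rightarrow> real" and \<phi> :: "real \<Rightarrow> real \<Rightarrow> real" and K :: real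
  assumes f_measurable: "f \<in> borel_measurable E"
    and phi_measurable: "(\<lambda>(u, v). \<phi> u v) \<in> borel_measurable (borel \<Otimes>\<^sub>M borel)"
    and phi_range: "\<And>u v. \<phi> u v \<in> {0..1}"
    and phi_lipschitz: "\<And>u. K-lipschitz_on UNIV (\<phi> u)"
begin

abbreviation l :: "('e \<times> 'e \<Rightarrow> real) \<Rightarrow> 'e \<Rightarrow> 'e \<Rightarrow> real" where "l \<equiv> pair_loss \<phi> f"

lemma K_nonneg: "0 \<le> K"
  using lipschitz_on_nonneg[OF phi_lipschitz] .

lemma loss_range: "l h x y \<in> {0..1}"
  unfolding pair_loss_def by (rule phi_range)

lemma loss_lipschitz:
  assumes "g \<in> H" "h \<in> H" "x \<in> space E" "y \<in> space E"
  shows "\<bar>l g x y - l h x y\<bar> \<le> K * mdist (sup_metric E) g h"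
proof -
  have "\<bar>l g x y - l h x y\<bar> \<le> K * \<bar>g (x, y) - h (x, y)\<bar>"
    using lipschitz_onD[OF phi_lipschitz, of "g (x, y)" "h (x, y)" "f x - f y"]
    by (simp add: pair_loss_def dist_real_def)
  also have "\<dots> \<le> K * mdist (sup_metric E) g h"
    using assms by (intro mult_left_mono K_nonneg abs_diff_le_mdist) (auto simp: space_pair_measure)
  finally show ?thesis .
qed

text \<open>The hypothesis varies with the sample, so measurability for each fixed \<open>h\<close>
  is not enough; joint measurability of evaluation is what makes the loss of a learned hypothesis a
  random variable.\<close>

lemma loss_measurable_joint:
  assumes h: "h \<in> N \<rightarrow>\<^sub>M borel_class E H" and x: "x \<in> N \<rightarrow>\<^sub>M E" and y: "y \<in> N \<rightarrow>\<^sub>M E"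
  shows "(\<lambda>w. l (h w) (x w) (y w)) \<in> borel_measurable N"
proof -
  have "(\<lambda>w. (h w) (x w, y w)) \<in> borel_measurable N"
    using measurable_compose[OF measurable_Pair[OF h measurable_Pair[OF x y]] evaluation_measurable] by simp
  moreover have "(\<lambda>w. f (x w) - f (y w)) \<in> borel_measurable N"
    using measurable_compose[OF x f_measurable] measurable_compose[OF y f_measurable] by simp
  ultimately show ?thesis
    using measurable_compose[OF measurable_Pair phi_measurable, of "\<lambda>w. f (x w) - f (y w)" N "\<lambda>w. (h w) (x w, y w)"]
    by (simp add: pair_loss_def)
qed

lemma loss_measurable:
  assumes "h \<in> H" "x \<in> N \<rightarrow>\<^sub>M E" "y \<in> N \<rightarrow>\<^sub>M E"
  shows "(\<lambda>w. l h (x w) (y w)) \<in> borel_measurable N"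
  using assms by (intro loss_measurable_joint) auto

end

section \<open>Finite-sample bound\<close>

locale online_learning =
  doeblin_process M E P X \<pi> \<mu> \<delta> m + loss_class E H f \<phi> K
  for M :: "'w measure" and E :: "'e measure" and P X \<pi> \<mu> \<delta> m H f \<phi> K +
  fixes alg :: "nat \<Rightarrow> (nat \<Rightarrow> 'e \<times> real) \<Rightarrow> ('e \<times> 'e \<Rightarrow> real)"
  assumes algorithm: "online_algorithm E H alg"
begin

text \<open>The labels are functions of the points, so the learner becomes a function of the
  trajectory alone and its output is a statistic of the past.\<close>

definition hypothesis_of :: "nat \<Rightarrow> (nat \<Rightarrow> 'e) \<Rightarrow> 'e \<times> 'e \<Rightarrow> real" where
  "hypothesis_of s w = alg s (\<lambda>i\<in>{1..s}. (w i, f (w i)))"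

abbreviation hyp :: "'w \<Rightarrow> nat \<Rightarrow> 'e \<times> 'e \<Rightarrow> real" where
  "hyp \<equiv> generated_hypothesis alg f X"

definition empirical_loss :: "nat \<Rightarrow> (nat \<Rightarrow> 'e) \<Rightarrow> 'e \<Rightarrow> real" where
  "empirical_loss s w y = (\<Sum>i = 1..s. l (hypothesis_of s w) y (w i)) / real s"

text \<open>Integrates out the first argument, the place of the test point; the training points
  occupy the second. At fixed \<open>h\<close> this leaves an ordinary function of a single state of
  the chain.\<close>

definition mean_loss :: "('e \<times> 'e \<Rightarrow> real) \<Rightarrow> 'e \<Rightarrow> real" where
  "mean_loss h x = (\<integral>y. l h y x \<partial>\<pi>)"

lemma hypothesis_of_measurable: "hypothesis_of s \<in> Pi\<^sub>M {1..s} (\<lambda>_. E) \<rightarrow>\<^sub>M borel_class E H"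
proof -
  have "(\<lambda>w. (w i, f (w i))) \<in> Pi\<^sub>M {1..s} (\<lambda>_. E) \<rightarrow>\<^sub>M E \<Otimes>\<^sub>M borel" if "i \<in> {1..s}" for i
    by (intro measurable_Pair measurable_compose[OF measurable_component_singleton[OF that] f_measurable]
        measurable_component_singleton[OF that])
  then have "(\<lambda>w. \<lambda>i\<in>{1..s}. (w i, f (w i))) \<in> Pi\<^sub>M {1..s} (\<lambda>_. E) \<rightarrow>\<^sub>M Pi\<^sub>M {1..s} (\<lambda>_. E \<Otimes>\<^sub>M borel)"
    by (rule measurable_restrict)
  then show ?thesis
    using algorithm measurable_compose unfolding online_algorithm_def hypothesis_of_def by blast
qed

lemma hyp_eq: "hyp \<omega> s = hypothesis_of s (trajectory s \<omega>)"
  unfolding generated_hypothesis_def hypothesis_of_def trajectory_def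
  by (intro arg_cong[where f="alg s"]) auto

lemma hyp_in_H: "\<omega> \<in> space M \<Longrightarrow> hyp \<omega> s \<in> H"
  unfolding hyp_eq using measurable_space[OF hypothesis_of_measurable] trajectory_space by fastforce

lemma predictable_empirical_loss: "predictable_family empirical_loss"
  unfolding predictable_family_def
proof (intro allI impI conjI ballI)
  fix s :: nat assume s: "1 \<le> s"
  show "(\<lambda>(w, y). empirical_loss s w y) \<in> borel_measurable (Pi\<^sub>M {1..s} (\<lambda>_. E) \<Otimes>\<^sub>M E)"
    unfolding empirical_loss_def case_prod_beta
    by (intro borel_measurable_divide borel_measurable_sum loss_measurable_joint
        measurable_compose[OF measurable_fst hypothesis_of_measurable]
        measurable_compose[OF measurable_fst measurable_component_singleton]) auto
  fix w y
  have "(\<Sum>i = 1..s. l (hypothesis_of s w) y (w i)) \<le> (\<Sum>i = 1..s. 1)"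
    using loss_range by (intro sum_mono) auto
  moreover have "0 \<le> (\<Sum>i = 1..s. l (hypothesis_of s w) y (w i))"
    using loss_range by (intro sum_nonneg) auto
  ultimately show "empirical_loss s w y \<in> {0..1}"
    using s by (simp add: empirical_loss_def)
qed

lemma integrable_loss_pi: "h \<in> H \<Longrightarrow> x \<in> space E \<Longrightarrow> integrable \<pi> (\<lambda>y. l h y x)"
  using loss_range by (intro integrable_pi loss_measurable) auto

lemma mean_loss_measurable:
  assumes "h \<in> H"
  shows "mean_loss h \<in> borel_measurable E"
proof -
  interpret \<pi>: prob_space \<pi> by (rule pi_prob)
  have "(\<lambda>(x, y). l h y x) \<in> borel_measurable (E \<Otimes>\<^sub>M E)"
    unfolding case_prod_beta by (intro loss_measurable assms) auto
  then have "(\<lambda>(x, y). l h y x) \<in> borel_measurable (E \<Otimes>\<^sub>M \<pi>)"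
    using pi_prob(2) by (simp cong: measurable_cong_sets sets_pair_measure_cong)
  from \<pi>.borel_measurable_lebesgue_integral[OF this] show ?thesis
    by (simp add: mean_loss_def[abs_def])
qed

lemma mean_loss_range: "h \<in> H \<Longrightarrow> x \<in> space E \<Longrightarrow> mean_loss h x \<in> {0..1}"
  unfolding mean_loss_def using loss_range by (intro integral_pi_range loss_measurable) auto

lemma risk_eq:
  assumes h: "h \<in> H"
  shows "risk l \<pi> h = (\<integral>x. mean_loss h x \<partial>\<pi>)"
proof -
  interpret \<pi>: prob_space \<pi> by (rule pi_prob)
  interpret \<pi>\<pi>: pair_prob_space \<pi> \<pi> ..
  have "(\<lambda>(x, y). l h x y) \<in> borel_measurable (E \<Otimes>\<^sub>M E)"
    unfolding case_prod_beta by (intro loss_measurable h) auto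
  then have meas: "(\<lambda>(x, y). l h x y) \<in> borel_measurable (\<pi> \<Otimes>\<^sub>M \<pi>)"
    using pi_prob(2) by (simp cong: measurable_cong_sets sets_pair_measure_cong)
  have "\<bar>l h x y\<bar> \<le> 1" for x y using loss_range[of h x y] by auto
  then have "integrable (\<pi> \<Otimes>\<^sub>M \<pi>) (\<lambda>(x, y). l h x y)"
    using meas by (intro \<pi>\<pi>.P.integrable_const_bound[where B=1]) auto
  from \<pi>\<pi>.integral_snd[OF this] show ?thesis
    by (simp add: risk_def mean_loss_def case_prod_unfold)
qed

lemma mean_loss_lipschitz:
  assumes "g \<in> H" "h \<in> H" "x \<in> space E"
  shows "\<bar>mean_loss g x - mean_loss h x\<bar> \<le> K * mdist (sup_metric E) g h"
proof -
  interpret \<pi>: prob_space \<pi> by (rule pi_prob)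
  have int: "integrable \<pi> (\<lambda>y. l g y x)" "integrable \<pi> (\<lambda>y. l h y x)"
    using assms by (auto intro: integrable_loss_pi)
  have "\<bar>mean_loss g x - mean_loss h x\<bar> = \<bar>\<integral>y. l g y x - l h y x \<partial>\<pi>\<bar>"
    using int by (simp add: mean_loss_def)
  also have "\<dots> \<le> (\<integral>y. \<bar>l g y x - l h y x\<bar> \<partial>\<pi>)" by (rule integral_abs_bound)
  also have "\<dots> \<le> K * mdist (sup_metric E) g h"
    using int assms by (intro \<pi>.integral_le_const AE_I2 loss_lipschitz) (auto simp: pi_prob)
  finally show ?thesis .
qed

lemma risk_lipschitz:
  assumes "g \<in> H" "h \<in> H"
  shows "\<bar>risk l \<pi> g - risk l \<pi> h\<bar> \<le> K * mdist (sup_metric E) g h"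
proof -
  interpret \<pi>: prob_space \<pi> by (rule pi_prob)
  have int: "integrable \<pi> (mean_loss g)" "integrable \<pi> (mean_loss h)"
    using assms mean_loss_range by (auto intro!: integrable_pi[of _ 0 1] mean_loss_measurable)
  have "\<bar>risk l \<pi> g - risk l \<pi> h\<bar> = \<bar>\<integral>x. mean_loss g x - mean_loss h x \<partial>\<pi>\<bar>"
    using int assms by (simp add: risk_eq)
  also have "\<dots> \<le> (\<integral>x. \<bar>mean_loss g x - mean_loss h x\<bar> \<partial>\<pi>)" by (rule integral_abs_bound)
  also have "\<dots> \<le> K * mdist (sup_metric E) g h"
    using int assms by (intro \<pi>.integral_le_const AE_I2 mean_loss_lipschitz) (auto simp: pi_prob)
  finally show ?thesis .
qed

lemma integral_empirical_loss:
  assumes "\<omega> \<in> space M"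
  shows "(\<integral>y. empirical_loss s (trajectory s \<omega>) y \<partial>\<pi>) = (\<Sum>i = 1..s. mean_loss (hyp \<omega> s) (X i \<omega>)) / real s"
proof -
  have "integrable \<pi> (\<lambda>y. l (hypothesis_of s (trajectory s \<omega>)) y (X i \<omega>))" if "i \<in> {1..s}" for i
    using hyp_in_H[OF assms, of s] X_space assms that by (intro integrable_loss_pi) (auto simp: hyp_eq)
  then show ?thesis
    unfolding empirical_loss_def mean_loss_def hyp_eq
    by (simp add: trajectory_def cong: sum.cong_simp)
qed

text \<open>Uniformity in \<open>h\<close> is what later permits inserting the hypothesis learned
  from the same sample. The union bound runs over all times \<open>s\<close> and all net points;
  moving from a net point to \<open>h\<close> costs \<open>K * \<eta>\<close> in the risk and
  \<open>K * \<eta>\<close> in the empirical mean.\<close>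

lemma uniform_deviation:
  assumes p: "1 \<le> p" and j: "1 \<le> j" and v: "v > 0" and \<eta>: "\<eta> > 0"
  obtains Bad where "Bad \<in> events"
    "prob Bad \<le> real (q - p) * real (covering_number E H \<eta>) * (2 * exp (- 2 * v\<^sup>2 * real p / (real (m * j))\<^sup>2))"
    "\<And>\<omega> s h. \<omega> \<in> space M - Bad \<Longrightarrow> s \<in> {p..<q} \<Longrightarrow> h \<in> H \<Longrightarrow>
      \<bar>risk l \<pi> h - (\<Sum>i = 1..s. mean_loss h (X i \<omega>)) / real s\<bar>
        \<le> v + real (m * j) / real p + (1 - \<delta>) ^ j + 2 * K * \<eta>"
proof -
  obtain G where G: "G \<subseteq> H" "finite G" "card G = covering_number E H \<eta>"
    "\<And>h. h \<in> H \<Longrightarrow> \<exists>g\<in>G. mdist (sup_metric E) g h \<le> \<eta>"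
    using covering_number_attained[OF \<eta>] by metis
  define bad where "bad s g = {\<omega>\<in>space M. \<bar>(\<Sum>i = 1..s. mean_loss g (X i \<omega>)) - real s * (\<integral>x. mean_loss g x \<partial>\<pi>)\<bar>
      \<ge> real s * v + real (m * j) + real s * (1 - \<delta>) ^ j}" for s g
  define Bad where "Bad = (\<Union>z\<in>{p..<q} \<times> G. bad (fst z) (snd z))"
  have bad_event: "bad s g \<in> events" if "g \<in> G" for s g
  proof -
    have "(\<lambda>\<omega>. \<Sum>i = 1..s. mean_loss g (X i \<omega>)) \<in> borel_measurable M"
      using that G(1) by (intro borel_measurable_sum measurable_compose[OF X_measurable mean_loss_measurable]) auto
    then show ?thesis unfolding bad_def by measurable
  qed
  have "prob Bad \<le> (\<Sum>z\<in>{p..<q} \<times> G. prob (bad (fst z) (snd z)))"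
    unfolding Bad_def using G(2) bad_event by (intro finite_measure_subadditive_finite) auto
  also have "\<dots> \<le> (\<Sum>z\<in>{p..<q} \<times> G. 2 * exp (- 2 * v\<^sup>2 * real p / (real (m * j))\<^sup>2))"
  proof (rule sum_mono)
    fix z assume "z \<in> {p..<q} \<times> G"
    then obtain s g where z: "z = (s, g)" "p \<le> s" "g \<in> G" by auto
    have s: "1 \<le> s" using p z by simp
    have "prob (bad s g) \<le> 2 * exp (- 2 * (real s * v)\<^sup>2 / (real s * (real (m * j))\<^sup>2))"
      unfolding bad_def using z G(1) s v j mean_loss_measurable mean_loss_range
      by (intro additive_functional_deviation) (auto simp: subset_iff)
    also have "- 2 * (real s * v)\<^sup>2 / (real s * (real (m * j))\<^sup>2) = - (2 * v\<^sup>2 * real s / (real (m * j))\<^sup>2)"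
      using s by (simp add: power2_eq_square mult_ac)
    \<comment> \<open>The exponent improves with \<open>s\<close>, so the earliest time
      \<open>p\<close> is the worst case for all of them.\<close>
    also have "\<dots> \<le> - (2 * v\<^sup>2 * real p / (real (m * j))\<^sup>2)"
      using z(2) by (auto intro!: divide_right_mono mult_left_mono)
    finally show "prob (bad (fst z) (snd z)) \<le> 2 * exp (- 2 * v\<^sup>2 * real p / (real (m * j))\<^sup>2)"
      by (simp add: z)
  qed
  also have "\<dots> = real (q - p) * real (covering_number E H \<eta>) * (2 * exp (- 2 * v\<^sup>2 * real p / (real (m * j))\<^sup>2))"
    by (simp add: card_cartesian_product G(3)[symmetric])
  finally have prob_Bad: "prob Bad \<le> real (q - p) * real (covering_number E H \<eta>) * (2 * exp (- 2 * v\<^sup>2 * real p / (real (m * j))\<^sup>2))" .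
  have dev: "\<bar>risk l \<pi> h - (\<Sum>i = 1..s. mean_loss h (X i \<omega>)) / real s\<bar>
        \<le> v + real (m * j) / real p + (1 - \<delta>) ^ j + 2 * K * \<eta>"
    if \<omega>: "\<omega> \<in> space M - Bad" and s: "s \<in> {p..<q}" and h: "h \<in> H" for \<omega> s h
  proof -
    have s0: "real s > 0" using s p by auto
    obtain g where g: "g \<in> G" "mdist (sup_metric E) g h \<le> \<eta>" using G(4)[OF h] by auto
    then have gH: "g \<in> H" using G(1) by auto
    have Kd: "K * mdist (sup_metric E) g h \<le> K * \<eta>" using g(2) by (intro mult_left_mono K_nonneg)
    have "\<omega> \<notin> bad s g" using \<omega> s g(1) by (auto simp: Bad_def)
    then have "\<bar>(\<Sum>i = 1..s. mean_loss g (X i \<omega>)) - real s * risk l \<pi> g\<bar>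
        \<le> real s * v + real (m * j) + real s * (1 - \<delta>) ^ j"
      using \<omega> gH by (simp add: bad_def risk_eq)
    then have "\<bar>(\<Sum>i = 1..s. mean_loss g (X i \<omega>)) / real s - risk l \<pi> g\<bar>
        \<le> v + real (m * j) / real s + (1 - \<delta>) ^ j"
      using s0 by (simp add: abs_le_iff field_simps)
    moreover have "real (m * j) / real s \<le> real (m * j) / real p"
      using s p by (intro divide_left_mono) auto
    moreover have "\<bar>(\<Sum>i = 1..s. mean_loss g (X i \<omega>)) / real s - (\<Sum>i = 1..s. mean_loss h (X i \<omega>)) / real s\<bar> \<le> K * \<eta>"
    proof -
      have "\<bar>\<Sum>i = 1..s. mean_loss g (X i \<omega>) - mean_loss h (X i \<omega>)\<bar> \<le> (\<Sum>i = 1..s. K * \<eta>)"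
        using \<omega> by (intro order_trans[OF sum_abs sum_mono] order_trans[OF mean_loss_lipschitz[OF gH h] Kd] X_space) auto
      then show ?thesis
        using s0 by (simp add: sum_subtractf diff_divide_distrib[symmetric] abs_div_pos[symmetric] field_simps)
    qed
    moreover have "\<bar>risk l \<pi> g - risk l \<pi> h\<bar> \<le> K * \<eta>"
      using risk_lipschitz[OF gH h] Kd by linarith
    ultimately show ?thesis by linarith
  qed
  have "Bad \<in> events"
    unfolding Bad_def using G(2) bad_event by (intro sets.finite_UN) auto
  then show thesis using prob_Bad dev by (rule that)
qed

text \<open>The bad event is a visit of the chain to \<open>A\<close> at one of the times
  considered. Off it, \<open>rate\<close> applies to the empirical loss of the realized trajectory,
  because \<open>A\<close> does not depend on the function.\<close>

lemma mixing_at_lag: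
  assumes A: "A \<in> null_sets \<pi>" and p: "1 \<le> p"
    and rate: "\<And>x g. x \<in> space E - A \<Longrightarrow> g \<in> borel_measurable E \<Longrightarrow> (\<And>y. y \<in> space E \<Longrightarrow> g y \<in> {0..1}) \<Longrightarrow>
      \<bar>(T ^^ b) g x - (\<integral>y. g y \<partial>\<pi>)\<bar> \<le> r"
  obtains Bad where "Bad \<in> events" "prob Bad \<le> real (q - p) * (1 - \<delta>) ^ ((p - 1) div m)"
    "\<And>\<omega> s. \<omega> \<in> space M - Bad \<Longrightarrow> s \<in> {p..<q} \<Longrightarrow>
      \<bar>(\<integral>y. empirical_loss s (trajectory s \<omega>) y \<partial>\<pi>) - (T ^^ b) (empirical_loss s (trajectory s \<omega>)) (X s \<omega>)\<bar> \<le> r"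
proof -
  define bad where "bad s = {\<omega>\<in>space M. X s \<omega> \<in> A}" for s
  have AE: "A \<in> sets E" using A pi_prob by auto
  have bad_event: "bad s \<in> events" if "1 \<le> s" for s
    unfolding bad_def using measurable_sets[OF X_measurable[OF that] AE] by (simp add: vimage_def Int_def conj_commute)
  have "prob (\<Union>s\<in>{p..<q}. bad s) \<le> (\<Sum>s\<in>{p..<q}. prob (bad s))"
    using p bad_event by (intro finite_measure_subadditive_finite) auto
  also have "\<dots> \<le> (\<Sum>s\<in>{p..<q}. (1 - \<delta>) ^ ((p - 1) div m))"
  proof (rule sum_mono)
    fix s assume s: "s \<in> {p..<q}"
    then have "prob (bad s) \<le> (1 - \<delta>) ^ ((s - 1) div m)"
      using prob_visit_null_set[OF A, of "s - 1"] p by (simp add: bad_def)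
    also have "\<dots> \<le> (1 - \<delta>) ^ ((p - 1) div m)"
      using s \<delta> by (intro power_decreasing div_le_mono) auto
    finally show "prob (bad s) \<le> (1 - \<delta>) ^ ((p - 1) div m)" .
  qed
  finally have 1: "prob (\<Union>s\<in>{p..<q}. bad s) \<le> real (q - p) * (1 - \<delta>) ^ ((p - 1) div m)" by simp
  have 2: "\<bar>(\<integral>y. empirical_loss s (trajectory s \<omega>) y \<partial>\<pi>) - (T ^^ b) (empirical_loss s (trajectory s \<omega>)) (X s \<omega>)\<bar> \<le> r"
    if \<omega>: "\<omega> \<in> space M - (\<Union>s\<in>{p..<q}. bad s)" and s: "s \<in> {p..<q}" for \<omega> s
  proof -
    have "1 \<le> s" "\<omega> \<in> space M" using s p \<omega> by auto
    note sec = predictable_section[OF predictable_empirical_loss this]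
    have "X s \<omega> \<in> space E - A" using \<omega> s X_space[OF \<open>1 \<le> s\<close> \<open>\<omega> \<in> space M\<close>] by (auto simp: bad_def)
    from rate[OF this sec] show ?thesis by (simp add: abs_minus_commute)
  qed
  have "(\<Union>s\<in>{p..<q}. bad s) \<in> events"
    using p bad_event by (intro sets.finite_UN) auto
  then show thesis using 1 2 by (rule that)
qed

text \<open>One bad event for each part of the decomposition: \<open>B1\<close> for the uniform
  deviation, used at \<open>h = hyp \<omega> s\<close>; \<open>B2\<close> for the lag;
  \<open>B3\<close> for the orthogonal sum. The parameters \<open>v\<close>, \<open>\<eta>\<close>,
  \<open>\<tau>\<close> and \<open>j\<close> stay free until the asymptotic choice.\<close>

lemma risk_deviation:
  assumes A: "A \<in> null_sets \<pi>" and p: "1 \<le> p" "p < q" and j: "1 \<le> j"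
    and v: "v > 0" and \<eta>: "\<eta> > 0" and \<tau>: "\<tau> > 0"
    and rate: "\<And>x g. x \<in> space E - A \<Longrightarrow> g \<in> borel_measurable E \<Longrightarrow> (\<And>y. y \<in> space E \<Longrightarrow> g y \<in> {0..1}) \<Longrightarrow>
      \<bar>(T ^^ b) g x - (\<integral>y. g y \<partial>\<pi>)\<bar> \<le> r"
  obtains Bad where "Bad \<in> events"
    "prob Bad \<le> real (q - p) * real (covering_number E H \<eta>) * (2 * exp (- 2 * v\<^sup>2 * real p / (real (m * j))\<^sup>2))
      + real (q - p) * (1 - \<delta>) ^ ((p - 1) div m) + 2 * real b / (real (q - p) * \<tau>\<^sup>2)"
    "\<And>\<omega>. \<omega> \<in> space M - Bad \<Longrightarrow>
      \<bar>\<Sum>s\<in>{p..<q}. risk l \<pi> (hyp \<omega> s) - (\<Sum>i = 1..s. l (hyp \<omega> s) (X (s + b) \<omega>) (X i \<omega>)) / real s\<bar>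
        \<le> real (q - p) * (v + real (m * j) / real p + (1 - \<delta>) ^ j + 2 * K * \<eta> + r + \<tau>)"
proof -
  let ?F = "\<lambda>\<omega> s. empirical_loss s (trajectory s \<omega>)"
  let ?D = "\<lambda>s. lagged_difference b (empirical_loss s) s"
  let ?e = "v + real (m * j) / real p + (1 - \<delta>) ^ j + 2 * K * \<eta>"
  obtain B1 where B1: "B1 \<in> events"
    "prob B1 \<le> real (q - p) * real (covering_number E H \<eta>) * (2 * exp (- 2 * v\<^sup>2 * real p / (real (m * j))\<^sup>2))"
    "\<And>\<omega> s h. \<omega> \<in> space M - B1 \<Longrightarrow> s \<in> {p..<q} \<Longrightarrow> h \<in> H \<Longrightarrow>
      \<bar>risk l \<pi> h - (\<Sum>i = 1..s. mean_loss h (X i \<omega>)) / real s\<bar> \<le> ?e"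
    by (rule uniform_deviation[OF p(1) j v \<eta>, where q=q]) (rule that)
  obtain B2 where B2: "B2 \<in> events" "prob B2 \<le> real (q - p) * (1 - \<delta>) ^ ((p - 1) div m)"
    "\<And>\<omega> s. \<omega> \<in> space M - B2 \<Longrightarrow> s \<in> {p..<q} \<Longrightarrow> \<bar>(\<integral>y. ?F \<omega> s y \<partial>\<pi>) - (T ^^ b) (?F \<omega> s) (X s \<omega>)\<bar> \<le> r"
    by (rule mixing_at_lag[OF A p(1) rate, where q=q]) (assumption | rule that)+
  define B3 where "B3 = {\<omega>\<in>space M. \<bar>\<Sum>s\<in>{p..<q}. ?D s \<omega>\<bar> \<ge> real (q - p) * \<tau>}"
  have "(\<lambda>\<omega>. \<Sum>s\<in>{p..<q}. ?D s \<omega>) \<in> borel_measurable M"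
    using p by (intro borel_measurable_sum
        past_measurable_M[OF lagged_difference_past_measurable[OF predictable_empirical_loss]]) auto
  then have B3: "B3 \<in> events" unfolding B3_def by measurable
  have B3_prob: "prob B3 \<le> 2 * real b / (real (q - p) * \<tau>\<^sup>2)"
    unfolding B3_def by (rule lagged_sum_tail[OF predictable_empirical_loss p \<tau>])
  have "prob (B1 \<union> B2 \<union> B3) \<le> prob B1 + prob B2 + prob B3"
    using measure_Un_le[of "B1 \<union> B2" M B3] measure_Un_le[of B1 M B2] B1(1) B2(1) B3 by simp
  also note B1(2) also note B2(2) also note B3_prob
  finally have prob_Bad: "prob (B1 \<union> B2 \<union> B3) \<le>
      real (q - p) * real (covering_number E H \<eta>) * (2 * exp (- 2 * v\<^sup>2 * real p / (real (m * j))\<^sup>2))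
      + real (q - p) * (1 - \<delta>) ^ ((p - 1) div m) + 2 * real b / (real (q - p) * \<tau>\<^sup>2)" by simp
  have dev: "\<bar>\<Sum>s\<in>{p..<q}. risk l \<pi> (hyp \<omega> s) - (\<Sum>i = 1..s. l (hyp \<omega> s) (X (s + b) \<omega>) (X i \<omega>)) / real s\<bar>
        \<le> real (q - p) * (?e + r + \<tau>)" if \<omega>: "\<omega> \<in> space M - (B1 \<union> B2 \<union> B3)" for \<omega>
  proof -
    have \<omega>M: "\<omega> \<in> space M" using \<omega> by simp
    have "(\<Sum>i = 1..s. l (hyp \<omega> s) (X (s + b) \<omega>) (X i \<omega>)) / real s = ?F \<omega> s (X (s + b) \<omega>)" for s
      unfolding empirical_loss_def hyp_eq by (simp add: trajectory_def cong: sum.cong_simp)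
    then have "(\<Sum>s\<in>{p..<q}. risk l \<pi> (hyp \<omega> s) - (\<Sum>i = 1..s. l (hyp \<omega> s) (X (s + b) \<omega>) (X i \<omega>)) / real s)
        = (\<Sum>s\<in>{p..<q}. (risk l \<pi> (hyp \<omega> s) - (\<integral>y. ?F \<omega> s y \<partial>\<pi>))
          + ((\<integral>y. ?F \<omega> s y \<partial>\<pi>) - (T ^^ b) (?F \<omega> s) (X s \<omega>)) - ?D s \<omega>)"
      by (simp add: lagged_difference_def)
    also have "\<dots> = (\<Sum>s\<in>{p..<q}. (risk l \<pi> (hyp \<omega> s) - (\<integral>y. ?F \<omega> s y \<partial>\<pi>)))
          + (\<Sum>s\<in>{p..<q}. (\<integral>y. ?F \<omega> s y \<partial>\<pi>) - (T ^^ b) (?F \<omega> s) (X s \<omega>)) - (\<Sum>s\<in>{p..<q}. ?D s \<omega>)"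
      by (simp add: sum.distrib sum_subtractf)
    finally have split: "(\<Sum>s\<in>{p..<q}. risk l \<pi> (hyp \<omega> s) - (\<Sum>i = 1..s. l (hyp \<omega> s) (X (s + b) \<omega>) (X i \<omega>)) / real s) = \<dots>" .
    have "\<bar>\<Sum>s\<in>{p..<q}. (risk l \<pi> (hyp \<omega> s) - (\<integral>y. ?F \<omega> s y \<partial>\<pi>))\<bar> \<le> (\<Sum>s\<in>{p..<q}. ?e)"
      using B1(3) \<omega> hyp_in_H[OF \<omega>M]
      by (intro order_trans[OF sum_abs sum_mono]) (simp add: integral_empirical_loss[OF \<omega>M])
    moreover have "\<bar>\<Sum>s\<in>{p..<q}. (\<integral>y. ?F \<omega> s y \<partial>\<pi>) - (T ^^ b) (?F \<omega> s) (X s \<omega>)\<bar> \<le> (\<Sum>s\<in>{p..<q}. r)"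
      using B2(3) \<omega> by (intro order_trans[OF sum_abs sum_mono]) simp
    moreover have "\<bar>\<Sum>s\<in>{p..<q}. ?D s \<omega>\<bar> \<le> real (q - p) * \<tau>"
      using \<omega> by (auto simp: B3_def simp del: of_nat_diff)
    ultimately show ?thesis
      unfolding split sum_constant card_atLeastLessThan distrib_left by argo
  qed
  have "B1 \<union> B2 \<union> B3 \<in> events" using B1(1) B2(1) B3 by blast
  then show thesis using prob_Bad dev by (rule that)
qed

end

section \<open>Events of probability tending to one\<close>

text \<open>The bad sets are required to be measurable because \<open>Q n\<close> need not be an event, and the
  measure of a non-measurable set is \<open>0\<close> by convention.\<close>

definition whp :: "'w measure \<Rightarrow> (nat \<Rightarrow> 'w \<Rightarrow> bool) \<Rightarrow> bool" where
  "whp M Q \<longleftrightarrow> (\<exists>B. (\<forall>n. B n \<in> sets M) \<and> (\<lambda>n. measure M (B n)) \<longlonglongrightarrow> 0 \<and>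
     (\<forall>\<^sub>F n in sequentially. \<forall>\<omega>\<in>space M - B n. Q n \<omega>))"

lemma whpI:
  assumes "\<forall>\<^sub>F n in sequentially. \<exists>B\<in>sets M. measure M B \<le> U n \<and> (\<forall>\<omega>\<in>space M - B. Q n \<omega>)"
    and U: "U \<longlonglongrightarrow> 0"
  shows "whp M Q"
proof -
  define good where "good n B \<longleftrightarrow> B \<in> sets M \<and> measure M B \<le> U n \<and> (\<forall>\<omega>\<in>space M - B. Q n \<omega>)" for n B
  \<comment> \<open>Bad sets are given only for large \<open>n\<close>; the empty set at the other
    indices keeps the whole sequence measurable.\<close>
  define B where "B n = (if Ex (good n) then SOME B. good n B else {})" for n
  have ev: "\<forall>\<^sub>F n in sequentially. good n (B n)"
    using assms(1) by eventually_elim (auto simp: B_def good_def[symmetric] Bex_def intro: someI)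
  have "B n \<in> sets M" for n
  proof (cases "Ex (good n)")
    case True
    then have "good n (B n)" by (simp add: B_def someI_ex)
    then show ?thesis by (simp add: good_def)
  next
    case False
    then have "B n = {}" unfolding B_def by (rule if_not_P)
    then show ?thesis by simp
  qed
  moreover have "(\<lambda>n. measure M (B n)) \<longlonglongrightarrow> 0"
    by (rule tendsto_sandwich[OF _ _ tendsto_const U]) (use ev in \<open>auto simp: good_def elim!: eventually_mono\<close>)
  moreover have "\<forall>\<^sub>F n in sequentially. \<forall>\<omega>\<in>space M - B n. Q n \<omega>"
    using ev by eventually_elim (simp add: good_def)
  ultimately show ?thesis unfolding whp_def by (intro exI[of _ B]) simp
qed

lemma whp_mono:
  assumes "whp M Q" "\<forall>\<^sub>F n in sequentially. \<forall>\<omega>\<in>space M. Q n \<omega> \<longrightarrow> Q' n \<omega>"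
  shows "whp M Q'"
proof -
  obtain B where B: "\<forall>n. B n \<in> sets M" "(\<lambda>n. measure M (B n)) \<longlonglongrightarrow> 0"
    "\<forall>\<^sub>F n in sequentially. \<forall>\<omega>\<in>space M - B n. Q n \<omega>"
    using assms(1) unfolding whp_def by blast
  have "\<forall>\<^sub>F n in sequentially. \<forall>\<omega>\<in>space M - B n. Q' n \<omega>"
    using B(3) assms(2) by eventually_elim simp
  then show ?thesis unfolding whp_def using B(1,2) by blast
qed

lemma whp_conj:
  assumes "whp M Q" "whp M Q'"
  shows "whp M (\<lambda>n \<omega>. Q n \<omega> \<and> Q' n \<omega>)"
proof -
  obtain B where B: "\<And>n. B n \<in> sets M" "(\<lambda>n. measure M (B n)) \<longlonglongrightarrow> 0"
    "\<forall>\<^sub>F n in sequentially. \<forall>\<omega>\<in>space M - B n. Q n \<omega>"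
    using assms(1) unfolding whp_def by blast
  obtain B' where B': "\<And>n. B' n \<in> sets M" "(\<lambda>n. measure M (B' n)) \<longlonglongrightarrow> 0"
    "\<forall>\<^sub>F n in sequentially. \<forall>\<omega>\<in>space M - B' n. Q' n \<omega>"
    using assms(2) unfolding whp_def by blast
  show ?thesis
  proof (rule whpI)
    show "(\<lambda>n. measure M (B n) + measure M (B' n)) \<longlonglongrightarrow> 0" using tendsto_add[OF B(2) B'(2)] by simp
    show "\<forall>\<^sub>F n in sequentially. \<exists>A\<in>sets M. measure M A \<le> measure M (B n) + measure M (B' n) \<and>
        (\<forall>\<omega>\<in>space M - A. Q n \<omega> \<and> Q' n \<omega>)"
      using B(3) B'(3)
    proof eventually_elim
      case (elim n)
      then show ?case
        using measure_Un_le[OF B(1) B'(1), of n n] B(1) B'(1) by (intro bexI[of _ "B n \<union> B' n"]) auto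
    qed
  qed
qed

lemma whp_AE:
  assumes "\<forall>\<^sub>F n in sequentially. AE \<omega> in M. Q n \<omega>"
  shows "whp M Q"
proof (rule whpI)
  show "\<forall>\<^sub>F n in sequentially. \<exists>B\<in>sets M. measure M B \<le> 0 \<and> (\<forall>\<omega>\<in>space M - B. Q n \<omega>)"
    using assms
  proof eventually_elim
    case (elim n)
    obtain N where N: "\<And>\<omega>. \<omega> \<in> space M - N \<Longrightarrow> Q n \<omega>" "N \<in> null_sets M"
      using AE_E3[OF elim] by blast
    then show ?case
      by (intro bexI[of _ N]) (auto simp: null_sets_def measure_def)
  qed
qed simp

text \<open>Monotonicity of the measure needs only the larger set \<open>B n\<close> to be
  measurable, so the bound also covers failure sets that are not events.\<close>

lemma (in prob_space) whp_prob_le: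
  assumes "whp M Q" "\<epsilon> > 0"
  shows "\<forall>\<^sub>F n in sequentially. prob {\<omega>\<in>space M. \<not> Q n \<omega>} < \<epsilon>"
proof -
  obtain B where B: "\<And>n. B n \<in> events" "(\<lambda>n. prob (B n)) \<longlonglongrightarrow> 0"
    "\<forall>\<^sub>F n in sequentially. \<forall>\<omega>\<in>space M - B n. Q n \<omega>"
    using assms(1) unfolding whp_def by blast
  show ?thesis
    using order_tendstoD(2)[OF B(2) assms(2)] B(3)
  proof eventually_elim
    case (elim n)
    have "prob {\<omega>\<in>space M. \<not> Q n \<omega>} \<le> prob (B n)"
      using elim(2) by (intro finite_measure_mono B(1)) blast
    then show ?case using elim(1) by simp
  qed
qed

text \<open>A condition that does not involve \<open>\<omega>\<close> fails with probability 0 or 1,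
  so a failure probability below 1 means that it holds.\<close>

lemma (in prob_space) whp_deterministic:
  assumes "whp M (\<lambda>n _. Q n)"
  shows "\<forall>\<^sub>F n in sequentially. Q n"
  using whp_prob_le[OF assms zero_less_one] 
proof eventually_elim
  case (elim n)
  then show ?case by (cases "Q n") (simp_all add: prob_space)
qed

lemma (in prob_space) negligible_in_probI:
  assumes "\<forall>\<^sub>F n in sequentially. a n > 0"
    and "\<And>\<epsilon>. \<epsilon> > 0 \<Longrightarrow> whp M (\<lambda>n \<omega>. \<bar>Y n \<omega>\<bar> \<le> \<epsilon> * a n)"
  shows "negligible_in_prob M Y a"
  unfolding negligible_in_prob_def
proof (intro allI impI)
  fix \<epsilon> :: real assume "\<epsilon> > 0"
  then have "whp M (\<lambda>n \<omega>. \<bar>Y n \<omega> / a n\<bar> \<le> \<epsilon>)"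
    by (rule whp_mono[OF assms(2)])
      (use assms(1) in \<open>auto elim!: eventually_mono simp: abs_div_pos[symmetric] pos_divide_le_eq\<close>)
  then show "(\<lambda>n. prob {\<omega>\<in>space M. \<bar>Y n \<omega> / a n\<bar> > \<epsilon>}) \<longlonglongrightarrow> 0"
    using whp_prob_le[of "\<lambda>n \<omega>. \<bar>Y n \<omega> / a n\<bar> \<le> \<epsilon>", unfolded not_le]
    by (simp add: tendsto_iff dist_real_def)
qed

section \<open>Asymptotics\<close>

text \<open>\<open>ln n\<close> comes from the union over times and \<open>D * n^\<alpha>\<close>
  from the covering. Both are beaten because \<open>(ln (ln n))^2\<close> is unbounded, whatever the
  ratio of \<open>D\<close> to \<open>a\<close>.\<close>

lemma entropy_exponent_limit:
  fixes \<alpha> D a :: real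
  assumes "\<alpha> > 0" "D > 0" "a > 0"
  shows "(\<lambda>n::nat. 2 * exp (ln (real n) + D * real n powr \<alpha> - a * (ln (ln (real n)))\<^sup>2 * real n powr \<alpha>)) \<longlonglongrightarrow> 0"
  using assms by real_asymp

text \<open>The union over at most \<open>n\<close> times against an exponential decay along blocks
  of length \<open>m\<close>; the final \<open>- 1\<close> accounts for integer division.\<close>

lemma null_set_exponent_limit:
  fixes \<gamma> c m :: real
  assumes "\<gamma> > 0" "c > 0" "m > 0"
  shows "(\<lambda>n::nat. real n * exp (- \<gamma> * ((c * real n - 1) / m - 1))) \<longlonglongrightarrow> 0"
  using assms by real_asymp

lemma variance_limit:
  fixes \<alpha> C :: real
  assumes "\<alpha> > 0"
  shows "(\<lambda>n::nat. C / (ln (real n) * (ln (ln (real n)))\<^sup>2 * real n powr \<alpha>)) \<longlonglongrightarrow> 0"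
  using assms by real_asymp

text \<open>The \<open>ln n / n\<close> term is the boundary cost of the Poisson sum, the
  \<open>1 / n\<close> term gathers the two mixing errors. Both are below the rate because
  \<open>\<kappa> < 1\<close>.\<close>

lemma bias_limit:
  fixes \<kappa> C D :: real
  assumes "0 < \<kappa>" "\<kappa> < 1"
  shows "(\<lambda>n::nat. (C * ln (real n) / real n + D / real n) / (ln (real n) * ln (ln (real n)) / real n powr \<kappa>)) \<longlonglongrightarrow> 0"
  using assms by real_asymp

lemma rate_limit:
  fixes \<kappa> :: real
  assumes "0 < \<kappa>"
  shows "(\<lambda>n::nat. ln (real n) * ln (ln (real n)) / real n powr \<kappa>) \<longlonglongrightarrow> 0"
  using assms by real_asymp


section \<open>Choice of the parameters and the deviation bound with high probability\<close>

context online_learning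
begin

text \<open>Reindexing by \<open>s = t - b n\<close>; as \<open>b n < c n\<close>, the natural
  subtraction never truncates and the inner weight becomes \<open>1 / s\<close>.\<close>

lemma risk_gap_eq:
  assumes "b n < c n" "c n < n"
  shows "average_risk l \<pi> b c g n - paired_empirical_risk l b c g x n
    = (\<Sum>s\<in>{c n - b n..<n - b n}. risk l \<pi> (g s) - (\<Sum>i = 1..s. l (g s) (x (s + b n)) (x i)) / real s)
      / real (n - c n)"
proof -
  have shift: "(\<Sum>t\<in>{c n..<n}. F t) = (\<Sum>s\<in>{c n - b n..<n - b n}. F (s + b n))" for F :: "nat \<Rightarrow> real"
    using sum.shift_bounds_nat_ivl[of F "c n - b n" "b n" "n - b n"] assms by simp
  show ?thesis
    unfolding average_risk_def paired_empirical_risk_def shift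
    using assms by (simp add: sum_subtractf diff_divide_distrib)
qed

lemma risk_deviation_negligible:
  fixes \<rho> \<theta> \<xi> q c \<epsilon> :: real and b\<^sub>n c\<^sub>n :: "nat \<Rightarrow> nat" and rate :: "nat \<Rightarrow> real"
  assumes rho: "ergodicity_rate E P \<pi> \<rho>" and theta: "\<theta> > 0"
    and entropy: "(\<lambda>\<eta>. ln (real (covering_number E H \<eta>))) \<in> O[at_right 0](\<lambda>\<eta>. \<eta> powr (- \<theta>))"
    and xi: "\<xi> > 0" and q: "q = (\<xi> + 1) / ln (1 / \<rho>)"
    and b\<^sub>n: "b\<^sub>n = (\<lambda>n. nat \<lfloor>q * ln (real n)\<rfloor>)"
    and c: "0 < c" "c < 1" and c\<^sub>n: "c\<^sub>n = (\<lambda>n. nat \<lceil>c * real n\<rceil>)"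
    and rate: "rate = (\<lambda>n. ln (real n) * ln (ln (real n)) / real n powr (1 / (2 + \<theta>)))"
    and \<epsilon>: "\<epsilon> > 0"
  shows "whp M (\<lambda>n \<omega>. \<bar>average_risk l \<pi> b\<^sub>n c\<^sub>n (hyp \<omega>) n
    - paired_empirical_risk l b\<^sub>n c\<^sub>n (hyp \<omega>) (\<lambda>i. X i \<omega>) n\<bar> \<le> \<epsilon> * rate n)"
proof -
  define \<kappa> where "\<kappa> = 1 / (2 + \<theta>)"
  \<comment> \<open>By the choice of \<open>\<kappa>\<close> this is also
    \<open>\<kappa> * \<theta>\<close>: the common power of \<open>n\<close> in the Azuma exponent
    and in the entropy bound.\<close>
  define \<alpha> where "\<alpha> = 1 - 2 * \<kappa>"
  define \<gamma> where "\<gamma> = - ln (1 - \<delta>)"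
  \<comment> \<open>\<open>r n\<close> will serve as \<open>v\<close>, \<open>\<eta>\<close> and
    \<open>\<tau>\<close> at once, for a total of \<open>(2 + 2 * K) * r n\<close>. This
    \<open>\<zeta>\<close> makes the total half of the allowed error and leaves the other half to
    \<open>err\<close>.\<close>
  define \<zeta> where "\<zeta> = \<epsilon> / (2 * (2 + 2 * K))"
  define r where "r n = \<zeta> * rate n" for n
  \<comment> \<open>The least number of Doeblin blocks for which
    \<open>(1 - \<delta>) ^ j \<le> 1 / n\<close>.\<close>
  define j where "j n = nat \<lceil>ln (real n) / \<gamma>\<rceil>" for n
  \<comment> \<open>Chosen so that \<open>m * j n\<close> is at most this constant times
    \<open>ln n\<close>; the factor 2 absorbs the ceiling once
    \<open>\<gamma> \<le> ln n\<close>.\<close>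
  define C\<^sub>1 where "C\<^sub>1 = 2 * real m / \<gamma>"
  define \<beta> where "\<beta> = ln (1 / \<rho>)"
  obtain L where L: "L > 0" "\<And>b. \<exists>A\<in>null_sets \<pi>. \<forall>x\<in>space E - A. \<forall>g\<in>borel_measurable E.
      (\<forall>y\<in>space E. g y \<in> {0..1}) \<longrightarrow> \<bar>(T ^^ b) g x - (\<integral>y. g y \<partial>\<pi>)\<bar> \<le> L * \<rho> ^ b"
    by (rule ergodicity_rate_functions[OF rho]) (rule that)
  obtain C where C: "C > 0" "\<forall>\<^sub>F \<eta> in at_right 0. \<bar>ln (real (covering_number E H \<eta>))\<bar> \<le> C * \<eta> powr (- \<theta>)"
    by (rule landau_o.bigE[OF entropy], rule that) simp_all
  have \<rho>: "0 < \<rho>" "\<rho> < 1" using rho by (auto simp: ergodicity_rate_def)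
  have \<beta>: "\<beta> > 0" "ln \<rho> = - \<beta>" using \<rho> by (simp_all add: \<beta>_def ln_div)
  have \<gamma>: "\<gamma> > 0" using \<delta> by (simp add: \<gamma>_def)
  have \<kappa>: "0 < \<kappa>" "\<kappa> < 1" "\<kappa> * \<theta> = \<alpha>" using theta by (auto simp: \<kappa>_def \<alpha>_def field_simps)
  have \<alpha>: "\<alpha> > 0" using \<kappa> theta by (metis mult_pos_pos)
  have \<zeta>: "\<zeta> > 0" "(2 + 2 * K) * \<zeta> = \<epsilon> / 2" using \<epsilon> K_nonneg by (auto simp: \<zeta>_def field_simps)
  have C\<^sub>1: "C\<^sub>1 > 0" using m \<gamma> by (auto simp: C\<^sub>1_def)
  have q_pos: "q > 0" using xi \<beta> by (simp add: q \<beta>_def)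
  have rate': "rate n = ln (real n) * ln (ln (real n)) / real n powr \<kappa>" for n
    by (simp add: rate \<kappa>_def)

  \<comment> \<open>\<open>U\<^sub>1\<close>, \<open>U\<^sub>2\<close>, \<open>U\<^sub>3\<close>
    dominate, in this order, the three summands of the probability bound in
    \<open>risk_deviation\<close>.\<close>
  define U\<^sub>1 where "U\<^sub>1 n = 2 * exp (ln (real n) + C * \<zeta> powr (- \<theta>) * real n powr \<alpha>
      - c * \<zeta>\<^sup>2 / C\<^sub>1\<^sup>2 * (ln (ln (real n)))\<^sup>2 * real n powr \<alpha>)" for n :: nat
  define U\<^sub>2 where "U\<^sub>2 n = real n * exp (- \<gamma> * ((c / 2 * real n - 1) / real m - 1))" for n :: nat
  define U\<^sub>3 where "U\<^sub>3 n = (4 * q / ((1 - c) * \<zeta>\<^sup>2)) / (ln (real n) * (ln (ln (real n)))\<^sup>2 * real n powr \<alpha>)" for n :: nat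
  have U: "(\<lambda>n. U\<^sub>1 n + U\<^sub>2 n + U\<^sub>3 n) \<longlonglongrightarrow> 0"
  proof -
    have "U\<^sub>1 \<longlonglongrightarrow> 0"
      unfolding U\<^sub>1_def[abs_def] using \<alpha> C c \<zeta> C\<^sub>1 by (intro entropy_exponent_limit) auto
    moreover have "U\<^sub>2 \<longlonglongrightarrow> 0"
      unfolding U\<^sub>2_def[abs_def] using \<gamma> c m by (intro null_set_exponent_limit) auto
    moreover have "U\<^sub>3 \<longlonglongrightarrow> 0"
      unfolding U\<^sub>3_def[abs_def] using \<alpha> by (intro variance_limit)
    ultimately have "(\<lambda>n. U\<^sub>1 n + U\<^sub>2 n + U\<^sub>3 n) \<longlonglongrightarrow> 0 + 0 + 0" by (intro tendsto_add)
    then show ?thesis by simp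
  qed

  define err where "err n = (2 * C\<^sub>1 / c) * ln (real n) / real n + (1 + L * exp \<beta>) / real n" for n :: nat
  \<comment> \<open>All requirements on the size of \<open>n\<close> in one predicate, so that the
    estimate itself concerns a single \<open>n\<close>. The entropy bound is known only near 0 and
    is therefore evaluated along \<open>r n\<close>, which tends to 0 from the right.\<close>
  define large where "large n \<longleftrightarrow> 1 \<le> ln (ln (real n)) \<and> max 1 \<gamma> \<le> ln (real n) \<and>
      q * ln (real n) + 1 \<le> c / 2 * real n \<and> 1 \<le> (1 - c) / 2 * real n \<and> 2 \<le> real n \<and>
      \<bar>ln (real (covering_number E H (r n)))\<bar> \<le> C * r n powr (- \<theta>) \<and> err n \<le> \<epsilon> / 2 * rate n" for n
  have large: "\<forall>\<^sub>F n in sequentially. large n"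
    unfolding large_def
  proof (intro eventually_conj)
    show lnln: "\<forall>\<^sub>F n in sequentially. 1 \<le> ln (ln (real n))" by real_asymp
    show ln: "\<forall>\<^sub>F n in sequentially. max 1 \<gamma> \<le> ln (real n)"
      using filterlim_compose[OF ln_at_top filterlim_real_sequentially] unfolding filterlim_at_top by blast
    show "\<forall>\<^sub>F n in sequentially. q * ln (real n) + 1 \<le> c / 2 * real n"
      using c q_pos by real_asymp
    show "\<forall>\<^sub>F n in sequentially. 1 \<le> (1 - c) / 2 * real n"
      using c by real_asymp
    show two: "\<forall>\<^sub>F n in sequentially. 2 \<le> real n" by real_asymp
    have rate_pos: "\<forall>\<^sub>F n in sequentially. rate n > 0"
      using lnln ln two by eventually_elim (unfold rate', intro divide_pos_pos mult_pos_pos, (linarith | simp)+)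
    have "rate \<longlonglongrightarrow> 0" unfolding rate'[abs_def] using \<kappa> by (intro rate_limit)
    then have "(\<lambda>n. \<zeta> * rate n) \<longlonglongrightarrow> \<zeta> * 0" by (intro tendsto_intros)
    then have "filterlim r (at_right 0) sequentially"
      unfolding r_def[abs_def] filterlim_at using rate_pos \<zeta> by (auto elim!: eventually_mono)
    then show "\<forall>\<^sub>F n in sequentially. \<bar>ln (real (covering_number E H (r n)))\<bar> \<le> C * r n powr (- \<theta>)"
      by (rule eventually_compose_filterlim[OF C(2)])
    have "(\<lambda>n. err n / rate n) \<longlonglongrightarrow> 0"
      unfolding err_def rate' using \<kappa> by (intro bias_limit)
    then have "\<forall>\<^sub>F n in sequentially. err n / rate n < \<epsilon> / 2"
      using \<epsilon> by (intro order_tendstoD(2)) auto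
    then show "\<forall>\<^sub>F n in sequentially. err n \<le> \<epsilon> / 2 * rate n"
      using rate_pos by eventually_elim (simp add: field_simps)
  qed

  have bad: "\<exists>Bad\<in>events. prob Bad \<le> U\<^sub>1 n + U\<^sub>2 n + U\<^sub>3 n \<and> (\<forall>\<omega>\<in>space M - Bad.
      \<bar>average_risk l \<pi> b\<^sub>n c\<^sub>n (hyp \<omega>) n - paired_empirical_risk l b\<^sub>n c\<^sub>n (hyp \<omega>) (\<lambda>i. X i \<omega>) n\<bar> \<le> \<epsilon> * rate n)"
    if "large n" for n
  proof -
    define p where "p = c\<^sub>n n - b\<^sub>n n"
    define u where "u = n - b\<^sub>n n"
    have lnln: "1 \<le> ln (ln (real n))" and ln: "1 \<le> ln (real n)" "\<gamma> \<le> ln (real n)"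
      and qc: "q * ln (real n) + 1 \<le> c / 2 * real n" and c1: "1 \<le> (1 - c) / 2 * real n" and n2: "2 \<le> real n"
      and cov: "\<bar>ln (real (covering_number E H (r n)))\<bar> \<le> C * r n powr (- \<theta>)"
      and err: "err n \<le> \<epsilon> / 2 * rate n"
      using that by (auto simp: large_def)
    have b: "real (b\<^sub>n n) \<le> q * ln (real n)" "q * ln (real n) - 1 \<le> real (b\<^sub>n n)"
    proof -
      have "0 \<le> q * ln (real n)" using q_pos ln(1) by simp
      then have "real (b\<^sub>n n) = of_int \<lfloor>q * ln (real n)\<rfloor>" by (simp add: b\<^sub>n)
      then show "real (b\<^sub>n n) \<le> q * ln (real n)" "q * ln (real n) - 1 \<le> real (b\<^sub>n n)" by linarith+
    qed
    have cn: "c * real n \<le> real (c\<^sub>n n)" "real (c\<^sub>n n) \<le> c * real n + 1"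
    proof -
      have "0 \<le> c * real n" using c by simp
      then have "real (c\<^sub>n n) = of_int \<lceil>c * real n\<rceil>" by (simp add: c\<^sub>n)
      then show "c * real n \<le> real (c\<^sub>n n)" "real (c\<^sub>n n) \<le> c * real n + 1" by linarith+
    qed
    have "real (b\<^sub>n n) < real (c\<^sub>n n)" "real (c\<^sub>n n) < real n"
      using b cn qc c1 c n2 by (auto simp: algebra_simps)
    then have bc: "b\<^sub>n n < c\<^sub>n n" "c\<^sub>n n < n" by simp_all
    have p: "1 \<le> p" "p < u" using bc by (auto simp: p_def u_def)
    have up: "u - p = n - c\<^sub>n n" using bc by (simp add: p_def u_def)
    have p_ge: "c / 2 * real n \<le> real p" using bc b cn qc by (simp add: p_def of_nat_diff)
    have up_le: "real (u - p) \<le> real n" unfolding up by simp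
    have up_ge: "(1 - c) / 2 * real n \<le> real (u - p)"
    proof -
      have "real (n - c\<^sub>n n) = real n - real (c\<^sub>n n)" using bc by simp
      moreover have "(1 - c) / 2 * real n = real n / 2 - c * real n / 2"
        by (simp add: diff_divide_distrib left_diff_distrib)
      ultimately show ?thesis unfolding up using cn(2) c1 by linarith
    qed
    have j_ge: "ln (real n) / \<gamma> \<le> real (j n)" and j_le: "real (j n) \<le> ln (real n) / \<gamma> + 1"
    proof -
      have "0 \<le> ln (real n) / \<gamma>" using \<gamma> ln by simp
      then have "real (j n) = of_int \<lceil>ln (real n) / \<gamma>\<rceil>" by (simp add: j_def)
      then show "ln (real n) / \<gamma> \<le> real (j n)" "real (j n) \<le> ln (real n) / \<gamma> + 1" by linarith+
    qed
    have j1: "1 \<le> j n"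
    proof -
      have "0 < ln (real n) / \<gamma>" using ln \<gamma> by simp
      then show ?thesis using j_ge by linarith
    qed
    have mj: "real (m * j n) \<le> C\<^sub>1 * ln (real n)"
    proof -
      have "ln (real n) / \<gamma> + 1 \<le> 2 * ln (real n) / \<gamma>" using ln \<gamma> by (simp add: field_simps)
      then have "real (j n) \<le> 2 * ln (real n) / \<gamma>" using j_le by linarith
      then have "real m * real (j n) \<le> real m * (2 * ln (real n) / \<gamma>)" by (intro mult_left_mono) auto
      then show ?thesis by (simp add: C\<^sub>1_def field_simps)
    qed
    have mj_pos: "0 < real (m * j n)" using m j1 by simp
    have pow_exp: "(1 - \<delta>) ^ k = exp (- \<gamma> * real k)" for k
      using \<delta> by (simp add: \<gamma>_def exp_of_nat_mult mult.commute[of _ "real k"])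
    have mix: "(1 - \<delta>) ^ j n \<le> 1 / real n"
    proof -
      have "ln (real n) \<le> \<gamma> * real (j n)" using j_ge \<gamma> by (simp add: field_simps)
      then have "exp (- \<gamma> * real (j n)) \<le> exp (- ln (real n))" by simp
      then show ?thesis using n2 by (simp add: pow_exp exp_minus inverse_eq_divide)
    qed
    \<comment> \<open>Here \<open>q\<close> takes effect: \<open>\<beta> * q = \<xi> + 1\<close>, so
      \<open>\<rho>\<close> to the power \<open>q * ln n\<close> is at most \<open>1 / n\<close>.
      The factor \<open>exp \<beta>\<close> pays for the floor in the lag.\<close>
    have rho_b: "L * \<rho> ^ b\<^sub>n n \<le> L * exp \<beta> / real n"
    proof -
      have "\<rho> ^ b\<^sub>n n = exp (- \<beta> * real (b\<^sub>n n))"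
        using \<rho> \<beta>(2) by (metis exp_ln exp_of_nat2_mult)
      also have "ln (real n) - \<beta> \<le> \<beta> * real (b\<^sub>n n)"
      proof -
        have "\<beta> * q = \<xi> + 1" using \<beta> by (simp add: q \<beta>_def)
        then have "(\<xi> + 1) * ln (real n) - \<beta> \<le> \<beta> * real (b\<^sub>n n)"
          using mult_left_mono[OF b(2), of \<beta>] \<beta>(1) by (simp add: right_diff_distrib mult.assoc[symmetric])
        moreover have "0 \<le> \<xi> * ln (real n)" using xi ln by simp
        ultimately show ?thesis by (simp add: distrib_right)
      qed
      then have "exp (- \<beta> * real (b\<^sub>n n)) \<le> exp (\<beta> - ln (real n))" by simp
      also have "\<dots> = exp \<beta> / real n" using n2 by (simp add: exp_diff)
      finally show ?thesis using L(1) mult_left_mono[of "\<rho> ^ b\<^sub>n n" "exp \<beta> / real n" L] by simp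
    qed
    have npow: "(real n powr \<kappa>)\<^sup>2 * real n powr \<alpha> = real n"
      using n2 by (simp add: \<alpha>_def power2_eq_square powr_add[symmetric])
    have npow_pos: "real n powr \<kappa> > 0" "real n powr \<alpha> > 0" using n2 by auto
    have rate_ge: "real n powr (- \<kappa>) \<le> rate n"
    proof -
      have "1 * 1 \<le> ln (real n) * ln (ln (real n))" using ln lnln by (intro mult_mono) auto
      then show ?thesis
        using npow_pos by (simp add: rate' powr_minus inverse_eq_divide divide_right_mono)
    qed
    have rate_pos: "rate n > 0" using rate_ge n2 by (smt (verit) powr_gt_zero)
    have r_pos: "r n > 0" using rate_pos \<zeta> by (simp add: r_def)
    have r_sq: "(r n)\<^sup>2 * real n = \<zeta>\<^sup>2 * (ln (real n))\<^sup>2 * (ln (ln (real n)))\<^sup>2 * real n powr \<alpha>"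
    proof -
      have "(r n)\<^sup>2 * (real n powr \<kappa>)\<^sup>2 = \<zeta>\<^sup>2 * (ln (real n))\<^sup>2 * (ln (ln (real n)))\<^sup>2"
        using npow_pos by (simp add: r_def rate' power_mult_distrib power_divide)
      then have "(r n)\<^sup>2 * ((real n powr \<kappa>)\<^sup>2 * real n powr \<alpha>) = \<zeta>\<^sup>2 * (ln (real n))\<^sup>2 * (ln (ln (real n)))\<^sup>2 * real n powr \<alpha>"
        by (simp add: mult.assoc[symmetric])
      then show ?thesis unfolding npow .
    qed
    \<comment> \<open>A negative power reverses the inequality, so the logarithmic factors of the
      rate, being at least 1, may be dropped from the entropy bound.\<close>
    have r_powr: "r n powr (- \<theta>) \<le> \<zeta> powr (- \<theta>) * real n powr \<alpha>"
    proof -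
      have "rate n powr (- \<theta>) \<le> (real n powr (- \<kappa>)) powr (- \<theta>)"
        using theta rate_ge npow_pos n2 by (intro powr_mono2') auto
      also have "\<dots> = real n powr \<alpha>" using \<kappa>(3) by (simp add: powr_powr)
      finally show ?thesis
        using \<zeta> rate_pos by (simp add: r_def powr_mult mult_left_mono)
    qed
    obtain A where A: "A \<in> null_sets \<pi>" "\<forall>x\<in>space E - A. \<forall>g\<in>borel_measurable E.
      (\<forall>y\<in>space E. g y \<in> {0..1}) \<longrightarrow> \<bar>(T ^^ b\<^sub>n n) g x - (\<integral>y. g y \<partial>\<pi>)\<bar> \<le> L * \<rho> ^ b\<^sub>n n"
      by (rule bexE[OF L(2)[of "b\<^sub>n n"]]) (rule that)
    obtain Bad where Bad: "Bad \<in> events"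
      "prob Bad \<le> real (u - p) * real (covering_number E H (r n)) * (2 * exp (- 2 * (r n)\<^sup>2 * real p / (real (m * j n))\<^sup>2))
        + real (u - p) * (1 - \<delta>) ^ ((p - 1) div m) + 2 * real (b\<^sub>n n) / (real (u - p) * (r n)\<^sup>2)"
      "\<And>\<omega>. \<omega> \<in> space M - Bad \<Longrightarrow>
        \<bar>\<Sum>s\<in>{p..<u}. risk l \<pi> (hyp \<omega> s) - (\<Sum>i = 1..s. l (hyp \<omega> s) (X (s + b\<^sub>n n) \<omega>) (X i \<omega>)) / real s\<bar>
        \<le> real (u - p) * (r n + real (m * j n) / real p + (1 - \<delta>) ^ j n + 2 * K * r n + L * \<rho> ^ b\<^sub>n n + r n)"
      by (rule risk_deviation[OF A(1) p j1 r_pos r_pos r_pos, where r="L * \<rho> ^ b\<^sub>n n" and b="b\<^sub>n n"])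
        (use A(2) in blast, rule that)
    have term1: "real (u - p) * real (covering_number E H (r n)) * (2 * exp (- 2 * (r n)\<^sup>2 * real p / (real (m * j n))\<^sup>2)) \<le> U\<^sub>1 n"
    proof -
      have cov_exp: "real (covering_number E H (r n)) \<le> exp (C * \<zeta> powr (- \<theta>) * real n powr \<alpha>)"
      \<comment> \<open>The value 0 is split off because \<open>ln 0 = 0\<close> by convention, and
        \<open>exp (ln x) = x\<close> fails there.\<close>
      proof (cases "covering_number E H (r n) = 0")
        case False
        have "ln (real (covering_number E H (r n))) \<le> C * (\<zeta> powr (- \<theta>) * real n powr \<alpha>)"
          using cov mult_left_mono[OF r_powr, of C] C(1) by linarith
        then have "exp (ln (real (covering_number E H (r n)))) \<le> exp (C * (\<zeta> powr (- \<theta>) * real n powr \<alpha>))" by simp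
        then show ?thesis using False by (simp add: mult.assoc)
      qed simp
      \<comment> \<open>The squared \<open>ln n\<close> in \<open>r n\<close> cancels against the
        one from the range \<open>m * j n\<close>; only \<open>(ln (ln n))^2 * n^\<alpha>\<close> is
        left in the exponent.\<close>
      have "c * \<zeta>\<^sup>2 / C\<^sub>1\<^sup>2 * (ln (ln (real n)))\<^sup>2 * real n powr \<alpha> = 2 * (r n)\<^sup>2 * (c / 2 * real n) / (C\<^sub>1 * ln (real n))\<^sup>2"
      proof -
        have eq: "2 * (r n)\<^sup>2 * (c / 2 * real n) = c * (\<zeta>\<^sup>2 * (ln (real n))\<^sup>2 * (ln (ln (real n)))\<^sup>2 * real n powr \<alpha>)"
          by (simp add: r_sq[symmetric])
        show ?thesis unfolding eq power_mult_distrib using C\<^sub>1 ln by (simp add: field_simps)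
      qed
      also have "\<dots> \<le> 2 * (r n)\<^sup>2 * real p / (real (m * j n))\<^sup>2"
        using p_ge mj mj_pos c m j1 by (intro frac_le mult_left_mono power_mono) auto
      finally have expo: "exp (- 2 * (r n)\<^sup>2 * real p / (real (m * j n))\<^sup>2)
          \<le> exp (- (c * \<zeta>\<^sup>2 / C\<^sub>1\<^sup>2 * (ln (ln (real n)))\<^sup>2 * real n powr \<alpha>))" by simp
      have "real (u - p) * real (covering_number E H (r n)) * (2 * exp (- 2 * (r n)\<^sup>2 * real p / (real (m * j n))\<^sup>2))
          \<le> real n * exp (C * \<zeta> powr (- \<theta>) * real n powr \<alpha>)
            * (2 * exp (- (c * \<zeta>\<^sup>2 / C\<^sub>1\<^sup>2 * (ln (ln (real n)))\<^sup>2 * real n powr \<alpha>)))"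
        by (intro mult_mono up_le cov_exp expo order_refl mult_nonneg_nonneg) auto
      also have "\<dots> = U\<^sub>1 n"
        using n2 by (simp add: U\<^sub>1_def exp_add exp_diff exp_minus field_simps)
      finally show ?thesis .
    qed
    have term2: "real (u - p) * (1 - \<delta>) ^ ((p - 1) div m) \<le> U\<^sub>2 n"
    proof -
      have "real (p - 1) / real m - 1 \<le> real ((p - 1) div m)"
        using floor_divide_of_nat_eq[of "p - 1" m, where 'a=real] by linarith
      moreover have "(c / 2 * real n - 1) / real m \<le> real (p - 1) / real m"
        using p_ge p by (intro divide_right_mono) auto
      ultimately have "\<gamma> * ((c / 2 * real n - 1) / real m - 1) \<le> \<gamma> * real ((p - 1) div m)"
        using \<gamma> by (intro mult_left_mono) auto
      then have "exp (- \<gamma> * real ((p - 1) div m)) \<le> exp (- \<gamma> * ((c / 2 * real n - 1) / real m - 1))" by simp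
      then show ?thesis
        unfolding pow_exp U\<^sub>2_def by (intro mult_mono up_le) auto
    qed
    have term3: "2 * real (b\<^sub>n n) / (real (u - p) * (r n)\<^sup>2) \<le> U\<^sub>3 n"
    proof -
      have "2 * real (b\<^sub>n n) / (real (u - p) * (r n)\<^sup>2) \<le> 2 * (q * ln (real n)) / ((1 - c) / 2 * real n * (r n)\<^sup>2)"
        using b(1) up_ge r_pos c n2 q_pos ln by (intro frac_le mult_left_mono mult_right_mono mult_pos_pos) auto
      also have "(1 - c) / 2 * real n * (r n)\<^sup>2 = (1 - c) / 2 * ((r n)\<^sup>2 * real n)" by simp
      also have "2 * (q * ln (real n)) / \<dots> = U\<^sub>3 n"
      proof -
        have cancel: "2 * (q * x) / (d / 2 * (\<zeta>\<^sup>2 * x\<^sup>2 * y\<^sup>2 * z)) = (4 * q / (d * \<zeta>\<^sup>2)) / (x * y\<^sup>2 * z)"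
          if "x > 0" "y > 0" "z > 0" "d > 0" for x y z d :: real
          using that \<zeta>(1) by (simp add: field_simps power2_eq_square)
        show ?thesis
          unfolding r_sq U\<^sub>3_def by (rule cancel) (use ln lnln npow_pos c in linarith)+
      qed
      finally show ?thesis .
    qed
    have dev: "\<bar>average_risk l \<pi> b\<^sub>n c\<^sub>n (hyp \<omega>) n - paired_empirical_risk l b\<^sub>n c\<^sub>n (hyp \<omega>) (\<lambda>i. X i \<omega>) n\<bar> \<le> \<epsilon> * rate n"
      if "\<omega> \<in> space M - Bad" for \<omega>
    proof -
      let ?S = "\<Sum>s\<in>{p..<u}. risk l \<pi> (hyp \<omega> s) - (\<Sum>i = 1..s. l (hyp \<omega> s) (X (s + b\<^sub>n n) \<omega>) (X i \<omega>)) / real s"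
      let ?e = "r n + real (m * j n) / real p + (1 - \<delta>) ^ j n + 2 * K * r n + L * \<rho> ^ b\<^sub>n n + r n"
      have up_pos: "0 < real (u - p)" using p by simp
      have "\<bar>average_risk l \<pi> b\<^sub>n c\<^sub>n (hyp \<omega>) n - paired_empirical_risk l b\<^sub>n c\<^sub>n (hyp \<omega>) (\<lambda>i. X i \<omega>) n\<bar>
          = \<bar>?S\<bar> / real (u - p)"
        unfolding risk_gap_eq[where b=b\<^sub>n and c=c\<^sub>n and n=n, OF bc] p_def[symmetric] u_def[symmetric] up[symmetric] by simp
      also have "\<dots> \<le> ?e"
        using Bad(3)[OF that] up_pos by (simp only: pos_divide_le_eq) (simp add: mult.commute)
      also have "real (m * j n) / real p \<le> C\<^sub>1 * ln (real n) / (c / 2 * real n)"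
        using mj p_ge c n2 mj_pos by (intro frac_le) auto
      then have "?e \<le> (2 + 2 * K) * r n + err n"
        using mix rho_b c n2 by (simp add: err_def algebra_simps add_divide_distrib)
      also have "\<dots> \<le> \<epsilon> * rate n"
      proof -
        have "(2 + 2 * K) * r n = \<epsilon> / 2 * rate n" unfolding r_def \<zeta>(2)[symmetric] by (simp only: mult.assoc)
        then show ?thesis using err by linarith
      qed
      finally show ?thesis .
    qed
    show ?thesis
      using Bad(1,2) term1 term2 term3 dev by (intro bexI[of _ Bad] conjI ballI) auto
  qed
  show ?thesis
    by (rule whpI[OF eventually_mono[OF large bad] U])
qed

end

section \<open>From the stated hypotheses to the final bounds\<close>

lemma (in markov_kernel) uniformly_ergodic_minorization:
  assumes "uniformly_ergodic E P"
  obtains m :: nat and \<delta> :: real and \<mu> where "1 \<le> m" "0 < \<delta>" "\<delta> < 1" "\<mu> \<in> space (prob_algebra E)"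
    "\<And>x A. x \<in> space E \<Longrightarrow> A \<in> sets E \<Longrightarrow> \<delta> * measure \<mu> A \<le> measure (kernel_power E P m x) A"
proof -
  obtain m \<delta> \<mu> where \<delta>: "\<delta> > 0" and \<mu>: "\<mu> \<in> space (prob_algebra E)"
    and minor: "\<And>x A. x \<in> space E \<Longrightarrow> A \<in> sets E \<Longrightarrow> \<delta> * measure \<mu> A \<le> measure (kernel_power E P m x) A"
    using assms unfolding uniformly_ergodic_def by blast
  \<comment> \<open>Ergodicity permits \<open>\<delta> = 1\<close>, for which
    \<open>ln (1 - \<delta>)\<close> would be useless as a rate. Lowering the constant preserves the
    minorization.\<close>
  define \<delta>' where "\<delta>' = min \<delta> (1 / 2)"
  have \<delta>': "0 < \<delta>'" "\<delta>' < 1" "\<delta>' \<le> \<delta>" using \<delta> by (auto simp: \<delta>'_def)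
  have minor': "\<delta>' * measure \<mu> A \<le> measure (kernel_power E P m x) A" if "x \<in> space E" "A \<in> sets E" for x A
    using minor[OF that] mult_right_mono[OF \<delta>'(3), of "measure \<mu> A"] by simp
  show thesis
  proof (cases "m = 0")
    case False
    then show ?thesis using that[of m \<delta>' \<mu>] \<delta>' \<mu> minor' by simp
  next
    case True
    text \<open>A minorization with \<open>m = 0\<close> forces \<open>\<mu> A = 0\<close> for every measurable \<open>A \<noteq> space E\<close>.\<close>
    have "\<delta>' * measure \<mu> A \<le> measure (kernel_power E P 1 x) A" if x: "x \<in> space E" and A: "A \<in> sets E" for x A
    proof (cases "A = space E")
      case True
      interpret \<mu>: prob_space \<mu> using \<mu> by (simp add: space_prob_algebra)
      have K: "prob_space (kernel_power E P 1 x)" "sets (kernel_power E P 1 x) = sets E"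
        using kernel_power_prob[OF x, of 1] by (auto simp: space_prob_algebra simp del: kernel_power.simps)
      have "measure (kernel_power E P 1 x) A = 1"
        using prob_space.prob_space[OF K(1)] sets_eq_imp_space_eq[OF K(2)] True by simp
      then show ?thesis using \<delta>' \<mu>.prob_le_1[of A] mult_mono[of \<delta>' 1 "measure \<mu> A" 1] by simp
    next
      case False
      then obtain y where "y \<in> space E" "y \<notin> A" using sets.sets_into_space[OF A] by blast
      then have "\<delta>' * measure \<mu> A \<le> 0"
        using minor'[of y A] A \<open>m = 0\<close> by (simp add: measure_return)
      then show ?thesis by (rule order_trans) simp
    qed
    then show ?thesis using that[of 1 \<delta>' \<mu>] \<delta>' \<mu> by simp
  qed
qed

lemma eventually_lag_lt_start:
  fixes q c :: real
  assumes c: "0 < c" "c < 1"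
  shows "\<forall>\<^sub>F n in sequentially. nat \<lfloor>q * ln (real n)\<rfloor> < nat \<lceil>c * real n\<rceil> \<and> nat \<lceil>c * real n\<rceil> < n"
proof -
  have "\<forall>\<^sub>F n::nat in sequentially. \<bar>q\<bar> * ln (real n) < c * real n" using c by real_asymp
  moreover have "\<forall>\<^sub>F n::nat in sequentially. c * real n + 1 < real n" using c by real_asymp
  ultimately show ?thesis
    using eventually_ge_at_top[of 2]
  proof eventually_elim
    case (elim n)
    have "q * ln (real n) \<le> \<bar>q\<bar> * ln (real n)" using elim(3) by (intro mult_right_mono) auto
    then have "real_of_int \<lfloor>q * ln (real n)\<rfloor> < real_of_int \<lceil>c * real n\<rceil>" using elim(1) by linarith
    moreover have "0 < c * real n" using c elim(3) by simp
    moreover have "real_of_int \<lceil>c * real n\<rceil> < real n" using elim(2) by linarith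
    ultimately show ?case by (simp add: zless_nat_conj nat_less_iff)
  qed
qed

theorem theorem4:
  fixes M :: "'w measure" and E :: "'e measure" and P :: "'e \<Rightarrow> 'e measure"
    and X :: "nat \<Rightarrow> 'w \<Rightarrow> 'e" and \<pi> :: "'e measure" and \<rho> :: real
    and H :: "('e \<times> 'e \<Rightarrow> real) set" and \<theta> :: real
    and f :: "'e \<Rightarrow> real" and \<phi> :: "real \<Rightarrow> real \<Rightarrow> real"
    and l :: "('e \<times> 'e \<Rightarrow> real) \<Rightarrow> 'e \<Rightarrow> 'e \<Rightarrow> real"
    and alg :: "nat \<Rightarrow> (nat \<Rightarrow> 'e \<times> real) \<Rightarrow> ('e \<times> 'e \<Rightarrow> real)"
    and hyp :: "'w \<Rightarrow> nat \<Rightarrow> ('e \<times> 'e \<Rightarrow> real)"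
    and \<xi> q c :: real and b\<^sub>n c\<^sub>n :: "nat \<Rightarrow> nat" and rate :: "nat \<Rightarrow> real"
  assumes chain: "markov_chain M E P X"
    and stationary: "stationary_distribution E P \<pi>"
    and reversible: "reversible_kernel E P \<pi>"
    and ergodic: "uniformly_ergodic E P"
    and rho: "ergodicity_rate E P \<pi> \<rho>"
    and H_measurable: "H \<subseteq> borel_measurable (E \<Otimes>\<^sub>M E)"
    and H_compact: "compactin (mtopology_of (sup_metric E)) H"
    and theta: "\<theta> > 0"
    and entropy: "(\<lambda>\<eta>. ln (real (covering_number E H \<eta>))) \<in> O[at_right 0](\<lambda>\<eta>. \<eta> powr (- \<theta>))"
    and f_measurable: "f \<in> borel_measurable E"
    and phi_measurable: "(\<lambda>(u, v). \<phi> u v) \<in> borel_measurable (borel \<Otimes>\<^sub>M borel)"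
    and phi_range: "\<And>u v. \<phi> u v \<in> {0..1}"
    and phi_lipschitz: "\<exists>K. \<forall>u. K-lipschitz_on UNIV (\<phi> u)"
    and loss: "l = pair_loss \<phi> f"
    and algorithm: "online_algorithm E H alg"
    and hypotheses: "hyp = generated_hypothesis alg f X"
    and xi: "\<xi> > 0"
    and q: "q = (\<xi> + 1) / ln (1 / \<rho>)"
    and b\<^sub>n: "b\<^sub>n = (\<lambda>n. nat \<lfloor>q * ln (real n)\<rfloor>)"
    and c: "0 < c" "c < 1"
    and c\<^sub>n: "c\<^sub>n = (\<lambda>n. nat \<lceil>c * real n\<rceil>)"
    and rate: "rate = (\<lambda>n. ln (real n) * ln (ln (real n)) / real n powr (1 / (2 + \<theta>)))"
  shows "negligible_in_prob M
           (\<lambda>n \<omega>. \<bar>average_risk l \<pi> b\<^sub>n c\<^sub>n (hyp \<omega>) n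
                    - paired_empirical_risk l b\<^sub>n c\<^sub>n (hyp \<omega>) (\<lambda>i. X i \<omega>) n\<bar>)
           rate \<and>
         (\<forall>R h_opt.
            regret_bound M l b\<^sub>n c\<^sub>n H X hyp R \<longrightarrow> is_arg_min (risk l \<pi>) (\<lambda>h. h \<in> H) h_opt \<longrightarrow>
              negligible_in_prob M
                (\<lambda>n \<omega>. max 0 (average_risk l \<pi> b\<^sub>n c\<^sub>n (hyp \<omega>) n - risk l \<pi> h_opt - R n))
                rate \<and>
              bounded_in_prob M
                (\<lambda>n \<omega>. average_risk l \<pi> b\<^sub>n c\<^sub>n (hyp \<omega>) n - risk l \<pi> h_opt)
                (\<lambda>n. rate n + R n))"
proof -
  interpret prob_space M using chain by (simp add: markov_chain_def)
  interpret markov_process M E P X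
    using chain by unfold_locales (simp_all add: markov_chain_def)
  obtain m \<delta> \<mu> where minor: "1 \<le> (m::nat)" "0 < (\<delta>::real)" "\<delta> < 1" "\<mu> \<in> space (prob_algebra E)"
    "\<And>x A. x \<in> space E \<Longrightarrow> A \<in> sets E \<Longrightarrow> \<delta> * measure \<mu> A \<le> measure (kernel_power E P m x) A"
    by (rule uniformly_ergodic_minorization[OF ergodic]) (rule that)
  obtain K where K: "\<And>u. K-lipschitz_on UNIV (\<phi> u)" using phi_lipschitz by blast
  interpret loss_class E H f \<phi> K
    using H_measurable H_compact f_measurable phi_measurable phi_range K by unfold_locales
  have learning: "online_learning M E P X \<pi> \<mu> \<delta> m H f \<phi> K A" if "online_algorithm E H A" for A
    using stationary minor that by unfold_locales
  have deviation: "whp M (\<lambda>n \<omega>. \<bar>average_risk l \<pi> b\<^sub>n c\<^sub>n (generated_hypothesis A f X \<omega>) n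
          - paired_empirical_risk l b\<^sub>n c\<^sub>n (generated_hypothesis A f X \<omega>) (\<lambda>i. X i \<omega>) n\<bar> \<le> \<epsilon> * rate n)"
    if A: "online_algorithm E H A" and \<epsilon>: "\<epsilon> > 0" for A \<epsilon>
  proof -
    interpret A: online_learning M E P X \<pi> \<mu> \<delta> m H f \<phi> K A by (rule learning[OF A])
    show ?thesis
      unfolding loss
      by (rule A.risk_deviation_negligible[OF rho theta entropy xi q b\<^sub>n c c\<^sub>n rate \<epsilon>])
  qed
  have rate_pos: "\<forall>\<^sub>F n in sequentially. rate n > 0"
    unfolding rate using theta by real_asymp
  have lags: "\<forall>\<^sub>F n in sequentially. b\<^sub>n n < c\<^sub>n n \<and> c\<^sub>n n < n"
    unfolding b\<^sub>n c\<^sub>n by (rule eventually_lag_lt_start[OF c])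

  have first: "negligible_in_prob M
      (\<lambda>n \<omega>. \<bar>average_risk l \<pi> b\<^sub>n c\<^sub>n (hyp \<omega>) n - paired_empirical_risk l b\<^sub>n c\<^sub>n (hyp \<omega>) (\<lambda>i. X i \<omega>) n\<bar>) rate"
    unfolding hypotheses using deviation[OF algorithm] by (intro negligible_in_probI rate_pos) simp

  \<comment> \<open>The regret hypothesis gives only an upper estimate, hence the positive part
    beyond \<open>R n\<close> in the first half. Tightness of the ratio also uses that the excess
    risk is nonnegative.\<close>
  have second: "negligible_in_prob M
        (\<lambda>n \<omega>. max 0 (average_risk l \<pi> b\<^sub>n c\<^sub>n (hyp \<omega>) n - risk l \<pi> h_opt - R n)) rate \<and>
      bounded_in_prob M (\<lambda>n \<omega>. average_risk l \<pi> b\<^sub>n c\<^sub>n (hyp \<omega>) n - risk l \<pi> h_opt) (\<lambda>n. rate n + R n)"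
    if regret: "regret_bound M l b\<^sub>n c\<^sub>n H X hyp R" and opt: "is_arg_min (risk l \<pi>) (\<lambda>h. h \<in> H) h_opt"
    for R h_opt
  proof -
    let ?Y = "\<lambda>n \<omega>. average_risk l \<pi> b\<^sub>n c\<^sub>n (hyp \<omega>) n - risk l \<pi> h_opt"
    have opt_H: "h_opt \<in> H" and opt_le: "\<And>h. h \<in> H \<Longrightarrow> risk l \<pi> h_opt \<le> risk l \<pi> h"
      using opt by (auto simp: is_arg_min_def not_less)
    have const: "online_algorithm E H (\<lambda>_ _. h_opt)"
      using opt_H by (simp add: online_algorithm_def)
    have const_hyp: "generated_hypothesis (\<lambda>_ _. h_opt) f X \<omega> = (\<lambda>_. h_opt)" for \<omega>
      by (simp add: generated_hypothesis_def fun_eq_iff)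
    have const_risk: "average_risk l \<pi> b\<^sub>n c\<^sub>n (\<lambda>_. h_opt) n = risk l \<pi> h_opt" if "c\<^sub>n n < n" for n
      using that by (simp add: average_risk_def of_nat_diff)
    have hyp_H: "hyp \<omega> s \<in> H" if "\<omega> \<in> space M" for \<omega> s
    proof -
      interpret A: online_learning M E P X \<pi> \<mu> \<delta> m H f \<phi> K alg by (rule learning[OF algorithm])
      show ?thesis unfolding hypotheses by (rule A.hyp_in_H[OF that])
    qed
    have excess_nonneg: "0 \<le> ?Y n \<omega>" if n: "c\<^sub>n n < n" and \<omega>: "\<omega> \<in> space M" for n \<omega>
    proof -
      have "(\<Sum>t\<in>{c\<^sub>n n..<n}. risk l \<pi> h_opt) \<le> (\<Sum>t\<in>{c\<^sub>n n..<n}. risk l \<pi> (hyp \<omega> (t - b\<^sub>n n)))"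
        by (intro sum_mono opt_le hyp_H \<omega>)
      then have "average_risk l \<pi> b\<^sub>n c\<^sub>n (\<lambda>_. h_opt) n \<le> average_risk l \<pi> b\<^sub>n c\<^sub>n (hyp \<omega>) n"
        unfolding average_risk_def using n by (intro mult_left_mono) auto
      then show ?thesis using const_risk[OF n] by simp
    qed
    \<comment> \<open>Supplies the lower bound without which the infimum over \<open>H\<close> in
      the regret hypothesis could not be compared with its value at \<open>h_opt\<close>.\<close>
    have paired_nonneg: "0 \<le> paired_empirical_risk l b\<^sub>n c\<^sub>n g x n" if "b\<^sub>n n < c\<^sub>n n" "c\<^sub>n n < n" for g x n
    proof -
      have "0 \<le> l h y z" for h y z using loss_range unfolding loss by auto
      then show ?thesis
        unfolding paired_empirical_risk_def using that by (intro mult_nonneg_nonneg sum_nonneg) auto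
    qed
    have regret_whp: "whp M (\<lambda>n \<omega>. paired_empirical_risk l b\<^sub>n c\<^sub>n (hyp \<omega>) (\<lambda>i. X i \<omega>) n
        \<le> (INF h\<in>H. paired_empirical_risk l b\<^sub>n c\<^sub>n (\<lambda>_. h) (\<lambda>i. X i \<omega>) n) + R n)"
      using regret unfolding regret_bound_def by (intro whp_AE eventually_mono[OF lags]) auto
    \<comment> \<open>Each of the two deviations takes \<open>\<epsilon> / 2\<close>: the average
      risk of the learner is close to its paired risk, which is at most the infimum plus
      \<open>R n\<close>, hence at most the paired risk of the constant \<open>h_opt\<close> plus
      \<open>R n\<close>, and that is close to the optimal risk.\<close>
    have excess: "whp M (\<lambda>n \<omega>. ?Y n \<omega> - R n \<le> \<epsilon> * rate n)" if \<epsilon>: "\<epsilon> > 0" for \<epsilon>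
    proof (rule whp_mono[OF whp_conj[OF whp_conj[OF deviation[OF algorithm half_gt_zero[OF \<epsilon>], folded hypotheses]
            deviation[OF const half_gt_zero[OF \<epsilon>], unfolded const_hyp]] regret_whp]])
      show "\<forall>\<^sub>F n in sequentially. \<forall>\<omega>\<in>space M.
        (\<bar>average_risk l \<pi> b\<^sub>n c\<^sub>n (hyp \<omega>) n
            - paired_empirical_risk l b\<^sub>n c\<^sub>n (hyp \<omega>) (\<lambda>i. X i \<omega>) n\<bar> \<le> \<epsilon> / 2 * rate n \<and>
         \<bar>average_risk l \<pi> b\<^sub>n c\<^sub>n (\<lambda>_. h_opt) n
            - paired_empirical_risk l b\<^sub>n c\<^sub>n (\<lambda>_. h_opt) (\<lambda>i. X i \<omega>) n\<bar> \<le> \<epsilon> / 2 * rate n) \<and>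
        paired_empirical_risk l b\<^sub>n c\<^sub>n (hyp \<omega>) (\<lambda>i. X i \<omega>) n
          \<le> (INF h\<in>H. paired_empirical_risk l b\<^sub>n c\<^sub>n (\<lambda>_. h) (\<lambda>i. X i \<omega>) n) + R n
        \<longrightarrow> ?Y n \<omega> - R n \<le> \<epsilon> * rate n"
        using lags
      proof (eventually_elim, intro ballI impI)
        fix n \<omega> assume n: "b\<^sub>n n < c\<^sub>n n \<and> c\<^sub>n n < n"
        have "(INF h\<in>H. paired_empirical_risk l b\<^sub>n c\<^sub>n (\<lambda>_. h) (\<lambda>i. X i \<omega>) n)
            \<le> paired_empirical_risk l b\<^sub>n c\<^sub>n (\<lambda>_. h_opt) (\<lambda>i. X i \<omega>) n"
          using n by (intro cINF_lower[OF _ opt_H] bdd_belowI2[where m=0] paired_nonneg) auto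
        moreover assume "(\<bar>average_risk l \<pi> b\<^sub>n c\<^sub>n (hyp \<omega>) n
            - paired_empirical_risk l b\<^sub>n c\<^sub>n (hyp \<omega>) (\<lambda>i. X i \<omega>) n\<bar> \<le> \<epsilon> / 2 * rate n \<and>
         \<bar>average_risk l \<pi> b\<^sub>n c\<^sub>n (\<lambda>_. h_opt) n
            - paired_empirical_risk l b\<^sub>n c\<^sub>n (\<lambda>_. h_opt) (\<lambda>i. X i \<omega>) n\<bar> \<le> \<epsilon> / 2 * rate n) \<and>
        paired_empirical_risk l b\<^sub>n c\<^sub>n (hyp \<omega>) (\<lambda>i. X i \<omega>) n
          \<le> (INF h\<in>H. paired_empirical_risk l b\<^sub>n c\<^sub>n (\<lambda>_. h) (\<lambda>i. X i \<omega>) n) + R n"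
        ultimately show "?Y n \<omega> - R n \<le> \<epsilon> * rate n"
          unfolding const_risk[OF conjunct2[OF n]] by linarith
      qed
    qed
    have "negligible_in_prob M (\<lambda>n \<omega>. max 0 (?Y n \<omega> - R n)) rate"
    proof (rule negligible_in_probI[OF rate_pos])
      fix \<epsilon> :: real assume \<epsilon>: "\<epsilon> > 0"
      show "whp M (\<lambda>n \<omega>. \<bar>max 0 (?Y n \<omega> - R n)\<bar> \<le> \<epsilon> * rate n)"
      proof (rule whp_mono[OF excess[OF \<epsilon>] eventually_mono[OF rate_pos]], intro ballI impI)
        fix n \<omega> assume "rate n > 0" "?Y n \<omega> - R n \<le> \<epsilon> * rate n"
        moreover from this have "0 \<le> \<epsilon> * rate n" using \<epsilon> by simp
        ultimately show "\<bar>max 0 (?Y n \<omega> - R n)\<bar> \<le> \<epsilon> * rate n" by linarith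
      qed
    qed
    moreover have "bounded_in_prob M ?Y (\<lambda>n. rate n + R n)"
    proof -
      \<comment> \<open>The value \<open>1 / 2\<close> spends only half of the rate: the other half
        keeps the denominator \<open>rate n + R n\<close> positive, and the ratio is then bounded by
        1, the witness used for tightness.\<close>
      have bounds: "whp M (\<lambda>n \<omega>. 0 \<le> ?Y n \<omega> \<and> ?Y n \<omega> - R n \<le> 1 / 2 * rate n)"
        by (rule whp_mono[OF excess[of "1 / 2"]]) (use lags excess_nonneg in \<open>auto elim!: eventually_mono\<close>)
      text \<open>The regret bound is deterministic, so the nonnegativity of the excess risk forces
        \<open>R n \<ge> - rate n / 2\<close> for large \<open>n\<close>; a negative \<open>R\<close> is therefore harmless.\<close>
      have "whp M (\<lambda>n _. rate n / 2 \<le> rate n + R n)"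
        by (rule whp_mono[OF bounds]) (intro always_eventually allI ballI impI; linarith)
      then have pos: "\<forall>\<^sub>F n in sequentially. rate n / 2 \<le> rate n + R n" by (rule whp_deterministic)
      have "whp M (\<lambda>n \<omega>. \<bar>?Y n \<omega> / (rate n + R n)\<bar> \<le> 1)"
      proof (rule whp_mono[OF bounds], use pos rate_pos in eventually_elim, intro ballI impI)
        fix n \<omega>
        assume *: "rate n / 2 \<le> rate n + R n" "rate n > 0" "0 \<le> ?Y n \<omega> \<and> ?Y n \<omega> - R n \<le> 1 / 2 * rate n"
        then have "0 < rate n + R n" "?Y n \<omega> \<le> rate n + R n" by linarith+
        then show "\<bar>?Y n \<omega> / (rate n + R n)\<bar> \<le> 1" using *(3) by simp
      qed
      from whp_prob_le[OF this, unfolded not_le] have ratio: "\<forall>\<^sub>F n in sequentially.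
          prob {\<omega>\<in>space M. 1 < \<bar>?Y n \<omega> / (rate n + R n)\<bar>} < \<epsilon>" if "\<epsilon> > 0" for \<epsilon>
        using that by blast
      show ?thesis
        unfolding bounded_in_prob_def
        by (intro allI impI exI[of _ 1] eventually_mono[OF ratio] less_imp_le)
    qed
    ultimately show ?thesis by blast
  qed
  show ?thesis using first second by blast
qed

end
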